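(* Let $q\ge 2$ be an integer and let $\mathcal{T}_{q+1}$ be the $(q+1)$-regular tree, with vertex set $V$, set of oriented edges $\mathbb{E}$ and graph distance $d$. (i) The kernel defined on $V$ by $$\Psi:(x,y)\mapsto d(x,y)-\frac{2q}{q^2-1}+\frac{2q}{q^2-1}\cdot q^{-d(x,y)}$$ is conditionally of negative type. (ii) Let $G$ be a closed non-compact subgroup of $\mathrm{Aut}(\mathcal{T}_{q+1})$ acting transitively on the vertices and on the boundary of $\mathcal{T}_{q+1}$, and choose a basepoint $x_0\in V$. For $g\in G$, set $|g|:=d(x_0,gx_0)$. Then the function on $G$ defined by $$g\mapsto\Psi(gx_0,x_0)=|g|+\frac{2q}{q^2-1}\left(q^{-|g|}-1\right)$$ is the unique (up to multiplication by a positive scalar) pure negative type function in $\mathrm{CL}(G)$ which is unbounded on $G$ and identically $0$ on the stabiliser $G_{x_0}$ of $x_0$. (iii) With $G$ and $x_0$ as in (ii), let $\tilde b(g)=(1-Q)\chi_{x_0\to gx_0}$, $g\in G$, be the projection of the Haagerup cocycle $g\mapsto\chi_{x_0\to gx_0}$ onto the closed invariant subspace $\ker\nabla^*$ of $\ell^2_{\mathrm{alt}}(\mathbb{E})$. Then the cocycle $\tilde b$ coincides with the harmonic, non-constant $G$-equivariant map $F:V\to\mathcal{H}$ given by the unique irreducible unitary representation $\sigma^-$ of $G$ with $H^1(G,\sigma^-)\neq0$ (the construction of $F$ is recalled in the context).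
   Context: A kernel $\Psi:W\times W\to\mathbb{R}$ on a set $W$ is conditionally of negative type if $\Psi(x,x)=0$ for all $x$, $\Psi(x,y)=\Psi(y,x)$ for all $x,y$, and $\sum_{i,j}\alpha_i\alpha_j\Psi(x_i,x_j)\le 0$ for all $x_1,\dots,x_n\in W$ and all real $\alpha_1,\dots,\alpha_n$ with $\sum_i\alpha_i=0$. A continuous function $\psi:G\to\mathbb{R}$ on a topological group is conditionally of negative type if the kernel $(g,h)\mapsto\psi(g^{-1}h)$ is. $\mathrm{CL}(G)$ is the convex positive cone of these functions; $\psi\in\mathrm{CL}(G)$ is pure if it lies on an extremal ray of $\mathrm{CL}(G)$. For a continuous unitary (or orthogonal) representation $\pi$ of $G$ on a Hilbert space $\mathcal{H}$, a cocycle is a continuous map $b:G\to\mathcal{H}$ with $b(gh)=\pi(g)b(h)+b(g)$; a coboundary is a cocycle $g\mapsto(\pi(g)-1)v$ with $v\in\mathcal{H}$; $H^1(G,\pi)$ is the quotient of cocycles by coboundaries. A cocycle $b$ vanishing on $K=G_{x_0}$ factors through $G/K=V$ and is thereby regarded as the map $F:V\to\mathcal{H}$, $F(gx_0)=b(g)$, which is $G$-equivariant for the affine isometric action $v\mapsto\pi(g)v+b(g)$. A map $F:V\to\mathcal{H}$ is harmonic if $\frac{1}{q+1}\sum_{y\sim x}F(y)=F(x)$ for all $x\in V$. The map $F$ in (iii): by a theorem of Nebbia, $G$ has a unique irreducible unitary representation $\sigma^-$ with $H^1(G,\sigma^-)\neq0$, and $H^1(G,\sigma^-)$ has complex dimension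 $1$. Let $\mathcal{H}$ be the space of $\sigma^-$ and let $b$ be an unbounded cocycle for $\sigma^-$ vanishing on $K$ (unique up to scalar multiplication); $F$ is defined by $F(gx_0)=b(g)$, and it is harmonic and non-constant. Each oriented edge $e\in\mathbb{E}$ has source $e_-$, range $e_+$ and reverse $\overline e$. $\ell^2_{\mathrm{alt}}(\mathbb{E})$ is the real Hilbert space of square-summable $\xi:\mathbb{E}\to\mathbb{R}$ with $\xi(\overline e)=-\xi(e)$, with $\langle\xi,\eta\rangle=\frac12\sum_{e\in\mathbb{E}}\xi(e)\eta(e)$; $G$ acts on it by the orthogonal representation induced by its action on the tree. On the space $\ell^2(V,\deg)$ of square-summable real functions on $V$ with $(f,g)=\sum_{x}f(x)g(x)\deg(x)$, the gradient is $(\nabla f)(e)=f(e_+)-f(e_-)$, with adjoint $(\nabla^*u)(x)=\frac{1}{\deg(x)}\sum_{y\sim x}u(y,x)$. $Q$ is the orthogonal projection of $\ell^2_{\mathrm{alt}}(\mathbb{E})$ onto the closed subspace $\mathrm{im}\,\nabla=(\ker\nabla^* )^\perp$. $\chi_{x\to y}(e)$ equals $1$ (resp. $-1$) if $e$ is on the geodesic $[x,y]$ and points from $x$ to $y$ (resp. from $y$ to $x$), and $0$ otherwise. *)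

theory Defs
  imports "HOL-Analysis.Analysis" "HOL-Algebra.Group"
begin

section \<open>Trees\<close>

text \<open>A graph on the vertex set \<^term>\<open>UNIV :: 'v set\<close> is given by its adjacency relation;
  the oriented edge \<open>e\<close> with source \<open>x\<close> and range \<open>y\<close> is the pair \<open>(x, y)\<close>.\<close>

definition is_tree :: "('v \<Rightarrow> 'v \<Rightarrow> bool) \<Rightarrow> bool" where
  "is_tree adj \<longleftrightarrow> symp adj \<and> irreflp adj \<and> (\<forall>x y. adj\<^sup>*\<^sup>* x y) \<and>
     (\<nexists>c. length c \<ge> 3 \<and> distinct c \<and> successively adj c \<and> adj (last c) (hd c))"

definition deg :: "('v \<Rightarrow> 'v \<Rightarrow> bool) \<Rightarrow> 'v \<Rightarrow> nat" where
  "deg adj x = card {y. adj x y}"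

definition regular_tree :: "nat \<Rightarrow> ('v \<Rightarrow> 'v \<Rightarrow> bool) \<Rightarrow> bool" where
  "regular_tree k adj \<longleftrightarrow> is_tree adj \<and> (\<forall>x. finite {y. adj x y} \<and> deg adj x = k)"

definition gdist :: "('v \<Rightarrow> 'v \<Rightarrow> bool) \<Rightarrow> 'v \<Rightarrow> 'v \<Rightarrow> nat" where
  "gdist adj x y = (LEAST n. (adj ^^ n) x y)"

definition geodesic :: "('v \<Rightarrow> 'v \<Rightarrow> bool) \<Rightarrow> 'v \<Rightarrow> 'v \<Rightarrow> 'v list \<Rightarrow> bool" where
  "geodesic adj x y p \<longleftrightarrow>
     successively adj p \<and> length p = Suc (gdist adj x y) \<and> hd p = x \<and> last p = y"

definition geodesic_ray :: "('v \<Rightarrow> 'v \<Rightarrow> bool) \<Rightarrow> (nat \<Rightarrow> 'v) \<Rightarrow> bool" where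
  "geodesic_ray adj r \<longleftrightarrow> (\<forall>m n. gdist adj (r m) (r (m + n)) = n)"

definition boundary :: "('v \<Rightarrow> 'v \<Rightarrow> bool) \<Rightarrow> (nat \<Rightarrow> 'v) set set" where
  "boundary adj = Collect (geodesic_ray adj) //
     {(r, s). geodesic_ray adj r \<and> geodesic_ray adj s \<and> (\<exists>m k. \<forall>n. r (m + n) = s (k + n))}"

definition tree_aut :: "('v \<Rightarrow> 'v \<Rightarrow> bool) \<Rightarrow> ('v \<Rightarrow> 'v) set" where
  "tree_aut adj = {g. bij g \<and> (\<forall>x y. adj (g x) (g y) \<longleftrightarrow> adj x y)}"

definition aut_group :: "('v \<Rightarrow> 'v \<Rightarrow> bool) \<Rightarrow> ('v \<Rightarrow> 'v) monoid" where
  "aut_group adj = \<lparr>carrier = tree_aut adj, mult = (\<circ>), one = id\<rparr>"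

text \<open>The topology of pointwise convergence, for the discrete topology on the vertices.\<close>

definition aut_topology :: "('v \<Rightarrow> 'v \<Rightarrow> bool) \<Rightarrow> ('v \<Rightarrow> 'v) topology" where
  "aut_topology adj =
     subtopology (product_topology (\<lambda>_. discrete_topology UNIV) UNIV) (tree_aut adj)"

definition vertex_transitive :: "('v \<Rightarrow> 'v) set \<Rightarrow> bool" where
  "vertex_transitive G \<longleftrightarrow> (\<forall>x y. \<exists>g\<in>G. g x = y)"

definition boundary_transitive :: "('v \<Rightarrow> 'v \<Rightarrow> bool) \<Rightarrow> ('v \<Rightarrow> 'v) set \<Rightarrow> bool" where
  "boundary_transitive adj G \<longleftrightarrow>
     (\<forall>\<xi>\<in>boundary adj. \<forall>\<eta>\<in>boundary adj. \<exists>g\<in>G. (\<lambda>r. g \<circ> r) ` \<xi> = \<eta>)"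


section \<open>Functions conditionally of negative type\<close>

definition cond_neg_type_kernel :: "'w set \<Rightarrow> ('w \<Rightarrow> 'w \<Rightarrow> real) \<Rightarrow> bool" where
  "cond_neg_type_kernel W \<Psi> \<longleftrightarrow>
     (\<forall>x\<in>W. \<Psi> x x = 0) \<and> (\<forall>x\<in>W. \<forall>y\<in>W. \<Psi> x y = \<Psi> y x) \<and>
     (\<forall>(n::nat) x \<alpha>. (\<forall>i<n. x i \<in> W) \<and> (\<Sum>i<n. \<alpha> i) = 0 \<longrightarrow>
        (\<Sum>i<n. \<Sum>j<n. \<alpha> i * \<alpha> j * \<Psi> (x i) (x j)) \<le> 0)"

text \<open>In what follows \<open>\<G>\<close> is a group with topology \<open>X\<close> on its carrier. Functions on the group
  are HOL functions of which only the values on the carrier matter, so they are compared there.\<close>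

definition CL :: "('g, 'm) monoid_scheme \<Rightarrow> 'g topology \<Rightarrow> ('g \<Rightarrow> real) set" where
  "CL \<G> X = {\<psi>. continuous_map X euclideanreal \<psi> \<and>
     cond_neg_type_kernel (carrier \<G>) (\<lambda>g h. \<psi> (m_inv \<G> g \<otimes>\<^bsub>\<G>\<^esub> h))}"

text \<open>The ray through \<open>\<psi> \<noteq> 0\<close> is extremal: the summands of any decomposition of \<open>\<psi>\<close> within
  the cone are nonnegative multiples of \<open>\<psi>\<close>.\<close>

definition pure :: "('g, 'm) monoid_scheme \<Rightarrow> 'g topology \<Rightarrow> ('g \<Rightarrow> real) \<Rightarrow> bool" where
  "pure \<G> X \<psi> \<longleftrightarrow> \<psi> \<in> CL \<G> X \<and> (\<exists>g\<in>carrier \<G>. \<psi> g \<noteq> 0) \<and>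
     (\<forall>\<psi>\<^sub>1\<in>CL \<G> X. \<forall>\<psi>\<^sub>2\<in>CL \<G> X. (\<forall>g\<in>carrier \<G>. \<psi> g = \<psi>\<^sub>1 g + \<psi>\<^sub>2 g) \<longrightarrow>
        (\<exists>t\<ge>0. \<forall>g\<in>carrier \<G>. \<psi>\<^sub>1 g = t * \<psi> g) \<and> (\<exists>t\<ge>0. \<forall>g\<in>carrier \<G>. \<psi>\<^sub>2 g = t * \<psi> g))"

definition tree_kernel :: "nat \<Rightarrow> ('v \<Rightarrow> 'v \<Rightarrow> bool) \<Rightarrow> 'v \<Rightarrow> 'v \<Rightarrow> real" where
  "tree_kernel q adj x y =
     real (gdist adj x y) - 2 * real q / ((real q)\<^sup>2 - 1)
       + 2 * real q / ((real q)\<^sup>2 - 1) * real q powi (- int (gdist adj x y))"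


section \<open>Unitary representations and their first cohomology\<close>

text \<open>Complex Hilbert spaces. The inner product is linear in the first argument; norm and
  completeness come from its real part, and definiteness from the superclass \<^class>\<open>real_inner\<close>.\<close>

class chilbert_space = real_inner + complete_space +
  fixes scaleC :: "complex \<Rightarrow> 'a \<Rightarrow> 'a"
    and cinner :: "'a \<Rightarrow> 'a \<Rightarrow> complex"
  assumes scaleC_add_right: "scaleC a (x + y) = scaleC a x + scaleC a y"
    and scaleC_add_left: "scaleC (a + b) x = scaleC a x + scaleC b x"
    and scaleC_scaleC: "scaleC a (scaleC b x) = scaleC (a * b) x"
    and scaleC_of_real: "scaleC (complex_of_real r) x = scaleR r x"
    and cinner_commute: "cinner x y = cnj (cinner y x)"
    and cinner_add_left: "cinner (x + y) z = cinner x z + cinner y z"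
    and cinner_scaleC_left: "cinner (scaleC a x) y = a * cinner x y"
    and Re_cinner: "Re (cinner x y) = inner x y"

definition unitary_op :: "('h::chilbert_space \<Rightarrow> 'h) \<Rightarrow> bool" where
  "unitary_op T \<longleftrightarrow> (\<forall>x y. T (x + y) = T x + T y) \<and> (\<forall>a x. T (scaleC a x) = scaleC a (T x)) \<and>
     (\<forall>x y. cinner (T x) (T y) = cinner x y) \<and> surj T"

definition unitary_rep ::
  "('g, 'm) monoid_scheme \<Rightarrow> 'g topology \<Rightarrow> ('g \<Rightarrow> 'h::chilbert_space \<Rightarrow> 'h) \<Rightarrow> bool" where
  "unitary_rep \<G> X \<pi> \<longleftrightarrow>
     (\<forall>g\<in>carrier \<G>. unitary_op (\<pi> g)) \<and>
     (\<forall>g\<in>carrier \<G>. \<forall>h\<in>carrier \<G>. \<pi> (g \<otimes>\<^bsub>\<G>\<^esub> h) = \<pi> g \<circ> \<pi> h) \<and>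
     (\<forall>v. continuous_map X euclidean (\<lambda>g. \<pi> g v))"

definition closed_csubspace :: "'h::chilbert_space set \<Rightarrow> bool" where
  "closed_csubspace S \<longleftrightarrow> closed S \<and> 0 \<in> S \<and> (\<forall>x\<in>S. \<forall>y\<in>S. x + y \<in> S) \<and>
     (\<forall>a. \<forall>x\<in>S. scaleC a x \<in> S)"

definition irreducible_rep ::
  "('g, 'm) monoid_scheme \<Rightarrow> ('g \<Rightarrow> 'h::chilbert_space \<Rightarrow> 'h) \<Rightarrow> bool" where
  "irreducible_rep \<G> \<pi> \<longleftrightarrow> (\<exists>v::'h. v \<noteq> 0) \<and>
     (\<forall>S. closed_csubspace S \<and> (\<forall>g\<in>carrier \<G>. \<pi> g ` S \<subseteq> S) \<longrightarrow> S = {0} \<or> S = UNIV)"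

definition cocycles ::
  "('g, 'm) monoid_scheme \<Rightarrow> 'g topology \<Rightarrow> ('g \<Rightarrow> 'h::chilbert_space \<Rightarrow> 'h) \<Rightarrow> ('g \<Rightarrow> 'h) set" where
  "cocycles \<G> X \<pi> = {b. continuous_map X euclidean b \<and>
     (\<forall>g\<in>carrier \<G>. \<forall>h\<in>carrier \<G>. b (g \<otimes>\<^bsub>\<G>\<^esub> h) = \<pi> g (b h) + b g)}"

definition coboundaries ::
  "('g, 'm) monoid_scheme \<Rightarrow> 'g topology \<Rightarrow> ('g \<Rightarrow> 'h::chilbert_space \<Rightarrow> 'h) \<Rightarrow> ('g \<Rightarrow> 'h) set" where
  "coboundaries \<G> X \<pi> = {b \<in> cocycles \<G> X \<pi>. \<exists>v. \<forall>g\<in>carrier \<G>. b g = \<pi> g v - v}"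

text \<open>The zero element of the quotient is the class \<^term>\<open>coboundaries \<G> X \<pi>\<close>, so
  nonvanishing of the cohomology reads \<^prop>\<open>H1 \<G> X \<pi> \<noteq> {coboundaries \<G> X \<pi>}\<close>.\<close>

definition H1 ::
  "('g, 'm) monoid_scheme \<Rightarrow> 'g topology \<Rightarrow> ('g \<Rightarrow> 'h::chilbert_space \<Rightarrow> 'h) \<Rightarrow> ('g \<Rightarrow> 'h) set set" where
  "H1 \<G> X \<pi> = cocycles \<G> X \<pi> //
     {(b, b'). b \<in> cocycles \<G> X \<pi> \<and> b' \<in> cocycles \<G> X \<pi> \<and> (\<lambda>g. b g - b' g) \<in> coboundaries \<G> X \<pi>}"

definition harmonic ::
  "nat \<Rightarrow> ('v \<Rightarrow> 'v \<Rightarrow> bool) \<Rightarrow> ('v \<Rightarrow> 'h::real_vector) \<Rightarrow> bool" where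
  "harmonic q adj F \<longleftrightarrow> (\<forall>x. (1 / (real q + 1)) *\<^sub>R (\<Sum>y | adj x y. F y) = F x)"


section \<open>Alternating functions on the oriented edges\<close>

text \<open>Functions on the set of oriented edges are functions on all pairs that vanish
  on the pairs that are not edges.\<close>

definition l2alt :: "('v \<Rightarrow> 'v \<Rightarrow> bool) \<Rightarrow> ('v \<times> 'v \<Rightarrow> real) set" where
  "l2alt adj = {\<xi>. (\<forall>x y. \<not> adj x y \<longrightarrow> \<xi> (x, y) = 0) \<and> (\<forall>x y. adj x y \<longrightarrow> \<xi> (y, x) = - \<xi> (x, y)) \<and>
     (\<lambda>e. (\<xi> e)\<^sup>2) summable_on {(x, y). adj x y}}"

definition alt_inner ::
  "('v \<Rightarrow> 'v \<Rightarrow> bool) \<Rightarrow> ('v \<times> 'v \<Rightarrow> real) \<Rightarrow> ('v \<times> 'v \<Rightarrow> real) \<Rightarrow> real" where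
  "alt_inner adj \<xi> \<eta> = 1/2 * (\<Sum>\<^sub>\<infinity>e\<in>{(x, y). adj x y}. \<xi> e * \<eta> e)"

definition edge_action :: "('v \<Rightarrow> 'v) \<Rightarrow> ('v \<times> 'v \<Rightarrow> real) \<Rightarrow> 'v \<times> 'v \<Rightarrow> real" where
  "edge_action g \<xi> = (\<lambda>(x, y). \<xi> (inv_into UNIV g x, inv_into UNIV g y))"

definition l2V :: "('v \<Rightarrow> 'v \<Rightarrow> bool) \<Rightarrow> ('v \<Rightarrow> real) set" where
  "l2V adj = {f. (\<lambda>x. (f x)\<^sup>2 * real (deg adj x)) summable_on UNIV}"

definition grad :: "('v \<Rightarrow> 'v \<Rightarrow> bool) \<Rightarrow> ('v \<Rightarrow> real) \<Rightarrow> 'v \<times> 'v \<Rightarrow> real" where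
  "grad adj f = (\<lambda>(x, y). if adj x y then f y - f x else 0)"

definition grad_adj :: "('v \<Rightarrow> 'v \<Rightarrow> bool) \<Rightarrow> ('v \<times> 'v \<Rightarrow> real) \<Rightarrow> 'v \<Rightarrow> real" where
  "grad_adj adj u x = 1 / real (deg adj x) * (\<Sum>y | adj x y. u (y, x))"

definition ker_grad_adj :: "('v \<Rightarrow> 'v \<Rightarrow> bool) \<Rightarrow> ('v \<times> 'v \<Rightarrow> real) set" where
  "ker_grad_adj adj = {u \<in> l2alt adj. \<forall>x. grad_adj adj u x = 0}"

text \<open>\<open>Q\<close>: the orthogonal projection onto the image of the gradient.\<close>

definition Q_proj :: "('v \<Rightarrow> 'v \<Rightarrow> bool) \<Rightarrow> ('v \<times> 'v \<Rightarrow> real) \<Rightarrow> 'v \<times> 'v \<Rightarrow> real" where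
  "Q_proj adj \<xi> = (THE \<eta>. \<eta> \<in> grad adj ` l2V adj \<and>
     (\<forall>\<zeta>\<in>grad adj ` l2V adj. alt_inner adj (\<lambda>e. \<xi> e - \<eta> e) \<zeta> = 0))"

definition traverses :: "'v list \<Rightarrow> 'v \<times> 'v \<Rightarrow> bool" where
  "traverses p e \<longleftrightarrow> (\<exists>i. Suc i < length p \<and> e = (p ! i, p ! Suc i))"

definition chi :: "('v \<Rightarrow> 'v \<Rightarrow> bool) \<Rightarrow> 'v \<Rightarrow> 'v \<Rightarrow> 'v \<times> 'v \<Rightarrow> real" where
  "chi adj x y e =
     (if \<exists>p. geodesic adj x y p \<and> traverses p e then 1
      else if \<exists>p. geodesic adj x y p \<and> traverses p (prod.swap e) then - 1
      else 0)"

definition b_tilde :: "('v \<Rightarrow> 'v \<Rightarrow> bool) \<Rightarrow> 'v \<Rightarrow> ('v \<Rightarrow> 'v) \<Rightarrow> 'v \<times> 'v \<Rightarrow> real" where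
  "b_tilde adj x\<^sub>0 g = (\<lambda>e. chi adj x\<^sub>0 (g x\<^sub>0) e - Q_proj adj (chi adj x\<^sub>0 (g x\<^sub>0)) e)"

text \<open>\<open>U\<close> identifies the complexification of the real Hilbert space \<open>S\<close>, with inner
  product \<open>ip\<close>, with the complex Hilbert space \<open>'h\<close>: the map \<open>\<xi> + \<i>\<eta> \<mapsto> U \<xi> + \<i> U \<eta>\<close> is a
  unitary isomorphism. (Injectivity follows from preservation of inner products.)\<close>

definition complexification_iso ::
  "(('e \<Rightarrow> real) \<Rightarrow> ('e \<Rightarrow> real) \<Rightarrow> real) \<Rightarrow> ('e \<Rightarrow> real) set \<Rightarrow> (('e \<Rightarrow> real) \<Rightarrow> 'h::chilbert_space) \<Rightarrow> bool"
  where
  "complexification_iso ip S U \<longleftrightarrow>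
     (\<forall>\<xi>\<in>S. \<forall>\<eta>\<in>S. U (\<lambda>e. \<xi> e + \<eta> e) = U \<xi> + U \<eta>) \<and>
     (\<forall>a. \<forall>\<xi>\<in>S. U (\<lambda>e. a * \<xi> e) = a *\<^sub>R U \<xi>) \<and>
     (\<forall>\<xi>\<in>S. \<forall>\<eta>\<in>S. cinner (U \<xi>) (U \<eta>) = complex_of_real (ip \<xi> \<eta>)) \<and>
     (\<forall>h. \<exists>\<xi>\<in>S. \<exists>\<eta>\<in>S. h = U \<xi> + scaleC \<i> (U \<eta>))"

end

theory Submission
  imports Defs
begin

text \<open>
  The stabiliser \<open>K\<close> of a vertex turns out to be transitive on all spheres around it. This is
  \<open>sphere_transitive\<close>, which follows from the transitivity on the boundary by a category argument
  (\<open>cone_orbit\<close>). So every invariant kernel on the vertices is a function of the distance, and the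
  average over the neighbours of a vertex acts on such functions by a three-term recursion
  (\<open>radial_avg\<close>). The kernel \<open>\<Psi>\<close> of the theorem is \<open>harmonic_profile\<close> of the distance; up to scaling,
  it is the only solution of the recursion that expresses that a map from the vertices to a
  Hilbert space, with square displacement \<open>\<Psi>\<close>, is harmonic. All three parts of the theorem lead to this
  recursion.

  That \<open>\<Psi>\<close> is of negative type is seen in the space of alternating functions. On edges,
  \<open>chi adj x y\<close> is the gradient of half the difference of the distances to \<open>x\<close> and \<open>y\<close>. A multiple of
  \<open>q ^ - d(y, v) - q ^ - d(x, v)\<close> has the same Laplacian as this potential and is square summable. The
  difference of the two is harmonic, so its gradient \<open>chi_harmonic x y\<close> is the projection of
  \<open>chi adj x y\<close> onto the kernel of the divergence. Its square norm is \<open>\<Psi> x y\<close> by summation by parts.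

  A function of negative type that vanishes on \<open>K\<close> is a function \<open>\<phi>\<close> of the displacement
  (\<open>CL_radial\<close>), and the averaging operator is symmetric and bounded for the inner product that \<open>\<phi>\<close>
  defines on measures of mass zero. It splits \<open>\<phi>\<close> into two summands, so it acts as a scalar \<open>t\<close> if \<open>\<phi>\<close>
  is pure. If \<open>t \<noteq> 1\<close>, then \<open>\<phi>\<close> is bounded (\<open>eigenfunction_bounded\<close>); if \<open>t = 1\<close>, the recursion
  shows that \<open>\<phi>\<close> is a multiple of \<open>\<Psi>\<close>. Conversely, harmonicity says that a certain nonnegative
  quantity vanishes, and this passes to summands, so \<open>\<Psi>\<close> is pure (\<open>harmonic_profile_extremal\<close>).

  Let \<open>\<sigma>\<close> be an irreducible representation with an unbounded cocycle and the corresponding equivariant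
  map \<open>F\<close>. The averaging operator on the \<open>K\<close>-fixed vectors is a symmetric contraction for which every
  nonzero vector is cyclic, so it is a scalar \<open>t\<close> by Schur's lemma. Suppose that \<open>F\<close> is not harmonic. Then
  \<open>t \<noteq> 1\<close>, and \<open>F\<close> is a harmonic map plus a bounded map whose values are orthogonal to all
  differences of the harmonic one. By irreducibility the latter is constant, so \<open>F\<close> is bounded, a
  contradiction. So \<open>F\<close> is harmonic (\<open>F_harmonic\<close>), and the recursion determines all inner
  products of its differences along edges: they are proportional to those of the harmonic
  components of the edges. The synthesis operator of these differences (\<open>synth\<close>) is the required
  isomorphism.
\<close>


section \<open>Trees and geodesics\<close>

locale tree =
  fixes adj :: "'v \<Rightarrow> 'v \<Rightarrow> bool"
  assumes is_tree: "is_tree adj"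
begin

abbreviation d :: "'v \<Rightarrow> 'v \<Rightarrow> nat" where "d \<equiv> gdist adj"

lemma adj_sym: "adj x y \<longleftrightarrow> adj y x"
  using is_tree by (auto simp: is_tree_def symp_def)

lemma adj_irrefl [simp]: "\<not> adj x x"
  using is_tree by (auto simp: is_tree_def irreflp_def)

lemma adj_neq: "adj x y \<Longrightarrow> x \<noteq> y"
  by auto

lemma relpowp_gdist: "(adj ^^ d x y) x y"
proof -
  have "adj\<^sup>*\<^sup>* x y"
    using is_tree by (auto simp: is_tree_def)
  then obtain n where "(adj ^^ n) x y"
    by (auto dest: rtranclp_imp_relpowp)
  then show ?thesis
    unfolding gdist_def by (rule LeastI)
qed

lemma gdist_le: "(adj ^^ n) x y \<Longrightarrow> d x y \<le> n"
  unfolding gdist_def by (rule Least_le)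

lemma gdist_self [simp]: "d x x = 0"
  using gdist_le[of 0 x x] by simp

lemma gdist_eq_0 [simp]: "d x y = 0 \<longleftrightarrow> x = y"
  using relpowp_gdist[of x y] by auto

lemma relpowp_adj_sym: "(adj ^^ n) x y \<Longrightarrow> (adj ^^ n) y x"
proof (induction n arbitrary: y)
  case (Suc n)
  then obtain z where "(adj ^^ n) x z" "adj z y"
    by auto
  with Suc.IH[of z] show ?case
    by (metis adj_sym relpowp_Suc_I2)
qed simp

lemma gdist_commute: "d x y = d y x"
  by (meson antisym gdist_le relpowp_adj_sym relpowp_gdist)

lemma gdist_triangle: "d x z \<le> d x y + d y z"
  using relpowp_gdist[of x y] relpowp_gdist[of y z]
  by (auto intro!: gdist_le simp: relpowp_add)

lemma gdist_adj: "adj x y \<Longrightarrow> d x y = 1"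
  using gdist_le[of 1 x y] gdist_eq_0[of x y] by (metis One_nat_def adj_irrefl le_0_eq le_SucE relpowp_1)

lemma adj_iff_gdist: "adj x y \<longleftrightarrow> d x y = 1"
  using relpowp_gdist[of x y] by (auto simp: gdist_adj)

lemma gdist_Suc_parent:
  assumes "d x y = Suc n"
  obtains z where "d x z = n" "adj z y"
proof -
  from relpowp_gdist[of x y] assms obtain z where z: "(adj ^^ n) x z" "adj z y"
    by auto
  then have "d x z \<le> n" "d x y \<le> d x z + 1"
    using gdist_le gdist_triangle[of x y z] gdist_adj[of z y] by auto
  with z assms that show thesis
    by force
qed

text \<open>Two distinct vertices of a sphere cannot be joined outside the open ball that it bounds:
  together with their geodesics to the centre such a path would close up to a cycle.\<close>

lemma no_path_outside_ball:
  assumes "distinct p" "successively adj p" "length p \<ge> 2" "\<forall>v\<in>set p. n \<le> d x v"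
    and "d x (hd p) = n" "d x (last p) = n"
  shows False
  using assms
proof (induction n arbitrary: p)
  case 0
  then have "hd p = last p"
    by (metis gdist_eq_0)
  with 0 show False
    by (cases p) (auto split: if_splits)
next
  case (Suc n)
  obtain a where a: "d x a = n" "adj a (hd p)"
    using gdist_Suc_parent Suc.prems(5) by blast
  obtain b where b: "d x b = n" "adj b (last p)"
    using gdist_Suc_parent Suc.prems(6) by blast
  have p: "p \<noteq> []" "a \<notin> set p" "b \<notin> set p"
    using Suc.prems a b by fastforce+
  show False
  proof (cases "a = b")
    case True
    have "length (a # p) \<ge> 3" "distinct (a # p)" "successively adj (a # p)"
      "adj (last (a # p)) (hd (a # p))"
      using Suc.prems a b p True by (auto simp: successively_Cons adj_sym)
    then show False
      using is_tree unfolding is_tree_def by blast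
  next
    case False
    have "successively adj (a # p @ [b])"
      using Suc.prems a b p by (auto simp: successively_Cons successively_append_iff adj_sym)
    moreover have "\<forall>v\<in>set (a # p @ [b]). n \<le> d x v"
      using Suc.prems(4) a b by force
    ultimately show False
      using Suc.IH[of "a # p @ [b]"] Suc.prems(1) a b p False by auto
  qed
qed

text \<open>An edge between two vertices of a sphere, or a second neighbour that is nearer to the centre, would
  give a path as in \<open>no_path_outside_ball\<close>.\<close>

lemma gdist_adj_cases:
  assumes "adj u v"
  shows "d x v = Suc (d x u) \<or> d x u = Suc (d x v)"
proof -
  have "d x u \<noteq> d x v"
  proof
    assume "d x u = d x v"
    then show False
      using no_path_outside_ball[of "[u, v]" "d x u" x] assms by (auto dest: adj_neq)
  qed
  moreover have "d x u \<le> Suc (d x v)" "d x v \<le> Suc (d x u)"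
    using gdist_triangle[of x u v] gdist_triangle[of x v u] gdist_adj[of u v] gdist_commute[of u v]
      assms by auto
  ultimately show ?thesis
    by linarith
qed

lemma parent_unique:
  assumes "adj u v" "adj w v" "d x v = Suc (d x u)" "d x v = Suc (d x w)"
  shows "u = w"
proof (rule ccontr)
  assume "u \<noteq> w"
  then show False
    using no_path_outside_ball[of "[u, v, w]" "d x u" x] assms adj_sym[of v w] by (auto dest: adj_neq)
qed

lemma gdist_non_parent:
  assumes "adj u v" "adj v w" "u \<noteq> w" "d x v = Suc (d x u)"
  shows "d x w = Suc (d x v)"
  using gdist_adj_cases[of v w x] parent_unique[of u v w x] assms adj_sym[of v w] by auto

definition between :: "'v \<Rightarrow> 'v \<Rightarrow> 'v \<Rightarrow> bool" where
  "between x w u \<longleftrightarrow> d x u = d x w + d w u"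

lemma between_refl [simp]: "between x x u" "between x u u"
  by (auto simp: between_def)

lemma between_trans:
  assumes "between x w u" "between x u v"
  shows "between x w v" "between w u v"
proof -
  have "d x v \<le> d x w + d w v" "d w v \<le> d w u + d u v"
    by (rule gdist_triangle)+
  with assms show "between x w v" "between w u v"
    by (auto simp: between_def)
qed

lemma between_at:
  assumes "b \<le> d x u"
  obtains w where "between x w u" "d x w = b"
  using assms
proof (induction "d x u" arbitrary: u thesis)
  case 0
  then show ?case
    by (metis between_refl(1) gdist_self le_zero_eq)
next
  case (Suc n)
  show ?case
  proof (cases "b = d x u")
    case True
    then show ?thesis
      using Suc.prems(1)[of u] by simp
  next
    case False
    obtain z where z: "d x z = n" "adj z u"
      using Suc.hyps(2) gdist_Suc_parent[of x u n] by metis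
    then have zu: "between x z u"
      using Suc.hyps(2) by (auto simp: between_def gdist_adj)
    obtain w where "between x w z" "d x w = b"
      using Suc.hyps(1)[of z] z Suc.prems(2) Suc.hyps(2) False by (metis le_SucE)
    then show ?thesis
      using Suc.prems(1) between_trans(1)[OF _ zu] by blast
  qed
qed

lemma between_unique:
  assumes "between x w u" "between x w' u" "d x w = d x w'"
  shows "w = w'"
  using assms
proof (induction "d w u" arbitrary: w w')
  case 0
  then show ?case
    by (auto simp: between_def)
next
  case (Suc n)
  have eq: "d w' u = Suc n"
    using Suc by (auto simp: between_def)
  obtain z where z: "adj w z" "d u z = n"
    using Suc.hyps(2) gdist_Suc_parent[of u w n] gdist_commute adj_sym by metis
  obtain z' where z': "adj w' z'" "d u z' = n"
    using eq gdist_Suc_parent[of u w' n] gdist_commute adj_sym by metis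
  have "d x u \<le> d x z + d z u" "d x z \<le> d x w + d w z"
    by (rule gdist_triangle)+
  then have dz: "d x z = Suc (d x w)" "between x z u"
    using z gdist_adj[OF z(1)] Suc gdist_commute[of z u] by (auto simp: between_def)
  have "d x u \<le> d x z' + d z' u" "d x z' \<le> d x w' + d w' z'"
    by (rule gdist_triangle)+
  then have dz': "d x z' = Suc (d x w')" "between x z' u"
    using z' gdist_adj[OF z'(1)] Suc eq gdist_commute[of z' u] by (auto simp: between_def)
  have "z = z'"
    using Suc.hyps(1)[of z z'] dz dz' Suc.prems z gdist_commute[of z u] by auto
  then show ?case
    using parent_unique[of w z w' x] dz dz' z z' Suc.prems by auto
qed

text \<open>An edge separates the tree: if \<open>x\<close> lies on the side of \<open>u\<close> and \<open>y\<close> on the side of \<open>v\<close>, then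
  the geodesic from \<open>x\<close> to \<open>y\<close> crosses the edge.\<close>

lemma edge_between:
  assumes "adj u v" "d x v = Suc (d x u)" "d y u = Suc (d y v)"
  shows "d x y = Suc (d x u + d v y)"
  using assms
proof (induction "d v y" arbitrary: y rule: less_induct)
  case less
  show ?case
  proof (cases "d v y")
    case 0
    then show ?thesis
      using less.prems by auto
  next
    case (Suc n)
    obtain y' where y': "d v y' = n" "adj y' y"
      using gdist_Suc_parent[OF Suc] by blast
    have uy: "d u y = Suc (Suc n)"
      using less.prems(3) Suc gdist_commute[of y u] gdist_commute[of y v] by arith
    then have uy': "d u y' = Suc n"
      using gdist_adj_cases[OF y'(2), of u] gdist_adj_cases[OF less.prems(1), of y'] y'(1)
        gdist_commute[of y' u] gdist_commute[of y' v]
      by arith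
    have xy': "d x y' = Suc (d x u + n)"
      using less.hyps[of y'] less.prems(1,2) y'(1) uy' Suc gdist_commute[of y' u] gdist_commute[of y' v]
      by simp
    obtain z where z: "adj z y'" "d x z + 1 = d x y'" "z \<noteq> y"
    proof (cases n)
      case 0
      then have "v = y'"
        using y' by auto
      moreover have "u \<noteq> y"
        using uy by auto
      ultimately show thesis
        using that[of u] less.prems by auto
    next
      case (Suc m)
      obtain z where z: "d v z = m" "adj z y'"
        using gdist_Suc_parent y'(1) Suc by blast
      have "d u z = Suc m"
        using gdist_adj_cases[OF z(2), of u] gdist_adj_cases[OF less.prems(1), of z] z(1) uy' Suc
          gdist_commute[of z u] gdist_commute[of z v]
        by arith
      then have "d x z = Suc (d x u + m)"
        using less.hyps[of z] less.prems(1,2) z(1) Suc \<open>d v y = Suc n\<close> gdist_commute[of z u]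
          gdist_commute[of z v]
        by simp
      moreover have "z \<noteq> y"
        using z \<open>d v y = Suc n\<close> Suc by auto
      ultimately show thesis
        using that[of z] z xy' Suc by auto
    qed
    have "d x y = Suc (d x y')"
      using gdist_non_parent[of z y' y x] z y' by auto
    then show ?thesis
      using xy' Suc by auto
  qed
qed

text \<open>Only one neighbour of a vertex is nearer to the origin of the path, and this is the vertex that the
  path comes from.\<close>

lemma geodesic_ray_if_no_backtracking:
  assumes "\<And>n. adj (r n) (r (Suc n))" "\<And>n. r (Suc (Suc n)) \<noteq> r n"
  shows "geodesic_ray adj r"
  unfolding geodesic_ray_def
proof (intro allI)
  fix m n
  have "d (r m) (r (m + n)) = n \<and> d (r m) (r (Suc (m + n))) = Suc n"
  proof (induction n)
    case 0
    then show ?case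
      using assms(1) gdist_adj by auto
  next
    case (Suc n)
    then show ?case
      using gdist_non_parent[of "r (m + n)" "r (Suc (m + n))" "r (Suc (Suc (m + n)))" "r m"]
        assms(1) assms(2)[of "m + n"] by auto
  qed
  then show "d (r m) (r (m + n)) = n"
    by simp
qed

end

locale regular_tree_graph =
  fixes q :: nat and adj :: "'v \<Rightarrow> 'v \<Rightarrow> bool"
  assumes q_ge_2: "q \<ge> 2" and regular: "regular_tree (q + 1) adj"
begin

sublocale tree adj
  using regular by unfold_locales (auto simp: regular_tree_def)

lemma finite_nbrs [simp]: "finite {y. adj x y}"
  and card_nbrs [simp]: "card {y. adj x y} = q + 1"
  and deg_eq [simp]: "deg adj x = q + 1"
  using regular by (auto simp: regular_tree_def deg_def)

lemma children:
  assumes "d x v = Suc n"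
  obtains u where "adj u v" "d x u = n" "card ({y. adj v y} - {u}) = q"
    "\<And>y. adj v y \<Longrightarrow> y \<noteq> u \<Longrightarrow> d x y = Suc (Suc n)"
proof -
  obtain u where u: "d x u = n" "adj u v"
    using gdist_Suc_parent assms by blast
  then have "card ({y. adj v y} - {u}) = q"
    using card_Diff_singleton[of u "{y. adj v y}"] adj_sym[of u v] by auto
  then show thesis
    using that[of u] u gdist_non_parent[of u v _ x] assms by auto
qed

lemma sum_nbrs_radial:
  fixes f :: "nat \<Rightarrow> real"
  shows "(\<Sum>y | adj v y. f (d x y)) =
    (if d x v = 0 then (real q + 1) * f 1 else f (d x v - 1) + real q * f (d x v + 1))"
proof (cases "d x v")
  case 0
  then have "(\<Sum>y | adj v y. f (d x y)) = (\<Sum>y | adj v y. f 1)"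
    by (intro sum.cong) (auto simp: gdist_adj)
  then show ?thesis
    using 0 by simp
next
  case (Suc n)
  obtain u where u: "adj u v" "d x u = n" "card ({y. adj v y} - {u}) = q"
    "\<And>y. adj v y \<Longrightarrow> y \<noteq> u \<Longrightarrow> d x y = Suc (Suc n)"
    using children[OF Suc] by blast
  have "(\<Sum>y | adj v y. f (d x y)) = f (d x u) + (\<Sum>y\<in>{y. adj v y} - {u}. f (d x y))"
    using u adj_sym[of u v] by (intro sum.remove) auto
  also have "(\<Sum>y\<in>{y. adj v y} - {u}. f (d x y)) = (\<Sum>y\<in>{y. adj v y} - {u}. f (Suc (Suc n)))"
    using u by (intro sum.cong) auto
  finally show ?thesis
    using u Suc by simp
qed

lemma ex_extend:
  assumes "adj u v \<or> u = v"
  obtains w where "adj v w" "w \<noteq> u"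
proof -
  have "card ({y. adj v y} - {u}) \<ge> q"
    using card_Diff_singleton_if[of "{y. adj v y}" u] by auto
  then have "{y. adj v y} - {u} \<noteq> {}"
    using q_ge_2 by (metis card.empty not_numeral_le_zero order_trans)
  then show thesis
    using that by auto
qed

lemma ex_beyond:
  obtains u' where "between x u u'" "d u u' = n"
proof (induction n arbitrary: thesis)
  case 0
  then show ?case
    by (metis between_refl(2) gdist_self)
next
  case (Suc n)
  obtain v where v: "between x u v" "d u v = n"
    using Suc.IH by blast
  obtain w where w: "adj v w" "d x w = Suc (d x v)"
  proof (cases "d x v")
    case 0
    then show thesis
      using ex_extend[of v v] that by (metis gdist_adj gdist_eq_0 One_nat_def)
  next
    case (Suc m)
    obtain p where "adj p v" "d x p = m" "\<And>y. adj v y \<Longrightarrow> y \<noteq> p \<Longrightarrow> d x y = Suc (Suc m)"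
      using children[OF Suc] by metis
    then show thesis
      using ex_extend[of p v] that Suc by metis
  qed
  have "d x w \<le> d x u + d u w" "d u w \<le> d u v + d v w"
    by (rule gdist_triangle)+
  then have "between x u w" "d u w = Suc n"
    using v w gdist_adj[OF w(1)] by (auto simp: between_def)
  then show ?case
    using Suc.prems by blast
qed

lemma finite_sphere: "finite {v. d x v = n}" and card_sphere: "card {v. d x v = n} \<le> 2 * q ^ n"
proof -
  have "finite {v. d x v = n} \<and> card {v. d x v = n} \<le> 2 * q ^ n"
  proof (induction n)
    case 0
    have "{v. d x v = 0} = {x}"
      by auto
    then show ?case
      by simp
  next
    case (Suc n)
    show ?case
    proof (cases n)
      case 0
      have "{v. d x v = Suc n} = {v. adj x v}"
        using 0 adj_iff_gdist by auto
      then show ?thesis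
        using q_ge_2 0 by simp
    next
      case (Suc m)
      let ?S = "{v. d x v = n}" and ?C = "\<lambda>v. {w. adj v w \<and> d x w = Suc n}"
      have C: "card (?C v) \<le> q \<and> finite (?C v)" if "v \<in> ?S" for v
      proof -
        have "d x v = Suc m"
          using that Suc by simp
        then obtain u where u: "d x u = m" "card ({y. adj v y} - {u}) = q"
          using children by metis
        have "?C v \<subseteq> {y. adj v y} - {u}"
          using u Suc by auto
        then have "card (?C v) \<le> card ({y. adj v y} - {u})"
          by (intro card_mono) auto
        then show ?thesis
          using u by auto
      qed
      have eq: "{v. d x v = Suc n} = (\<Union>v\<in>?S. ?C v)"
        by (auto elim: gdist_Suc_parent[of x _ n])
      have "card {v. d x v = Suc n} \<le> (\<Sum>v\<in>?S. card (?C v))"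
        unfolding eq by (rule card_UN_le) (use Suc.IH in blast)
      also have "\<dots> \<le> (\<Sum>v\<in>?S. q)"
        using C by (blast intro: sum_mono)
      also have "\<dots> \<le> 2 * q ^ Suc n"
        using mult_le_mono1[of "card ?S" "2 * q ^ n" q] Suc.IH by (simp add: mult_ac)
      finally show ?thesis
        unfolding eq using C Suc.IH by (metis (no_types, lifting) finite_UN_I)
    qed
  qed
  then show "finite {v. d x v = n}" "card {v. d x v = n} \<le> 2 * q ^ n"
    by auto
qed

end

section \<open>Groups of automorphisms that are transitive on the boundary\<close>

abbreviation fun_inv :: "('a \<Rightarrow> 'b) \<Rightarrow> 'b \<Rightarrow> 'a" where
  "fun_inv \<equiv> inv_into UNIV"

context tree
begin

lemma group_aut_group: "group (aut_group adj)"
proof (rule groupI)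
  fix g assume g: "g \<in> carrier (aut_group adj)"
  then have "bij g" "\<And>x y. adj (g x) (g y) \<longleftrightarrow> adj x y"
    by (auto simp: aut_group_def tree_aut_def)
  then have "fun_inv g \<in> tree_aut adj" "fun_inv g \<circ> g = id"
    by (auto simp: tree_aut_def bij_imp_bij_inv bij_is_inj inv_o_cancel)
      (metis bij_inv_eq_iff)+
  then show "\<exists>h\<in>carrier (aut_group adj). h \<otimes>\<^bsub>aut_group adj\<^esub> g = \<one>\<^bsub>aut_group adj\<^esub>"
    by (auto simp: aut_group_def)
qed (auto simp: aut_group_def tree_aut_def bij_comp o_assoc)

lemma inv_aut_group:
  assumes "g \<in> tree_aut adj"
  shows "inv\<^bsub>aut_group adj\<^esub> g = fun_inv g" and "fun_inv g \<in> tree_aut adj"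
proof -
  have g: "bij g" "\<And>x y. adj (g x) (g y) \<longleftrightarrow> adj x y"
    using assms by (auto simp: tree_aut_def)
  then show "fun_inv g \<in> tree_aut adj"
    by (auto simp: tree_aut_def bij_imp_bij_inv) (metis bij_inv_eq_iff)+
  then show "inv\<^bsub>aut_group adj\<^esub> g = fun_inv g"
    using group.inv_equality[OF group_aut_group, of "fun_inv g" g] assms g
    by (auto simp: aut_group_def bij_is_inj inv_o_cancel)
qed

lemma boundary_transitive_rays:
  assumes "boundary_transitive adj G" "geodesic_ray adj r" "geodesic_ray adj s"
  obtains g a b where "g \<in> G" "\<And>n. g (r (a + n)) = s (b + n)"
proof -
  define R where "R = {(r, s). geodesic_ray adj r \<and> geodesic_ray adj s \<and> (\<exists>m k. \<forall>n. r (m + n) = s (k + n))}"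
  have "R `` {r} \<in> boundary adj" "R `` {s} \<in> boundary adj"
    using assms(2,3) unfolding boundary_def R_def[symmetric] by (auto intro: quotientI)
  then obtain g where g: "g \<in> G" "(\<lambda>r. g \<circ> r) ` (R `` {r}) = R `` {s}"
    using assms(1) unfolding boundary_transitive_def by metis
  have "r \<in> R `` {r}"
    using assms(2) by (auto simp: R_def)
  then have "(s, g \<circ> r) \<in> R"
    using g by blast
  then obtain m k where "\<forall>n. s (m + n) = (g \<circ> r) (k + n)"
    by (auto simp: R_def)
  then show thesis
    using that[of g k m] g by auto
qed

end

locale tree_action = regular_tree_graph q adj
  for q :: nat and adj :: "'v \<Rightarrow> 'v \<Rightarrow> bool" +
  fixes G :: "('v \<Rightarrow> 'v) set"
  assumes subgroup_G: "subgroup G (aut_group adj)"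
    and vertex_transitive: "vertex_transitive G"
    and boundary_transitive: "boundary_transitive adj G"
begin

lemma G_aut: "g \<in> G \<Longrightarrow> g \<in> tree_aut adj"
  using subgroup.subset[OF subgroup_G] by (auto simp: aut_group_def)

lemma bij_G: "g \<in> G \<Longrightarrow> bij g"
  using G_aut by (auto simp: tree_aut_def)

lemma adj_G: "g \<in> G \<Longrightarrow> adj (g x) (g y) \<longleftrightarrow> adj x y"
  using G_aut by (auto simp: tree_aut_def)

lemma id_G: "id \<in> G"
  using subgroup.one_closed[OF subgroup_G] by (simp add: aut_group_def)

lemma comp_G: "g \<in> G \<Longrightarrow> h \<in> G \<Longrightarrow> g \<circ> h \<in> G"
  using subgroup.m_closed[OF subgroup_G] by (simp add: aut_group_def)

lemma inv_G: "g \<in> G \<Longrightarrow> fun_inv g \<in> G"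
  using subgroup.m_inv_closed[OF subgroup_G] inv_aut_group G_aut by metis

lemma inv_G_apply [simp]: "g \<in> G \<Longrightarrow> fun_inv g (g x) = x" "g \<in> G \<Longrightarrow> g (fun_inv g x) = x"
  using bij_G by (auto simp: bij_is_inj bij_is_surj surj_f_inv_f)

lemma gdist_G_le: "g \<in> G \<Longrightarrow> d (g x) (g y) \<le> d x y"
proof -
  assume g: "g \<in> G"
  have "(adj ^^ n) x y \<Longrightarrow> (adj ^^ n) (g x) (g y)" for n
  proof (induction n arbitrary: y)
    case (Suc n)
    then obtain z where "(adj ^^ n) x z" "adj z y"
      by auto
    then show ?case
      using Suc.IH[of z] adj_G[OF g] by auto
  qed simp
  then show ?thesis
    using relpowp_gdist gdist_le by blast
qed

lemma gdist_G [simp]: "g \<in> G \<Longrightarrow> d (g x) (g y) = d x y"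
  using gdist_G_le[of g x y] gdist_G_le[OF inv_G, of g "g x" "g y"] by simp

lemma gdist_inv_G: "g \<in> G \<Longrightarrow> d (fun_inv g x) y = d x (g y)"
  using gdist_G[of g "fun_inv g x" y] by simp

lemma between_G [simp]: "g \<in> G \<Longrightarrow> between (g x) (g y) (g z) \<longleftrightarrow> between x y z"
  by (simp add: between_def)

lemma transitive: obtains g where "g \<in> G" "g x = y"
  using vertex_transitive by (auto simp: vertex_transitive_def)

text \<open>A category argument. The boundary is covered by countably many sets, one for each pair of tails
  of a fixed ray \<open>r\<close> and of a variable ray: its members are the ends for which some element of
  the group matches these tails. If each of these sets were nowhere dense, then a ray avoiding all
  of them could be built step by step. So one of them is dense in the set of ends beyond some
  vertex \<open>u\<close>.\<close>

lemma cone_orbit: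
  assumes r: "geodesic_ray adj r"
  obtains w u a where "between x\<^sub>0 w u"
    "\<And>u'. between x\<^sub>0 u u' \<Longrightarrow> \<exists>g\<in>G. g (r a) = w \<and> g (r (a + d w u')) = u'"
proof (rule ccontr)
  assume no: "\<not> thesis"
  note result = that
  have neg: "\<exists>u'. between x\<^sub>0 u u' \<and> (\<forall>g\<in>G. \<not> (g (r a) = w \<and> g (r (a + d w u')) = u'))"
    if w: "between x\<^sub>0 w u" for w u a
  proof (rule ccontr)
    assume "\<not> ?thesis"
    then have "\<And>u'. between x\<^sub>0 u u' \<Longrightarrow> \<exists>g\<in>G. g (r a) = w \<and> g (r (a + d w u')) = u'"
      by blast
    then show False
      using result[OF w] no by blast
  qed
  \<comment> \<open>the \<open>i\<close>-th step avoids the set with the index \<open>prod_decode i\<close>\<close>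
  define step where "step i u u' \<longleftrightarrow> between x\<^sub>0 u u' \<and> d x\<^sub>0 u < d x\<^sub>0 u' \<and>
    (case prod_decode i of (a, b) \<Rightarrow> b \<le> d x\<^sub>0 u' \<and> (\<forall>w. between x\<^sub>0 w u' \<and> d x\<^sub>0 w = b \<longrightarrow>
      (\<forall>g\<in>G. \<not> (g (r a) = w \<and> g (r (a + d w u')) = u'))))" for i u u'
  have ex_step: "\<exists>u'. step i u u'" for i u
  proof -
    obtain a b where ab: "prod_decode i = (a, b)"
      by fastforce
    obtain v where v: "between x\<^sub>0 u v" "d u v = Suc b"
      using ex_beyond by blast
    then have dv: "d x\<^sub>0 v = d x\<^sub>0 u + Suc b"
      by (simp add: between_def)
    then obtain w where w: "between x\<^sub>0 w v" "d x\<^sub>0 w = b"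
      using between_at[of b x\<^sub>0 v] by auto
    obtain u' where u': "between x\<^sub>0 v u'" "\<forall>g\<in>G. \<not> (g (r a) = w \<and> g (r (a + d w u')) = u')"
      using neg w by blast
    have "between x\<^sub>0 w u'" "between x\<^sub>0 u u'"
      using between_trans u' v w by blast+
    moreover have "d x\<^sub>0 u < d x\<^sub>0 u'" "b \<le> d x\<^sub>0 u'"
      using u'(1) dv by (auto simp: between_def)
    moreover have "w' = w" if "between x\<^sub>0 w' u'" "d x\<^sub>0 w' = b" for w'
      using between_unique[OF that(1) \<open>between x\<^sub>0 w u'\<close>] that(2) w(2) by simp
    ultimately have "step i u u'"
      unfolding step_def ab prod.case using u'(2) by blast
    then show ?thesis
      by blast
  qed
  obtain v where v: "\<And>i. step i (v i) (v (Suc i))"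
    using ex_step dependent_nat_choice[of "\<lambda>_ _. True" "\<lambda>i u u'. step i u u'"] by blast
  have mono: "between x\<^sub>0 (v i) (v (i + k))" for i k
  proof (induction k)
    case (Suc k)
    have "between x\<^sub>0 (v (i + k)) (v (Suc (i + k)))"
      using v[of "i + k"] by (simp add: step_def)
    then show ?case
      using Suc between_trans(1) by auto
  qed simp
  have long: "i \<le> d x\<^sub>0 (v i)" for i
  proof (induction i)
    case (Suc i)
    then show ?case
      using v[of i] by (auto simp: step_def)
  qed simp
  have "\<exists>w. between x\<^sub>0 w (v n) \<and> d x\<^sub>0 w = n" for n
    using between_at[OF long] by metis
  then obtain s where s: "\<And>n. between x\<^sub>0 (s n) (v n)" "\<And>n. d x\<^sub>0 (s n) = n"
    by metis
  have s_v: "between x\<^sub>0 (s n) (v i)" if ni: "n \<le> d x\<^sub>0 (v i)" for n i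
  proof (cases "n \<le> i")
    case True
    then show ?thesis
      using s(1)[of n] mono[of n "i - n"] between_trans(1) by fastforce
  next
    case False
    then have iv: "between x\<^sub>0 (v i) (v n)"
      using mono[of i "n - i"] by auto
    obtain w where w: "between x\<^sub>0 w (v i)" "d x\<^sub>0 w = n"
      using between_at[OF ni] by blast
    then have "w = s n"
      using between_trans(1)[OF _ iv] between_unique[of x\<^sub>0 w "v n" "s n"] s by auto
    then show ?thesis
      using w by simp
  qed
  have s_s: "d (s m) (s (m + n)) = n" for m n
  proof -
    have "between x\<^sub>0 (s (m + n)) (v (m + n))" "between x\<^sub>0 (s m) (v (m + n))"
      using s_v[of _ "m + n"] long[of "m + n"] by auto
    moreover obtain w where "between x\<^sub>0 w (s (m + n))" "d x\<^sub>0 w = m"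
      using between_at[of m x\<^sub>0 "s (m + n)"] s by auto
    ultimately have "between x\<^sub>0 (s m) (s (m + n))"
      using between_trans(1) between_unique s(2) by metis
    then show ?thesis
      using s(2) by (simp add: between_def)
  qed
  then have "geodesic_ray adj s"
    by (simp add: geodesic_ray_def)
  then obtain g a b where g: "g \<in> G" "\<And>n. g (r (a + n)) = s (b + n)"
    using boundary_transitive_rays[OF boundary_transitive r] by blast
  let ?i = "prod_encode (a, b)"
  let ?u = "v (Suc ?i)"
  have step: "b \<le> d x\<^sub>0 ?u"
    "\<And>w. between x\<^sub>0 w ?u \<Longrightarrow> d x\<^sub>0 w = b \<Longrightarrow> \<not> (g (r a) = w \<and> g (r (a + d w ?u)) = ?u)"
    using v[of ?i] g(1) by (auto simp: step_def)
  have "s (d x\<^sub>0 ?u) = ?u"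
    using s_v[of "d x\<^sub>0 ?u" "Suc ?i"] s(2)[of "d x\<^sub>0 ?u"] by (auto simp: between_def)
  moreover have "d x\<^sub>0 ?u = b + d (s b) ?u"
    using s_v[OF step(1)] s(2)[of b] by (auto simp: between_def)
  ultimately show False
    using step(2)[OF s_v[OF step(1)] s(2)] g(2)[of 0] g(2)[of "d (s b) ?u"] by auto
qed

text \<open>Fullness of all edges is a local form of the transitivity of stabilisers on spheres. It passes from an
  edge to the edges that continue it, and it is invariant under the group.\<close>

definition full_edge :: "'v \<Rightarrow> 'v \<Rightarrow> bool" where
  "full_edge w u \<longleftrightarrow> adj w u \<and> (\<forall>v v'. between w u v \<and> between w u v' \<and> d w v = d w v' \<longrightarrow>
     (\<exists>g\<in>G. g w = w \<and> g v = v'))"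

lemma full_edge_G:
  assumes "h \<in> G" "full_edge w u"
  shows "full_edge (h w) (h u)"
  unfolding full_edge_def
proof (intro conjI allI impI)
  fix v v' assume *: "between (h w) (h u) v \<and> between (h w) (h u) v' \<and> d (h w) v = d (h w) v'"
  let ?v = "fun_inv h v" and ?v' = "fun_inv h v'"
  have "between w u ?v" "between w u ?v'" "d w ?v = d w ?v'"
    using * assms between_G[of h w u ?v] between_G[of h w u ?v'] gdist_G[of h w ?v] gdist_G[of h w ?v']
    by auto
  then obtain g where "g \<in> G" "g w = w" "g ?v = ?v'"
    using assms(2) unfolding full_edge_def by blast
  then show "\<exists>g\<in>G. g (h w) = h w \<and> g v = v'"
    using assms(1) by (intro bexI[of _ "h \<circ> g \<circ> fun_inv h"]) (auto intro: comp_G inv_G)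
qed (use assms adj_G in \<open>auto simp: full_edge_def\<close>)

text \<open>Beyond the edge from \<open>u\<close> to \<open>y\<close> one is also beyond the edge from \<open>w\<close> to \<open>u\<close>, and an element that
  fixes \<open>w\<close> and moves \<open>v\<close> to \<open>v'\<close> has to fix \<open>u\<close>, which lies between \<open>w\<close> and both of them.\<close>

lemma full_edge_next:
  assumes "full_edge w u" "adj u y" "y \<noteq> w"
  shows "full_edge u y"
  unfolding full_edge_def
proof (intro conjI allI impI)
  fix v v' assume *: "between u y v \<and> between u y v' \<and> d u v = d u v'"
  have wu: "adj w u"
    using assms(1) by (simp add: full_edge_def)
  have "d w y = Suc (d w u)"
    using gdist_non_parent[of w u y w] wu assms gdist_adj[OF wu] by auto
  then have beyond: "between w u z" if "between u y z" for z
    using that edge_between[of u y w z] assms(2) gdist_adj[OF assms(2)]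
    by (auto simp: between_def gdist_commute)
  have b: "between w u v" "between w u v'"
    using * beyond by auto
  then have "d w v = d w v'"
    using * by (auto simp: between_def)
  then obtain g where g: "g \<in> G" "g w = w" "g v = v'"
    using assms(1) b unfolding full_edge_def by blast
  have "g u = u"
    using between_unique[of w "g u" v' u] b between_G[of g w u v] gdist_G[of g w u] g by auto
  then show "\<exists>g\<in>G. g u = u \<and> g v = v'"
    using g by blast
qed (rule assms)

lemma ex_geodesic_ray: obtains r where "geodesic_ray adj r"
proof -
  have "\<exists>y. adj (snd p) y \<and> y \<noteq> fst p" if "adj (fst p) (snd p)" for p :: "'v \<times> 'v"
    using ex_extend that by blast
  moreover obtain x y where "adj x y"
    using ex_extend by metis
  ultimately obtain e :: "nat \<Rightarrow> 'v \<times> 'v" where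
    e: "\<And>n. adj (fst (e n)) (snd (e n))"
       "\<And>n. fst (e (Suc n)) = snd (e n) \<and> snd (e (Suc n)) \<noteq> fst (e n)"
    using dependent_nat_choice[of "\<lambda>_ p. adj (fst p) (snd p)"
        "\<lambda>_ p p'. fst p' = snd p \<and> snd p' \<noteq> fst p"]
    by (metis fst_conv snd_conv)
  have "geodesic_ray adj (\<lambda>n. fst (e n))"
    using e by (intro geodesic_ray_if_no_backtracking) metis+
  then show thesis
    using that by blast
qed

text \<open>If two elements map the same pair of vertices of a ray to \<open>(w, v)\<close> and to \<open>(w, v')\<close>, then the
  second one composed with the inverse of the first one fixes \<open>w\<close> and moves \<open>v\<close> to \<open>v'\<close>. So the
  vertex \<open>u\<^sub>0\<close> of \<open>cone_orbit\<close> gives full edges.\<close>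

lemma ex_full_edge: obtains w u where "full_edge w u"
proof -
  fix x\<^sub>0 :: 'v
  obtain r where r: "geodesic_ray adj r"
    using ex_geodesic_ray by blast
  obtain w u\<^sub>0 a where w: "between x\<^sub>0 w u\<^sub>0"
    "\<And>u'. between x\<^sub>0 u\<^sub>0 u' \<Longrightarrow> \<exists>g\<in>G. g (r a) = w \<and> g (r (a + d w u')) = u'"
    using cone_orbit[OF r, of x\<^sub>0] by metis
  \<comment> \<open>one step further, since \<open>w\<close> and \<open>u\<^sub>0\<close> may coincide\<close>
  obtain u where u: "between x\<^sub>0 u\<^sub>0 u" "d u\<^sub>0 u = 1"
    using ex_beyond by blast
  have wu: "between x\<^sub>0 w u" "between w u\<^sub>0 u"
    using between_trans[OF w(1) u(1)] by auto
  then obtain n where n: "d w u = Suc n"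
    using u(2) by (auto simp: between_def)
  obtain p where p: "d w p = n" "adj p u"
    using gdist_Suc_parent[OF n] by blast
  have "full_edge p u"
    unfolding full_edge_def
  proof (intro conjI allI impI)
    fix v v' assume *: "between p u v \<and> between p u v' \<and> d p v = d p v'"
    have wv: "between w u z \<and> between w p z" if "between p u z" for z
    proof -
      have "d z p = Suc (d z u)"
        using that gdist_adj[OF p(2)] by (auto simp: between_def gdist_commute)
      then show ?thesis
        using edge_between[of p u w z] that p n by (auto simp: between_def gdist_adj)
    qed
    have xv: "between x\<^sub>0 u\<^sub>0 z" if z: "between p u z" for z
    proof -
      have "d w u = Suc (d w u\<^sub>0)" "adj u\<^sub>0 u"
        using wu(2) u(2) by (auto simp: between_def adj_iff_gdist)
      then have "u\<^sub>0 = p"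
        using parent_unique[of u\<^sub>0 u p w] p n by simp
      then have "d x\<^sub>0 u = Suc (d x\<^sub>0 p)" "d z p = Suc (d z u)"
        using u z gdist_adj[OF p(2)] gdist_commute[of z p] gdist_commute[of z u]
        by (simp_all add: between_def)
      then show ?thesis
        using edge_between[of p u x\<^sub>0 z] z p(2) gdist_adj[OF p(2)] \<open>u\<^sub>0 = p\<close>
        by (simp add: between_def)
    qed
    have pv: "between p u v" "between p u v'" "d p v = d p v'"
      using * by auto
    have eq: "d w v = d w v'"
      using wv[OF pv(1)] wv[OF pv(2)] pv(3) unfolding between_def by simp
    obtain g where g: "g \<in> G" "g (r a) = w" "g (r (a + d w v)) = v"
      using w(2)[OF xv[OF pv(1)]] by blast
    obtain g' where g': "g' \<in> G" "g' (r a) = w" "g' (r (a + d w v)) = v'"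
      using w(2)[OF xv[OF pv(2)]] unfolding eq by blast
    let ?h = "g' \<circ> fun_inv g"
    have h: "?h \<in> G" "?h w = w" "?h v = v'"
      using g g' inv_G_apply(1)[OF g(1), of "r a"] inv_G_apply(1)[OF g(1), of "r (a + d w v)"]
      by (auto intro: comp_G inv_G)
    have "?h p = p"
      using between_unique[of w "?h p" v' p] between_G[OF h(1), of w p v] gdist_G[OF h(1), of w p]
        wv[OF pv(1)] wv[OF pv(2)] unfolding h(2,3) by blast
    then show "\<exists>g\<in>G. g p = p \<and> g v = v'"
      using h by blast
  qed (rule p)
  then show thesis
    using that by blast
qed

text \<open>If some edge were not full, every vertex \<open>z\<close> would have exactly one outgoing edge to a
  vertex \<open>f z\<close> that is not full, and \<open>f\<close> would commute with the group. The iterates of \<open>f\<close>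
  define a ray, and all rays would have to follow \<open>f\<close> eventually because the group is
  transitive on the boundary; but there are rays that run against \<open>f\<close>.\<close>

lemma all_full: assumes "adj x y" shows "full_edge x y"
proof (rule ccontr)
  assume not_full: "\<not> full_edge x y"
  obtain w u where wu: "full_edge w u"
    using ex_full_edge by blast
  have ex_in: "\<exists>p. full_edge p z \<and> (\<forall>y. adj z y \<longrightarrow> y \<noteq> p \<longrightarrow> full_edge z y)" for z
  proof -
    obtain g where g: "g \<in> G" "g u = z"
      using transitive by blast
    then show ?thesis
      using full_edge_G[OF g(1) wu] full_edge_next by blast
  qed
  have "\<exists>!y. adj z y \<and> \<not> full_edge z y" for z
  proof -
    obtain g where g: "g \<in> G" "g x = z"
      using transitive by blast
    have "adj z (g y) \<and> \<not> full_edge z (g y)"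
      using g assms not_full adj_G full_edge_G[OF inv_G[OF g(1)], of z "g y"] by auto
    then show ?thesis
      using ex_in[of z] by blast
  qed
  then obtain f where f: "\<And>z. adj z (f z)" "\<And>z. \<not> full_edge z (f z)"
    "\<And>z y. adj z y \<Longrightarrow> \<not> full_edge z y \<Longrightarrow> y = f z"
    by metis
  have f_in: "full_edge (f z) z" for z
    using ex_in[of z] f by metis
  have f_G: "f (g z) = g (f z)" if "g \<in> G" for g z
  proof -
    have "\<not> full_edge (g z) (g (f z))"
      using full_edge_G[OF inv_G[OF that], of "g z" "g (f z)"] f(2)[of z] that by auto
    then show ?thesis
      using f(3)[of "g z" "g (f z)"] f(1)[of z] adj_G[OF that] by simp
  qed
  let ?r = "\<lambda>n. (f ^^ n) x"
  have r: "geodesic_ray adj ?r"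
  proof (rule geodesic_ray_if_no_backtracking)
    fix n
    show "adj (?r n) (?r (Suc n))"
      using f(1) by simp
    show "?r (Suc (Suc n)) \<noteq> ?r n"
      using f_in[of "?r n"] f(2)[of "f (?r n)"] by auto
  qed
  have against: "f y = z" if "adj z y" "y \<noteq> f z" for y z
  proof -
    have "full_edge z y"
      using that f(3) by blast
    then show ?thesis
      using full_edge_next[of z y "f y"] f by metis
  qed
  have "\<exists>y. adj z y \<and> y \<noteq> f z" for z
    using ex_extend[of "f z" z] f(1) adj_sym by metis
  then obtain c where c: "\<And>z. adj z (c z)" "\<And>z. c z \<noteq> f z"
    by metis
  let ?s = "\<lambda>n. (c ^^ n) x"
  have fc: "f (c z) = z" for z
    using against c by blast
  have s: "geodesic_ray adj ?s"
  proof (rule geodesic_ray_if_no_backtracking)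
    fix n
    show "adj (?s n) (?s (Suc n))"
      using c(1) by simp
    show "?s (Suc (Suc n)) \<noteq> ?s n"
      using c(2)[of "c (?s n)"] fc by auto
  qed
  obtain g a b where g: "g \<in> G" "\<And>n. g (?r (a + n)) = ?s (b + n)"
    using boundary_transitive_rays[OF boundary_transitive r s] by blast
  have "f (?s (b + 1)) = g (f (?r (a + 1)))"
    using g f_G by metis
  also have "\<dots> = ?s (b + 2)"
    using g(2)[of 2] by simp
  finally have "?s (b + 2) = ?s b"
    using fc by simp
  moreover have "d (?s b) (?s (b + 2)) = 2"
    using s unfolding geodesic_ray_def by blast
  ultimately show False
    by simp
qed

text \<open>The first steps \<open>z\<close> and \<open>z'\<close> of the two geodesics are matched by means of a full edge that ends at
  \<open>x\<close> and starts at a third neighbour, which exists because there are at least three. The full edge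
  from \<open>x\<close> to \<open>z'\<close> then matches the rest.\<close>

lemma sphere_transitive:
  assumes "d x y = d x y'"
  obtains g where "g \<in> G" "g x = x" "g y = y'"
proof (cases "d x y")
  case 0
  then show thesis
    using that[of id] id_G assms by auto
next
  case (Suc n)
  obtain z where z: "between x z y" "d x z = 1"
    using between_at[of 1 x y] Suc by auto
  obtain z' where z': "between x z' y'" "d x z' = 1"
    using between_at[of 1 x y'] Suc assms by auto
  have xz: "adj x z" "adj x z'"
    using z z' adj_iff_gdist by auto
  obtain g where g: "g \<in> G" "g x = x" "g z = z'"
  proof (cases "z = z'")
    case True
    then show thesis
      using that[of id] id_G by auto
  next
    case False
    have "card ({w. adj x w} - {z, z'}) = q - 1"
      using xz False by (subst card_Diff_subset) auto
    then have "{w. adj x w} - {z, z'} \<noteq> {}"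
      using q_ge_2 by (metis One_nat_def card.empty diff_is_0_eq not_less_eq_eq numeral_2_eq_2)
    then obtain w where w: "adj w x" "w \<noteq> z" "w \<noteq> z'"
      using adj_sym by blast
    have "d w z = 2" "d w z' = 2"
      using gdist_non_parent[of w x _ w] w xz gdist_adj[OF w(1)] by auto
    then have b: "between w x z" "between w x z'" "d w z = d w z'"
      using gdist_adj[OF w(1)] gdist_adj[OF xz(1)] gdist_adj[OF xz(2)] by (auto simp: between_def)
    then obtain g where g: "g \<in> G" "g w = w" "g z = z'"
      using all_full[OF w(1)] unfolding full_edge_def by blast
    have "g x = x"
      using between_unique[of w "g x" z' x] between_G[OF g(1), of w x z] gdist_G[OF g(1), of w x] b
      unfolding g(2,3) by blast
    then show thesis
      using that g by blast
  qed
  have "between x z' (g y)" "d x (g y) = d x y'"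
    using between_G[OF g(1), of x z y] gdist_G[OF g(1), of x y] z g assms by auto
  then obtain h where "h \<in> G" "h x = x" "h (g y) = y'"
    using all_full[OF xz(2)] z'(1) unfolding full_edge_def by blast
  then show thesis
    using that[of "h \<circ> g"] g comp_G by auto
qed

lemma two_point_homogeneous:
  assumes "d x y = d x' y'"
  obtains g where "g \<in> G" "g x = x'" "g y = y'"
proof -
  obtain h where h: "h \<in> G" "h x = x'"
    using transitive by blast
  then have "d x' (h y) = d x' y'"
    using assms gdist_G[of h x y] by auto
  then obtain k where "k \<in> G" "k x' = x'" "k (h y) = y'"
    using sphere_transitive by blast
  then show thesis
    using that[of "k \<circ> h"] h comp_G by auto
qed

end

section \<open>Radial kernels of negative type\<close>

text \<open>Iterating the hypothesis gives \<open>b 1 ^ (2 ^ j) \<le> b 0 ^ (2 ^ j - 1) * b (2 ^ j)\<close>, and the growth bound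
  remains after the roots have been taken.\<close>

lemma log_convex_geometric_bound:
  fixes b :: "nat \<Rightarrow> real"
  assumes b0: "b 0 \<ge> 0" and cs: "\<And>k. (b k)\<^sup>2 \<le> b 0 * b (2 * k)"
    and growth: "\<And>k. \<bar>b k\<bar> \<le> C * D ^ k" and D: "D > 0"
  shows "\<bar>b 1\<bar> \<le> D * b 0"
proof (cases "b 0 = 0")
  case True
  then show ?thesis
    using cs[of 1] by simp
next
  case False
  then have pos: "b 0 > 0"
    using b0 by simp
  define r where "r = \<bar>b 1\<bar> / (D * b 0)"
  have r0: "r \<ge> 0"
    using pos D by (simp add: r_def)
  have ind: "r ^ (2 ^ j) \<le> \<bar>b (2 ^ j)\<bar> / (D ^ (2 ^ j) * b 0)" for j
  proof (induction j)
    case 0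
    then show ?case
      by (simp add: r_def)
  next
    case (Suc j)
    have "r ^ (2 ^ Suc j) = (r ^ (2 ^ j))\<^sup>2"
      by (simp add: power_mult[symmetric] mult.commute)
    also have "\<dots> \<le> (\<bar>b (2 ^ j)\<bar> / (D ^ (2 ^ j) * b 0))\<^sup>2"
      using Suc r0 by (intro power_mono) auto
    also have "\<dots> = (b (2 ^ j))\<^sup>2 / ((D ^ (2 ^ j))\<^sup>2 * (b 0)\<^sup>2)"
      by (simp add: power_divide power_mult_distrib)
    also have "\<dots> \<le> (b 0 * b (2 ^ Suc j)) / ((D ^ (2 ^ j))\<^sup>2 * (b 0)\<^sup>2)"
      using cs[of "2 ^ j"] by (intro divide_right_mono) auto
    also have "\<dots> = b (2 ^ Suc j) / ((D ^ (2 ^ j))\<^sup>2 * b 0)"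
      using pos by (simp add: power2_eq_square)
    also have "(D ^ (2 ^ j))\<^sup>2 = D ^ (2 ^ Suc j)"
      by (simp add: power_mult[symmetric] mult.commute)
    also have "b (2 ^ Suc j) / (D ^ (2 ^ Suc j) * b 0) \<le> \<bar>b (2 ^ Suc j)\<bar> / (D ^ (2 ^ Suc j) * b 0)"
      using pos D by (intro divide_right_mono) auto
    finally show ?case .
  qed
  have bound: "r ^ (2 ^ j) \<le> C / b 0" for j
  proof -
    have "\<bar>b (2 ^ j)\<bar> / (D ^ (2 ^ j) * b 0) \<le> (C * D ^ (2 ^ j)) / (D ^ (2 ^ j) * b 0)"
      using growth pos D by (intro divide_right_mono) auto
    then show ?thesis
      using ind[of j] D by simp
  qed
  have "r \<le> 1"
  proof (rule ccontr)
    assume "\<not> r \<le> 1"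
    then have r: "r > 1"
      by simp
    obtain n where "C / b 0 < r ^ n"
      using real_arch_pow[OF r] by blast
    also have "r ^ n \<le> r ^ (2 ^ n)"
      using r by (intro power_increasing) auto
    finally show False
      using bound[of n] by simp
  qed
  then show ?thesis
    using pos D by (simp add: r_def field_simps)
qed

lemma quadratic_discriminant:
  fixes A B C :: real
  assumes "\<And>t. A + 2 * t * B + t\<^sup>2 * C \<ge> 0" "C \<ge> 0"
  shows "B\<^sup>2 \<le> A * C"
proof (cases "C = 0")
  case True
  have "B = 0"
  proof (rule ccontr)
    assume "B \<noteq> 0"
    then have "2 * (- (A + 1) / (2 * B)) * B = - (A + 1)"
      by simp
    then show False
      using assms(1)[of "- (A + 1) / (2 * B)"] True by simp
  qed
  then show ?thesis
    using True by simp
next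
  case False
  have "(A + 2 * (- B / C) * B + (- B / C)\<^sup>2 * C) * C \<ge> 0"
    using assms(1)[of "- B / C"] assms(2) by (intro mult_nonneg_nonneg)
  moreover have "(A + 2 * (- B / C) * B + (- B / C)\<^sup>2 * C) * C = A * C - B\<^sup>2"
    using False by (simp add: field_simps power2_eq_square)
  ultimately show ?thesis
    by simp
qed

text \<open>Signed measures of finite support are encoded by their densities.\<close>

definition fin_supp :: "('v \<Rightarrow> real) \<Rightarrow> bool" where
  "fin_supp \<mu> \<longleftrightarrow> finite {x. \<mu> x \<noteq> 0}"

definition pairing :: "('v \<Rightarrow> real) \<Rightarrow> ('v \<Rightarrow> real) \<Rightarrow> real" where
  "pairing \<mu> f = (\<Sum>x | \<mu> x \<noteq> 0. \<mu> x * f x)"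

definition dirac :: "'v \<Rightarrow> 'v \<Rightarrow> real" where
  "dirac x y = (if y = x then 1 else 0)"

lemma pairing_eq:
  assumes "finite S" "\<And>x. \<mu> x \<noteq> 0 \<Longrightarrow> x \<in> S"
  shows "pairing \<mu> f = (\<Sum>x\<in>S. \<mu> x * f x)"
  unfolding pairing_def using assms by (intro sum.mono_neutral_left) auto

lemma fin_supp_dirac [simp]: "fin_supp (dirac x)"
  by (simp add: fin_supp_def dirac_def)

lemma pairing_dirac [simp]: "pairing (dirac x) f = f x"
  by (subst pairing_eq[of "{x}"]) (auto simp: dirac_def split: if_splits)

lemma fin_supp_lin [simp]:
  assumes "fin_supp \<mu>" "fin_supp \<nu>"
  shows "fin_supp (\<lambda>x. a * \<mu> x + b * \<nu> x)"
proof -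
  have "{x. a * \<mu> x + b * \<nu> x \<noteq> 0} \<subseteq> {x. \<mu> x \<noteq> 0} \<union> {x. \<nu> x \<noteq> 0}"
    by auto
  then show ?thesis
    using assms unfolding fin_supp_def by (meson finite_UnI finite_subset)
qed

lemma pairing_lin_left:
  assumes "fin_supp \<mu>" "fin_supp \<nu>"
  shows "pairing (\<lambda>x. a * \<mu> x + b * \<nu> x) f = a * pairing \<mu> f + b * pairing \<nu> f"
proof -
  let ?S = "{x. \<mu> x \<noteq> 0} \<union> {x. \<nu> x \<noteq> 0}"
  have S: "finite ?S"
    using assms by (simp add: fin_supp_def)
  have "pairing (\<lambda>x. a * \<mu> x + b * \<nu> x) f = (\<Sum>x\<in>?S. (a * \<mu> x + b * \<nu> x) * f x)"
    by (rule pairing_eq[OF S]) auto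
  moreover have "pairing \<mu> f = (\<Sum>x\<in>?S. \<mu> x * f x)" "pairing \<nu> f = (\<Sum>x\<in>?S. \<nu> x * f x)"
    by (rule pairing_eq[OF S]; auto)+
  ultimately show ?thesis
    by (simp add: sum.distrib sum_distrib_left algebra_simps)
qed

lemma pairing_lin_right:
  "pairing \<mu> (\<lambda>x. a * f x + b * g x) = a * pairing \<mu> f + b * pairing \<mu> g"
  by (simp add: pairing_def sum.distrib sum_distrib_left algebra_simps)

lemma pairing_sum_right: "pairing \<mu> (\<lambda>x. \<Sum>i\<in>I. f i x) = (\<Sum>i\<in>I. pairing \<mu> (f i))"
  unfolding pairing_def by (simp add: sum_distrib_left) (rule sum.swap)

lemma pairing_sum_left:
  assumes "finite I"
  shows "fin_supp (\<lambda>v. \<Sum>i\<in>I. \<alpha> i * dirac (x i) v) \<and>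
    pairing (\<lambda>v. \<Sum>i\<in>I. \<alpha> i * dirac (x i) v) f = (\<Sum>i\<in>I. \<alpha> i * f (x i))"
  using assms
proof (induction I rule: finite_induct)
  case empty
  then show ?case
    by (simp add: fin_supp_def pairing_def)
next
  case (insert i I)
  then show ?case
    using fin_supp_lin[OF fin_supp_dirac, of "\<lambda>v. \<Sum>i\<in>I. \<alpha> i * dirac (x i) v" "\<alpha> i" "x i" 1]
      pairing_lin_left[OF fin_supp_dirac, of "\<lambda>v. \<Sum>i\<in>I. \<alpha> i * dirac (x i) v" "\<alpha> i" "x i" 1 f]
    by simp
qed

lemma pairing_swap: "pairing \<mu> (\<lambda>x. pairing \<nu> (\<lambda>y. k x y)) = pairing \<nu> (\<lambda>y. pairing \<mu> (\<lambda>x. k x y))"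
  unfolding pairing_def sum_distrib_left by (subst sum.swap) (simp add: mult_ac)

context regular_tree_graph
begin

definition avg :: "('v \<Rightarrow> real) \<Rightarrow> 'v \<Rightarrow> real" where
  "avg f x = (\<Sum>y | adj x y. f y) / (real q + 1)"

lemma fin_supp_avg [simp]: assumes "fin_supp \<mu>" shows "fin_supp (avg \<mu>)"
proof -
  have "{x. avg \<mu> x \<noteq> 0} \<subseteq> (\<Union>y\<in>{y. \<mu> y \<noteq> 0}. {x. adj y x})"
  proof
    fix x assume "x \<in> {x. avg \<mu> x \<noteq> 0}"
    then obtain y where "adj x y" "\<mu> y \<noteq> 0"
      unfolding avg_def by (auto elim!: sum.not_neutral_contains_not_neutral)
    then show "x \<in> (\<Union>y\<in>{y. \<mu> y \<noteq> 0}. {x. adj y x})"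
      using adj_sym[of x y] by auto
  qed
  then show ?thesis
    using assms unfolding fin_supp_def by (meson finite_UN_I finite_nbrs finite_subset)
qed

lemma pairing_avg:
  assumes "fin_supp \<mu>"
  shows "pairing (avg \<mu>) f = pairing \<mu> (avg f)"
proof -
  define S where "S = {x. \<mu> x \<noteq> 0}"
  define T where "T = (\<Union>x\<in>S. {y. adj x y}) \<union> {x. avg \<mu> x \<noteq> 0}"
  have fin: "finite S" "finite T"
    using assms fin_supp_avg[OF assms] by (auto simp: S_def T_def fin_supp_def)
  have l: "(\<Sum>x | adj y x. \<mu> x) = (\<Sum>x\<in>S. if adj y x then \<mu> x else 0)" for y
  proof -
    have "(\<Sum>x\<in>S. if adj y x then \<mu> x else 0) = (\<Sum>x\<in>{x\<in>S. adj y x}. \<mu> x)"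
      using fin by (intro sum.inter_filter[symmetric])
    also have "\<dots> = (\<Sum>x | adj y x. \<mu> x)"
      by (intro sum.mono_neutral_left) (auto simp: S_def)
    finally show ?thesis ..
  qed
  have r: "(\<Sum>y | adj x y. f y) = (\<Sum>y\<in>T. if adj x y then f y else 0)" if "x \<in> S" for x
  proof -
    have "(\<Sum>y\<in>T. if adj x y then f y else 0) = (\<Sum>y\<in>{y\<in>T. adj x y}. f y)"
      using fin by (intro sum.inter_filter[symmetric])
    also have "{y\<in>T. adj x y} = {y. adj x y}"
      using that by (auto simp: T_def)
    finally show ?thesis ..
  qed
  have "pairing (avg \<mu>) f = (\<Sum>y\<in>T. avg \<mu> y * f y)"
    using fin by (intro pairing_eq) (auto simp: T_def)
  also have "\<dots> = (\<Sum>y\<in>T. \<Sum>x\<in>S. if adj y x then \<mu> x * f y / (real q + 1) else 0)"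
    by (simp add: avg_def l sum_distrib_right sum_divide_distrib if_distrib[of "\<lambda>z. z / _"]
        if_distrib[of "\<lambda>z. z * _"] cong: if_cong)
  also have "\<dots> = (\<Sum>x\<in>S. \<Sum>y\<in>T. if adj x y then \<mu> x * f y / (real q + 1) else 0)"
    by (subst sum.swap) (simp add: adj_sym)
  also have "\<dots> = (\<Sum>x\<in>S. \<mu> x * avg f x)"
    by (intro sum.cong) (auto simp: avg_def r sum_distrib_left sum_divide_distrib intro!: sum.cong)
  also have "\<dots> = pairing \<mu> (avg f)"
    by (simp add: pairing_def S_def)
  finally show ?thesis .
qed

text \<open>The action of the averaging operator on radial functions.\<close>

definition radial_avg :: "(nat \<Rightarrow> real) \<Rightarrow> nat \<Rightarrow> real" where
  "radial_avg \<phi> n = (if n = 0 then \<phi> 1 else (\<phi> (n - 1) + real q * \<phi> (n + 1)) / (real q + 1))"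

lemma avg_radial: "avg (\<lambda>y. \<phi> (d x y)) v = radial_avg \<phi> (d x v)"
  using q_ge_2 by (simp add: avg_def sum_nbrs_radial radial_avg_def)

lemma avg_const [simp]: "avg (\<lambda>_. c) = (\<lambda>_. c)"
  by (auto simp: avg_def fun_eq_iff divide_simps add.commute add_nonneg_eq_0_iff)

text \<open>If the radial kernel \<open>\<phi>\<close> is the square displacement of a map into a Hilbert space, then this is the
  inner product of the integrals of the map with respect to two measures of mass zero.\<close>

definition form :: "(nat \<Rightarrow> real) \<Rightarrow> ('v \<Rightarrow> real) \<Rightarrow> ('v \<Rightarrow> real) \<Rightarrow> real" where
  "form \<phi> \<mu> \<nu> = - 1 / 2 * pairing \<mu> (\<lambda>x. pairing \<nu> (\<lambda>y. \<phi> (d x y)))"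

lemma form_commute: "form \<phi> \<mu> \<nu> = form \<phi> \<nu> \<mu>"
  unfolding form_def by (subst pairing_swap) (simp add: gdist_commute)

lemma form_lin_left:
  "fin_supp \<mu> \<Longrightarrow> fin_supp \<mu>' \<Longrightarrow> form \<phi> (\<lambda>x. a * \<mu> x + b * \<mu>' x) \<nu> = a * form \<phi> \<mu> \<nu> + b * form \<phi> \<mu>' \<nu>"
  by (simp add: form_def pairing_lin_left algebra_simps)

lemma form_lin_right:
  "fin_supp \<mu> \<Longrightarrow> fin_supp \<mu>' \<Longrightarrow> form \<phi> \<nu> (\<lambda>x. a * \<mu> x + b * \<mu>' x) = a * form \<phi> \<nu> \<mu> + b * form \<phi> \<nu> \<mu>'"
  using form_lin_left[of \<mu> \<mu>' \<phi> a b \<nu>] by (simp add: form_commute)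

lemma form_diff_left:
  "fin_supp \<mu> \<Longrightarrow> fin_supp \<mu>' \<Longrightarrow> form \<phi> (\<lambda>x. \<mu> x - \<mu>' x) \<nu> = form \<phi> \<mu> \<nu> - form \<phi> \<mu>' \<nu>"
  using form_lin_left[of \<mu> \<mu>' \<phi> 1 "- 1" \<nu>] by simp

lemma form_diff_right:
  "fin_supp \<mu> \<Longrightarrow> fin_supp \<mu>' \<Longrightarrow> form \<phi> \<nu> (\<lambda>x. \<mu> x - \<mu>' x) = form \<phi> \<nu> \<mu> - form \<phi> \<nu> \<mu>'"
  using form_lin_right[of \<mu> \<mu>' \<phi> \<nu> 1 "- 1"] by simp

lemma form_lin_radial: "form (\<lambda>n. a * \<phi> n + b * \<phi>' n) \<mu> \<nu> = a * form \<phi> \<mu> \<nu> + b * form \<phi>' \<mu> \<nu>"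
  by (simp add: form_def pairing_lin_right algebra_simps)

lemma form_const: "form (\<lambda>_. c) \<mu> \<nu> = - c / 2 * (pairing \<mu> (\<lambda>_. 1) * pairing \<nu> (\<lambda>_. 1))"
proof -
  have "pairing \<nu> (\<lambda>_. c) = c * pairing \<nu> (\<lambda>_. 1)" for c and \<nu> :: "'v \<Rightarrow> real"
    by (simp add: pairing_def sum_distrib_left mult_ac)
  from this[of \<nu> c] this[of \<mu> "c * pairing \<nu> (\<lambda>_. 1)"] show ?thesis
    by (simp add: form_def)
qed

text \<open>Averaging commutes with the automorphisms of a regular tree, so it may be moved from a measure to
  the kernel, and from there to the other measure: it is symmetric for the form.\<close>

lemma form_avg_left: assumes "fin_supp \<mu>" shows "form \<phi> (avg \<mu>) \<nu> = form (radial_avg \<phi>) \<mu> \<nu>"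
proof -
  have "avg (\<lambda>x. pairing \<nu> (\<lambda>y. \<phi> (d x y))) v = pairing \<nu> (\<lambda>y. radial_avg \<phi> (d v y))" for v
  proof -
    have "avg (\<lambda>x. pairing \<nu> (\<lambda>y. \<phi> (d x y))) v = pairing \<nu> (\<lambda>y. avg (\<lambda>x. \<phi> (d y x)) v)"
      unfolding avg_def pairing_sum_right[symmetric]
      using pairing_lin_right[of \<nu> "1 / (real q + 1)" "\<lambda>y. \<Sum>x | adj v x. \<phi> (d y x)" 0 "\<lambda>_. 0"]
      by (simp add: gdist_commute)
    then show ?thesis
      by (simp add: avg_radial gdist_commute)
  qed
  then have "avg (\<lambda>x. pairing \<nu> (\<lambda>y. \<phi> (d x y))) = (\<lambda>v. pairing \<nu> (\<lambda>y. radial_avg \<phi> (d v y)))"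
    by (rule ext)
  then show ?thesis
    by (simp add: form_def pairing_avg[OF assms])
qed

lemma form_avg_right: "fin_supp \<nu> \<Longrightarrow> form \<phi> \<mu> (avg \<nu>) = form (radial_avg \<phi>) \<mu> \<nu>"
  using form_avg_left[of \<nu> \<phi> \<mu>] by (simp add: form_commute)

lemma form_dirac [simp]: "form \<phi> (dirac x) (dirac y) = - \<phi> (d x y) / 2"
  by (simp add: form_def)

definition radial_neg_type :: "(nat \<Rightarrow> real) \<Rightarrow> bool" where
  "radial_neg_type \<phi> \<longleftrightarrow> cond_neg_type_kernel UNIV (\<lambda>x y. \<phi> (d x y))"

definition mass0 :: "('v \<Rightarrow> real) \<Rightarrow> bool" where
  "mass0 \<mu> \<longleftrightarrow> fin_supp \<mu> \<and> pairing \<mu> (\<lambda>_. 1) = 0"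

lemma mass0_fin_supp [simp]: "mass0 \<mu> \<Longrightarrow> fin_supp \<mu>"
  by (simp add: mass0_def)

lemma mass0_lin: "mass0 \<mu> \<Longrightarrow> mass0 \<nu> \<Longrightarrow> mass0 (\<lambda>x. a * \<mu> x + b * \<nu> x)"
  by (simp add: mass0_def pairing_lin_left)

lemma mass0_avg: "mass0 \<mu> \<Longrightarrow> mass0 (avg \<mu>)"
  by (simp add: mass0_def pairing_avg)

lemma mass0_diff: "fin_supp \<mu> \<Longrightarrow> fin_supp \<nu> \<Longrightarrow> pairing \<mu> (\<lambda>_. 1) = pairing \<nu> (\<lambda>_. 1) \<Longrightarrow>
    mass0 (\<lambda>v. \<mu> v - \<nu> v)"
  using fin_supp_lin[of \<mu> \<nu> 1 "- 1"] pairing_lin_left[of \<mu> \<nu> 1 "- 1"] by (simp add: mass0_def)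

lemma radial_neg_type_0: "radial_neg_type \<phi> \<Longrightarrow> \<phi> 0 = 0"
  unfolding radial_neg_type_def cond_neg_type_kernel_def by (metis UNIV_I gdist_self)

lemma radial_neg_typeI:
  assumes "\<phi> 0 = 0" "\<And>\<mu>. mass0 \<mu> \<Longrightarrow> form \<phi> \<mu> \<mu> \<ge> 0"
  shows "radial_neg_type \<phi>"
  unfolding radial_neg_type_def cond_neg_type_kernel_def
proof (intro conjI ballI allI impI)
  fix n :: nat and x :: "nat \<Rightarrow> 'v" and \<alpha> :: "nat \<Rightarrow> real"
  assume \<alpha>: "(\<forall>i<n. x i \<in> UNIV) \<and> (\<Sum>i<n. \<alpha> i) = 0"
  let ?\<mu> = "\<lambda>v. \<Sum>i<n. \<alpha> i * dirac (x i) v"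
  have \<mu>: "fin_supp ?\<mu>" "\<And>f. pairing ?\<mu> f = (\<Sum>i<n. \<alpha> i * f (x i))"
    using pairing_sum_left[of "{..<n}" \<alpha> x] by auto
  then have "mass0 ?\<mu>"
    using \<alpha> by (simp add: mass0_def)
  then have "form \<phi> ?\<mu> ?\<mu> \<ge> 0"
    by (rule assms)
  moreover have "pairing ?\<mu> (\<lambda>x. pairing ?\<mu> (\<lambda>y. \<phi> (d x y))) = (\<Sum>i<n. \<Sum>j<n. \<alpha> i * \<alpha> j * \<phi> (d (x i) (x j)))"
    by (simp add: \<mu>(2) sum_distrib_left mult_ac)
  ultimately show "(\<Sum>i<n. \<Sum>j<n. \<alpha> i * \<alpha> j * \<phi> (d (x i) (x j))) \<le> 0"
    by (simp add: form_def)
qed (auto simp: assms gdist_commute)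

lemma form_nonneg:
  assumes "radial_neg_type \<phi>" "mass0 \<mu>"
  shows "form \<phi> \<mu> \<mu> \<ge> 0"
proof -
  let ?S = "{x. \<mu> x \<noteq> 0}"
  obtain x where x: "bij_betw x {..<card ?S} ?S"
    using assms(2) ex_bij_betw_nat_finite[of ?S] by (auto simp: mass0_def fin_supp_def atLeast0LessThan)
  have p: "pairing \<mu> f = (\<Sum>i<card ?S. \<mu> (x i) * f (x i))" for f
    unfolding pairing_def by (rule sum.reindex_bij_betw[OF x, symmetric])
  have "(\<Sum>i<card ?S. \<mu> (x i)) = 0"
    using assms(2) p[of "\<lambda>_. 1"] by (simp add: mass0_def)
  then have "(\<Sum>i<card ?S. \<Sum>j<card ?S. \<mu> (x i) * \<mu> (x j) * \<phi> (d (x i) (x j))) \<le> 0"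
    using assms(1) unfolding radial_neg_type_def cond_neg_type_kernel_def by simp
  moreover have "pairing \<mu> (\<lambda>x. pairing \<mu> (\<lambda>y. \<phi> (d x y))) =
      (\<Sum>i<card ?S. \<Sum>j<card ?S. \<mu> (x i) * \<mu> (x j) * \<phi> (d (x i) (x j)))"
    by (simp add: p sum_distrib_left mult_ac)
  ultimately show ?thesis
    by (simp add: form_def)
qed

lemma form_Cauchy_Schwarz:
  assumes "radial_neg_type \<phi>" "mass0 \<mu>" "mass0 \<nu>"
  shows "(form \<phi> \<mu> \<nu>)\<^sup>2 \<le> form \<phi> \<mu> \<mu> * form \<phi> \<nu> \<nu>"
proof (rule quadratic_discriminant)
  fix t
  have "form \<phi> (\<lambda>x. 1 * \<mu> x + t * \<nu> x) (\<lambda>x. 1 * \<mu> x + t * \<nu> x) \<ge> 0"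
    by (intro form_nonneg[OF assms(1)] mass0_lin assms)
  then show "form \<phi> \<mu> \<mu> + 2 * t * form \<phi> \<mu> \<nu> + t\<^sup>2 * form \<phi> \<nu> \<nu> \<ge> 0"
    using assms form_commute[of \<phi> \<nu> \<mu>]
    by (subst (asm) form_lin_left, simp, simp, subst (asm) (1 2) form_lin_right)
       (auto simp: algebra_simps power2_eq_square)
qed (use assms form_nonneg in auto)

lemma ex_gdist: obtains x y where "d x y = n"
  using ex_beyond by metis

lemma radial_neg_type_nonneg:
  assumes "radial_neg_type \<phi>"
  shows "\<phi> n \<ge> 0"
proof -
  obtain x y where xy: "d x y = n"
    by (rule ex_gdist)
  have "form \<phi> (\<lambda>v. dirac x v - dirac y v) (\<lambda>v. dirac x v - dirac y v) \<ge> 0"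
    by (intro form_nonneg[OF assms] mass0_diff) auto
  then show ?thesis
    using radial_neg_type_0[OF assms] xy
    by (simp add: form_diff_left form_diff_right gdist_commute[of y x])
qed

lemma form_diff_dirac:
  assumes "\<phi> 0 = 0"
  shows "form \<phi> (\<lambda>v. dirac x v - dirac y v) (\<lambda>v. dirac x v - dirac y v) = \<phi> (d x y)"
  using assms by (simp add: form_diff_left form_diff_right gdist_commute[of y x])

text \<open>The triangle inequality for the square root of \<open>\<phi>\<close>, squared.\<close>

lemma radial_neg_type_Suc:
  assumes "radial_neg_type \<phi>"
  shows "\<phi> (Suc n) \<le> 2 * \<phi> n + 2 * \<phi> 1"
proof -
  obtain x z where xz: "d x z = Suc n"
    by (rule ex_gdist)
  obtain y where y: "d x y = n" "adj y z"
    using gdist_Suc_parent[OF xz] by blast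
  define \<mu> \<nu> where "\<mu> = (\<lambda>v. dirac x v - dirac y v)" and "\<nu> = (\<lambda>v. dirac y v - dirac z v)"
  have m: "mass0 \<mu>" "mass0 \<nu>"
    unfolding \<mu>_def \<nu>_def by (auto intro!: mass0_diff)
  then have "form \<phi> (\<lambda>v. \<mu> v - \<nu> v) (\<lambda>v. \<mu> v - \<nu> v) \<ge> 0"
    by (intro form_nonneg[OF assms] mass0_diff) (auto simp: mass0_def)
  then have "form \<phi> \<mu> \<mu> - form \<phi> \<mu> \<nu> - (form \<phi> \<nu> \<mu> - form \<phi> \<nu> \<nu>) \<ge> 0"
    using m by (simp add: form_diff_left form_diff_right)
  then show ?thesis
    using radial_neg_type_0[OF assms] xz y gdist_adj[OF y(2)] unfolding \<mu>_def \<nu>_def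
    by (simp add: form_diff_left form_diff_right gdist_commute[of y x] gdist_commute[of z x]
        gdist_commute[of z y])
qed

lemma radial_neg_type_growth:
  assumes "radial_neg_type \<phi>"
  shows "\<phi> n \<le> \<phi> 1 * 4 ^ n"
proof (induction n)
  case 0
  then show ?case
    using radial_neg_type_0[OF assms] radial_neg_type_nonneg[OF assms] by simp
next
  case (Suc n)
  have "\<phi> 1 * 1 \<le> \<phi> 1 * 4 ^ n"
    using radial_neg_type_nonneg[OF assms] by (intro mult_left_mono) auto
  then show ?case
    using Suc radial_neg_type_Suc[OF assms, of n] by simp
qed

lemma funpow_avg_mass0: "mass0 \<mu> \<Longrightarrow> mass0 ((avg ^^ k) \<mu>)"
  by (induction k) (auto simp: mass0_avg)

lemma form_funpow_avg_left:
  "fin_supp \<mu> \<Longrightarrow> fin_supp ((avg ^^ k) \<mu>) \<and> form \<phi> ((avg ^^ k) \<mu>) \<nu> = form ((radial_avg ^^ k) \<phi>) \<mu> \<nu>"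
proof (induction k arbitrary: \<phi>)
  case (Suc k)
  then show ?case
    by (simp add: form_avg_left funpow_swap1[of radial_avg])
qed simp

lemma radial_avg_growth:
  assumes "\<And>n. \<bar>\<phi> n\<bar> \<le> c * 4 ^ n"
  shows "\<bar>(radial_avg ^^ k) \<phi> n\<bar> \<le> c * 4 ^ k * 4 ^ n"
proof (induction k arbitrary: n)
  case (Suc k)
  let ?\<phi> = "(radial_avg ^^ k) \<phi>" and ?c = "c * 4 ^ k"
  have c: "?c \<ge> 0"
    using assms[of 0] by (metis abs_ge_zero mult.right_neutral mult_nonneg_nonneg order_trans
        power_0 zero_le_numeral zero_le_power)
  show ?case
  proof (cases n)
    case 0
    then show ?thesis
      using Suc.IH[of 1] by (simp add: radial_avg_def mult_ac)
  next
    case (Suc m)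
    have "\<bar>?\<phi> m + real q * ?\<phi> (m + 2)\<bar> \<le> \<bar>?\<phi> m\<bar> + real q * \<bar>?\<phi> (m + 2)\<bar>"
      by (metis abs_mult abs_of_nat abs_triangle_ineq)
    also have "\<dots> \<le> ?c * 4 ^ m + real q * (?c * 4 ^ (m + 2))"
      using Suc.IH[of m] Suc.IH[of "m + 2"] by (intro add_mono mult_left_mono) auto
    also have "\<dots> \<le> ?c * 4 ^ (m + 2) + real q * (?c * 4 ^ (m + 2))"
      using c by (intro add_mono mult_left_mono power_increasing) auto
    also have "\<dots> = (real q + 1) * (4 * ?c * 4 ^ n)"
      using Suc by (simp add: algebra_simps)
    finally show ?thesis
      using Suc by (simp add: radial_avg_def[of "(radial_avg ^^ k) \<phi>"] field_simps)
  qed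
qed (use assms in simp)

text \<open>The averaging operator is symmetric for the form of \<open>\<phi>\<close>, so by iterating the
  Cauchy-Schwarz inequality its norm is at most the exponential growth rate of the powers of
  \<open>radial_avg\<close> on \<open>\<phi>\<close>, for which the crude bound by powers of 4 is enough.\<close>

lemma form_radial_avg_bound:
  assumes "radial_neg_type \<phi>" "mass0 \<mu>"
  shows "\<bar>form (radial_avg \<phi>) \<mu> \<mu>\<bar> \<le> 4 * form \<phi> \<mu> \<mu>"
proof -
  let ?b = "\<lambda>k. form ((radial_avg ^^ k) \<phi>) \<mu> \<mu>"
  define C where "C = 1 / 2 * (\<Sum>x | \<mu> x \<noteq> 0. \<Sum>y | \<mu> y \<noteq> 0. \<bar>\<mu> x\<bar> * \<bar>\<mu> y\<bar> * (\<phi> 1 * 4 ^ d x y))"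
  have "\<bar>?b 1\<bar> \<le> 4 * ?b 0"
  proof (rule log_convex_geometric_bound)
    show "?b 0 \<ge> 0"
      using form_nonneg assms by simp
    show "(?b k)\<^sup>2 \<le> ?b 0 * ?b (2 * k)" for k
    proof -
      have m: "mass0 ((avg ^^ k) \<mu>)"
        using funpow_avg_mass0 assms by blast
      have 1: "form \<phi> \<mu> ((avg ^^ k) \<mu>) = ?b k"
        using form_funpow_avg_left[of \<mu> k \<phi> \<mu>] assms form_commute by simp
      have "form \<phi> ((avg ^^ k) \<mu>) ((avg ^^ k) \<mu>) = form ((radial_avg ^^ k) \<phi>) ((avg ^^ k) \<mu>) \<mu>"
        using form_funpow_avg_left[of \<mu> k \<phi> "(avg ^^ k) \<mu>"] assms form_commute by simp
      also have "\<dots> = ?b (2 * k)"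
        using form_funpow_avg_left[of \<mu> k "(radial_avg ^^ k) \<phi>" \<mu>] assms
        by (simp add: mult_2 funpow_add)
      finally show ?thesis
        using form_Cauchy_Schwarz[OF assms m] 1 by simp
    qed
    show "\<bar>?b k\<bar> \<le> C * 4 ^ k" for k
    proof -
      have \<phi>: "\<bar>\<phi> n\<bar> \<le> \<phi> 1 * 4 ^ n" for n
        using radial_neg_type_growth radial_neg_type_nonneg assms by simp
      have "\<bar>?b k\<bar> = 1 / 2 * \<bar>\<Sum>x | \<mu> x \<noteq> 0. \<Sum>y | \<mu> y \<noteq> 0. \<mu> x * (\<mu> y * (radial_avg ^^ k) \<phi> (d x y))\<bar>"
        unfolding form_def pairing_def sum_distrib_left[symmetric] by (simp add: abs_mult)
      also have "\<dots> \<le> 1 / 2 * (\<Sum>x | \<mu> x \<noteq> 0. \<Sum>y | \<mu> y \<noteq> 0. \<bar>\<mu> x * (\<mu> y * (radial_avg ^^ k) \<phi> (d x y))\<bar>)"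
        by (intro mult_left_mono order_trans[OF sum_abs] sum_mono) auto
      also have "\<dots> \<le> 1 / 2 * (\<Sum>x | \<mu> x \<noteq> 0. \<Sum>y | \<mu> y \<noteq> 0. \<bar>\<mu> x\<bar> * (\<bar>\<mu> y\<bar> * (\<phi> 1 * 4 ^ k * 4 ^ d x y)))"
        using radial_avg_growth[OF \<phi>] unfolding abs_mult
        by (intro mult_left_mono sum_mono) auto
      also have "\<dots> = C * 4 ^ k"
        by (simp add: C_def sum_distrib_left sum_distrib_right mult_ac)
      finally show ?thesis .
    qed
  qed simp
  then show ?thesis
    by simp
qed

text \<open>The form of this kernel is half that of \<open>1 + s * avg\<close>, which is nonnegative by the bound on
  the averaging operator. Subtracting \<open>\<phi> 1\<close> makes the kernel vanish on the diagonal.\<close>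

lemma radial_neg_type_dominated:
  assumes "radial_neg_type \<phi>" "\<bar>s\<bar> \<le> 1 / 4"
  shows "radial_neg_type (\<lambda>n. (\<phi> n + s * (radial_avg \<phi> n - \<phi> 1)) / 2)"
proof (rule radial_neg_typeI)
  fix \<mu> assume \<mu>: "mass0 \<mu>"
  have "form (\<lambda>n. (\<phi> n + s * (radial_avg \<phi> n - \<phi> 1)) / 2) \<mu> \<mu> =
    form (\<lambda>n. 1 / 2 * (1 * \<phi> n + s * (1 * radial_avg \<phi> n + (- \<phi> 1) * 1)) + 0 * 0) \<mu> \<mu>"
    by simp
  also have "\<dots> = 1 / 2 * (form \<phi> \<mu> \<mu> + s * form (radial_avg \<phi>) \<mu> \<mu>)"
    using \<mu> by (simp only: form_lin_radial form_const) (simp add: mass0_def)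
  finally have eq: "form (\<lambda>n. (\<phi> n + s * (radial_avg \<phi> n - \<phi> 1)) / 2) \<mu> \<mu> =
    1 / 2 * (form \<phi> \<mu> \<mu> + s * form (radial_avg \<phi>) \<mu> \<mu>)" .
  have "\<bar>s * form (radial_avg \<phi>) \<mu> \<mu>\<bar> \<le> 1 / 4 * (4 * form \<phi> \<mu> \<mu>)"
    unfolding abs_mult using assms form_radial_avg_bound[OF assms(1) \<mu>] by (intro mult_mono) auto
  then show "form (\<lambda>n. (\<phi> n + s * (radial_avg \<phi> n - \<phi> 1)) / 2) \<mu> \<mu> \<ge> 0"
    unfolding eq using abs_le_D2[of "s * form (radial_avg \<phi>) \<mu> \<mu>" "form \<phi> \<mu> \<mu>"] by simp
qed (simp add: radial_neg_type_0[OF assms(1)] radial_avg_def)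

lemma mass0_dirac_avg: "mass0 (\<lambda>v. dirac x v - avg (dirac x) v)"
  by (rule mass0_diff) (auto simp: pairing_avg)

lemma form_laplace_dirac:
  "form \<phi> (\<lambda>v. dirac x v - avg (dirac x) v) (\<lambda>v. dirac x v - dirac y v) =
    - ((\<phi> 0 - radial_avg \<phi> 0) - (\<phi> (d x y) - radial_avg \<phi> (d x y))) / 2"
  by (simp add: form_diff_left form_diff_right form_avg_left)

lemma form_laplace_laplace:
  "form \<phi> (\<lambda>v. dirac x v - avg (dirac x) v) (\<lambda>v. dirac x v - avg (dirac x) v) =
    - (\<phi> 0 - 2 * radial_avg \<phi> 0 + radial_avg (radial_avg \<phi>) 0) / 2"
  by (simp add: form_diff_left form_diff_right form_avg_left form_avg_right)

text \<open>The inner product of the fixed measure \<open>dirac x - avg (dirac x)\<close> with \<open>dirac x - dirac y\<close> is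
  \<open>(1 - t) * \<phi> (d x y) / 2\<close>, while the square norm of the latter is only \<open>\<phi> (d x y)\<close>.\<close>

lemma eigenfunction_bounded:
  assumes "radial_neg_type \<phi>" "\<And>n. radial_avg \<phi> n - \<phi> 1 = t * \<phi> n" "t \<noteq> 1"
  obtains B where "\<And>n. \<phi> n \<le> B"
proof -
  define e where "e = - (\<phi> 0 - 2 * radial_avg \<phi> 0 + radial_avg (radial_avg \<phi>) 0) / 2"
  have "\<phi> n \<le> 4 * e / (1 - t)\<^sup>2" for n
  proof -
    obtain x y where xy: "d x y = n"
      by (rule ex_gdist)
    have \<phi>0: "\<phi> 0 = 0"
      by (rule radial_neg_type_0[OF assms(1)])
    have "(- ((\<phi> 0 - radial_avg \<phi> 0) - (\<phi> n - radial_avg \<phi> n)) / 2)\<^sup>2 \<le> e * \<phi> n"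
      using form_Cauchy_Schwarz[OF assms(1) mass0_dirac_avg mass0_diff[of "dirac x" "dirac y"], of x]
      by (simp only: form_laplace_dirac form_laplace_laplace form_diff_dirac[where \<phi> = \<phi>, OF \<phi>0] e_def xy
          fin_supp_dirac pairing_dirac simp_thms)
    moreover have "- ((\<phi> 0 - radial_avg \<phi> 0) - (\<phi> n - radial_avg \<phi> n)) / 2 = (1 - t) * \<phi> n / 2"
      using assms(2)[of n] \<phi>0 by (simp add: radial_avg_def algebra_simps)
    ultimately have *: "((1 - t) * \<phi> n / 2)\<^sup>2 \<le> e * \<phi> n"
      by (simp only:)
    have "\<phi> n \<ge> 0"
      by (rule radial_neg_type_nonneg[OF assms(1)])
    show ?thesis
    proof (cases "\<phi> n = 0")
      case True
      obtain x y where "d x y = (1::nat)"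
        by (rule ex_gdist)
      have "e \<ge> 0"
        using form_nonneg[OF assms(1) mass0_dirac_avg] unfolding form_laplace_laplace e_def .
      then show ?thesis
        using True by simp
    next
      case False
      then have pos: "\<phi> n > 0"
        using \<open>\<phi> n \<ge> 0\<close> by simp
      have "((1 - t)\<^sup>2 * \<phi> n) * \<phi> n \<le> (4 * e) * \<phi> n"
        using * by (simp add: power_mult_distrib power_divide power2_eq_square field_simps)
      then have "(1 - t)\<^sup>2 * \<phi> n \<le> 4 * e"
        using pos by (metis mult_le_cancel_right_pos)
      then show ?thesis
        using assms(3) by (simp add: field_simps)
    qed
  qed
  then show thesis
    using that by blast
qed

definition harmonic_profile :: "nat \<Rightarrow> real" where
  "harmonic_profile n = real n - 2 * real q / ((real q)\<^sup>2 - 1) + 2 * real q / ((real q)\<^sup>2 - 1) * (1 / real q) ^ n"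

lemma tree_kernel_eq: "tree_kernel q adj x y = harmonic_profile (d x y)"
  by (simp add: tree_kernel_def harmonic_profile_def power_int_minus power_one_over field_simps)

lemma q_sq_gt_1: "(real q)\<^sup>2 - 1 > 0"
  using q_ge_2 power_strict_increasing[of 0 2 "real q"] by simp

lemma harmonic_profile_0 [simp]: "harmonic_profile 0 = 0"
  by (simp add: harmonic_profile_def)

lemma harmonic_profile_1: "harmonic_profile 1 = (real q - 1) / (real q + 1)"
proof -
  have "((real q)\<^sup>2 - 1) = (real q - 1) * (real q + 1)"
    by (simp add: power2_eq_square algebra_simps)
  then show ?thesis
    using q_ge_2 q_sq_gt_1 by (simp add: harmonic_profile_def divide_simps) (simp add: algebra_simps)
qed

lemma harmonic_profile_1_pos: "harmonic_profile 1 > 0"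
  using q_ge_2 unfolding harmonic_profile_1 by simp

lemma radial_avg_harmonic_profile: "radial_avg harmonic_profile n = harmonic_profile n + harmonic_profile 1"
proof (cases n)
  case 0
  then show ?thesis
    by (simp add: radial_avg_def)
next
  case (Suc m)
  define c where "c = 2 * real q / ((real q)\<^sup>2 - 1)"
  define p where "p = (1 / real q) ^ m"
  have q: "real q > 0"
    using q_ge_2 by simp
  have profile: "harmonic_profile k = real k - c + c * (1 / real q) ^ k" for k
    by (simp add: harmonic_profile_def c_def)
  have "(real q + 1) * radial_avg harmonic_profile n =
      (real m - c + c * p) + real q * (real m + 2 - c + c * (p / (real q * real q)))"
    using Suc q by (simp add: radial_avg_def profile p_def)
  also have "\<dots> = (real q + 1) * (real m + 1 - c + c * (p / real q)) + (real q - 1)"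
    using q by (simp add: field_simps)
  also have "\<dots> = (real q + 1) * (harmonic_profile n + harmonic_profile 1)"
  proof -
    have "harmonic_profile n = real m + 1 - c + c * (p / real q)"
      using Suc by (simp add: profile p_def)
    moreover have "(real q + 1) * harmonic_profile 1 = real q - 1"
      using q unfolding harmonic_profile_1 by simp
    ultimately show ?thesis
      by (simp add: distrib_left)
  qed
  finally show ?thesis
    using q by simp
qed

lemma harmonic_recursion_unique:
  assumes "\<phi> 0 = 0" "\<And>n. radial_avg \<phi> n = \<phi> n + \<phi> 1"
  shows "\<phi> n = \<phi> 1 / harmonic_profile 1 * harmonic_profile n"
proof -
  have step: "\<psi> (Suc (Suc n)) = ((real q + 1) * (\<psi> (Suc n) + \<psi> 1) - \<psi> n) / real q"
    if "\<And>n. radial_avg \<psi> n = \<psi> n + \<psi> 1" for \<psi> n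
    using that[of "Suc n"] q_ge_2 by (simp add: radial_avg_def field_simps)
  define k where "k = \<phi> 1 / harmonic_profile 1"
  have k1: "\<phi> 1 = k * harmonic_profile 1"
    using harmonic_profile_1_pos by (simp add: k_def)
  have "\<phi> n = k * harmonic_profile n \<and> \<phi> (Suc n) = k * harmonic_profile (Suc n)"
  proof (induction n)
    case 0
    then show ?case
      using assms(1) k1 by simp
  next
    case (Suc n)
    have "\<phi> (Suc (Suc n)) = ((real q + 1) * (\<phi> (Suc n) + \<phi> 1) - \<phi> n) / real q"
      by (rule step[OF assms(2)])
    also have "(real q + 1) * (\<phi> (Suc n) + \<phi> 1) - \<phi> n =
        k * ((real q + 1) * (harmonic_profile (Suc n) + harmonic_profile 1) - harmonic_profile n)"
      using Suc k1 by (simp add: algebra_simps)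
    finally show ?case
      using Suc step[OF radial_avg_harmonic_profile, of n] by simp
  qed
  then show ?thesis
    by (simp add: k_def)
qed

text \<open>That a kernel corresponds to a harmonic embedding means that the associated form vanishes on
  \<open>dirac x - avg (dirac x)\<close>. This passes to each of two summands, because both are
  nonnegative there, and a harmonic embedding is determined up to scaling by the recursion.\<close>

lemma harmonic_profile_extremal:
  assumes "radial_neg_type \<phi>\<^sub>1" "radial_neg_type \<phi>\<^sub>2" "\<And>n. harmonic_profile n = \<phi>\<^sub>1 n + \<phi>\<^sub>2 n"
  obtains t where "t \<ge> 0" "\<And>n. \<phi>\<^sub>1 n = t * harmonic_profile n"
proof -
  obtain x :: 'v where True
    by blast
  let ?\<mu> = "\<lambda>v. dirac x v - avg (dirac x) v"
  have "form harmonic_profile ?\<mu> ?\<mu> = 0"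
    unfolding form_laplace_laplace
    by (simp add: radial_avg_harmonic_profile radial_avg_def[of "radial_avg harmonic_profile"])
  moreover have "form harmonic_profile ?\<mu> ?\<mu> = form \<phi>\<^sub>1 ?\<mu> ?\<mu> + form \<phi>\<^sub>2 ?\<mu> ?\<mu>"
    using form_lin_radial[of 1 \<phi>\<^sub>1 1 \<phi>\<^sub>2 ?\<mu> ?\<mu>] assms(3)[abs_def] by simp
  ultimately have 0: "form \<phi>\<^sub>1 ?\<mu> ?\<mu> = 0"
    using form_nonneg[OF assms(1) mass0_dirac_avg, of x] form_nonneg[OF assms(2) mass0_dirac_avg, of x]
    by linarith
  have \<phi>0: "\<phi>\<^sub>1 0 = 0"
    by (rule radial_neg_type_0[OF assms(1)])
  have rec: "radial_avg \<phi>\<^sub>1 n = \<phi>\<^sub>1 n + \<phi>\<^sub>1 1" for n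
  proof -
    obtain y where y: "d x y = n"
      using ex_beyond by metis
    have "(form \<phi>\<^sub>1 ?\<mu> (\<lambda>v. dirac x v - dirac y v))\<^sup>2 \<le> 0"
      using form_Cauchy_Schwarz[OF assms(1) mass0_dirac_avg mass0_diff[of "dirac x" "dirac y"], of x] 0
      by simp
    then show ?thesis
      unfolding form_laplace_dirac using \<phi>0 y by (simp add: radial_avg_def[of _ 0])
  qed
  show thesis
  proof (rule that)
    show "\<phi>\<^sub>1 1 / harmonic_profile 1 \<ge> 0"
      using harmonic_profile_1_pos radial_neg_type_nonneg[OF assms(1), of 1] by simp
    show "\<phi>\<^sub>1 n = \<phi>\<^sub>1 1 / harmonic_profile 1 * harmonic_profile n" for n
      by (rule harmonic_recursion_unique[OF \<phi>0 rec])
  qed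
qed

lemma harmonic_profile_unbounded: "\<exists>n. harmonic_profile n > B"
proof -
  define c where "c = 2 * real q / ((real q)\<^sup>2 - 1)"
  have "c \<ge> 0"
    using q_sq_gt_1 by (simp add: c_def)
  obtain n :: nat where "real n > B + c"
    using reals_Archimedean2 by blast
  moreover have "harmonic_profile n \<ge> real n - c"
    using mult_nonneg_nonneg[OF \<open>c \<ge> 0\<close>, of "(1 / real q) ^ n"]
    by (simp add: harmonic_profile_def c_def[symmetric])
  ultimately show ?thesis
    by (intro exI[of _ n]) linarith
qed

end

section \<open>The harmonic component of the Haagerup cocycle\<close>

context tree
begin

lemma successively_gdist_le:
  assumes "successively adj p" "i \<le> j" "j < length p"
  shows "d (p ! i) (p ! j) \<le> j - i"
  using assms(2,3)
proof (induction "j - i" arbitrary: j)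
  case 0
  then show ?case
    by simp
next
  case (Suc n)
  then obtain k where k: "j = Suc k" "i \<le> k"
    by (cases j) auto
  then have "adj (p ! k) (p ! j)"
    using assms(1) Suc.prems by (simp add: successively_conv_nth)
  then have "d (p ! k) (p ! j) = 1"
    by (rule gdist_adj)
  moreover have "d (p ! i) (p ! k) \<le> k - i"
    using Suc k by auto
  ultimately show ?case
    using gdist_triangle[of "p ! i" "p ! j" "p ! k"] k by linarith
qed

lemma ex_geodesic: obtains p where "geodesic adj x y p"
proof (induction "d x y" arbitrary: y thesis)
  case 0
  then show ?case
    using 0(2)[of "[x]"] by (simp add: geodesic_def)
next
  case (Suc n)
  then obtain z where z: "d x z = n" "adj z y"
    using gdist_Suc_parent by metis
  obtain p where p: "geodesic adj x z p"
    using Suc.hyps(1)[of z] z(1) by blast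
  then have "p \<noteq> []"
    by (auto simp: geodesic_def)
  then have "geodesic adj x y (p @ [y])"
    using p z Suc.hyps(2) by (auto simp: geodesic_def successively_append_iff)
  then show ?case
    by (rule Suc.prems)
qed

lemma ex_geodesic_traverses_iff:
  "(\<exists>p. geodesic adj x y p \<and> traverses p (u, v)) \<longleftrightarrow>
    adj u v \<and> d x v = Suc (d x u) \<and> d y u = Suc (d y v)"
proof
  assume "\<exists>p. geodesic adj x y p \<and> traverses p (u, v)"
  then obtain p i where p: "successively adj p" "length p = Suc (d x y)" "hd p = x" "last p = y"
    and i: "Suc i < length p" "u = p ! i" "v = p ! Suc i"
    by (auto simp: geodesic_def traverses_def)
  have ends: "p ! 0 = x" "p ! d x y = y"
    using p by (auto simp: hd_conv_nth last_conv_nth simp flip: length_greater_0_conv)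
  have on: "d x (p ! k) = k \<and> d (p ! k) y = d x y - k" if "k \<le> d x y" for k
  proof -
    have "d x (p ! k) \<le> k" "d (p ! k) y \<le> d x y - k"
      using successively_gdist_le[OF p(1), of 0 k] successively_gdist_le[OF p(1), of k "d x y"]
        ends p(2) that by auto
    then show ?thesis
      using gdist_triangle[of x y "p ! k"] that by linarith
  qed
  have "adj u v"
    using p(1) i by (simp add: successively_conv_nth)
  moreover have "d x u = i" "d x v = Suc i" "d u y = d x y - i" "d v y = d x y - Suc i"
    using on[of i] on[of "Suc i"] i p(2) by auto
  ultimately show "adj u v \<and> d x v = Suc (d x u) \<and> d y u = Suc (d y v)"
    using i p(2) by (simp add: gdist_commute[of y])
next
  assume *: "adj u v \<and> d x v = Suc (d x u) \<and> d y u = Suc (d y v)"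
  obtain p1 where p1: "geodesic adj x u p1"
    using ex_geodesic by blast
  obtain p2 where p2: "geodesic adj v y p2"
    using ex_geodesic by blast
  have ne: "p1 \<noteq> []" "p2 \<noteq> []"
    using p1 p2 by (auto simp: geodesic_def)
  have "d x y = Suc (d x u + d v y)"
    using edge_between * by blast
  then have "geodesic adj x y (p1 @ p2)"
    using p1 p2 ne * by (auto simp: geodesic_def successively_append_iff)
  moreover have "p1 ! d x u = u" "length p1 = Suc (d x u)" "p2 ! 0 = v"
    using p1 p2 ne unfolding geodesic_def by (metis diff_Suc_1 last_conv_nth, simp, simp add: hd_conv_nth)
  then have "traverses (p1 @ p2) (u, v)"
    unfolding traverses_def using ne by (intro exI[of _ "d x u"]) (auto simp: nth_append)
  ultimately show "\<exists>p. geodesic adj x y p \<and> traverses p (u, v)"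
    by blast
qed

text \<open>The two distance functions increase in opposite directions along the geodesic and in the same
  direction along every other edge.\<close>

lemma chi_eq_grad: "chi adj x y = grad adj (\<lambda>v. (real (d x v) - real (d y v)) / 2)"
proof
  fix e :: "'v \<times> 'v"
  obtain u v where e: "e = (u, v)"
    by fastforce
  show "chi adj x y e = grad adj (\<lambda>v. (real (d x v) - real (d y v)) / 2) e"
  proof (cases "adj u v")
    case True
    then show ?thesis
      unfolding e chi_def grad_def prod.swap_def fst_conv snd_conv ex_geodesic_traverses_iff
      using gdist_adj_cases[OF True, of x] gdist_adj_cases[OF True, of y] adj_sym[of u v]
      by (auto simp: diff_divide_distrib add_divide_distrib)
  next
    case False
    then show ?thesis
      unfolding e chi_def grad_def prod.swap_def fst_conv snd_conv ex_geodesic_traverses_iff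
      using adj_sym[of u v] by auto
  qed
qed

lemma chi_add: "chi adj x z e = chi adj x y e + chi adj y z e"
  unfolding chi_eq_grad by (cases e) (simp add: grad_def diff_divide_distrib)

lemma chi_refl [simp]: "chi adj x x e = 0"
  unfolding chi_eq_grad by (cases e) (simp add: grad_def)

lemma chi_edge:
  assumes "adj x y" "adj u v"
  shows "chi adj x y (u, v) = (if u = x \<and> v = y then 1 else if u = y \<and> v = x then - 1 else 0)"
proof -
  have key: "d x v = Suc (d x u) \<and> d y u = Suc (d y v) \<longleftrightarrow> u = x \<and> v = y" if "adj u v" for u v
  proof
    assume "d x v = Suc (d x u) \<and> d y u = Suc (d y v)"
    then have "d x y = Suc (d x u + d v y)"
      using edge_between that by blast
    then show "u = x \<and> v = y"
      using gdist_adj[OF assms(1)] by auto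
  next
    assume "u = x \<and> v = y"
    then show "d x v = Suc (d x u) \<and> d y u = Suc (d y v)"
      using gdist_adj[OF assms(1)] gdist_commute[of x y] by auto
  qed
  have "adj v u"
    using assms(2) adj_sym by blast
  then show ?thesis
    unfolding chi_def prod.swap_def fst_conv snd_conv ex_geodesic_traverses_iff
    by (simp only: key[OF assms(2)] key[OF \<open>adj v u\<close>] assms(2) simp_thms conj_commute)
qed

end

lemma sq_sum_le: "(a + b)\<^sup>2 \<le> 2 * a\<^sup>2 + 2 * (b::real)\<^sup>2"
  using sum_squares_ge_zero[of "a - b" 0] by (simp add: power2_eq_square algebra_simps)

lemma summable_on_product_of_squares:
  fixes f g :: "'a \<Rightarrow> real"
  assumes "(\<lambda>x. (f x)\<^sup>2) summable_on A" "(\<lambda>x. (g x)\<^sup>2) summable_on A"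
  shows "(\<lambda>x. f x * g x) summable_on A"
proof -
  have "(\<lambda>x. (f x)\<^sup>2 + (g x)\<^sup>2) summable_on A"
    by (intro summable_on_add assms)
  moreover have "norm (f x * g x) \<le> (f x)\<^sup>2 + (g x)\<^sup>2" if "x \<in> A" for x
  proof -
    have "2 * (\<bar>f x\<bar> * \<bar>g x\<bar>) \<le> (f x)\<^sup>2 + (g x)\<^sup>2" "0 \<le> \<bar>f x\<bar> * \<bar>g x\<bar>"
      using sum_squares_bound[of "\<bar>f x\<bar>" "\<bar>g x\<bar>"] by auto
    then show ?thesis
      unfolding real_norm_def abs_mult by linarith
  qed
  ultimately have "(\<lambda>x. norm (f x * g x)) summable_on A"
    by (rule Infinite_Sum.abs_summable_on_comparison_test')
  then show ?thesis
    by (rule abs_summable_summable)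
qed

lemma summable_on_square_add:
  fixes f g :: "'a \<Rightarrow> real"
  assumes "(\<lambda>x. (f x)\<^sup>2) summable_on A" "(\<lambda>x. (g x)\<^sup>2) summable_on A"
  shows "(\<lambda>x. (f x + g x)\<^sup>2) summable_on A"
proof (rule summable_on_comparison_test)
  show "(\<lambda>x. 2 * (f x)\<^sup>2 + 2 * (g x)\<^sup>2) summable_on A"
    by (intro summable_on_add summable_on_cmult_right assms)
qed (auto simp: sq_sum_le)

lemma summable_on_square_cmult:
  fixes f :: "'a \<Rightarrow> real"
  assumes "(\<lambda>x. (f x)\<^sup>2) summable_on A"
  shows "(\<lambda>x. (c * f x)\<^sup>2) summable_on A"
  using summable_on_cmult_right[OF assms, of "c\<^sup>2"] by (simp add: power_mult_distrib)

context regular_tree_graph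
begin

abbreviation edges :: "('v \<times> 'v) set" where "edges \<equiv> {(x, y). adj x y}"

lemma edges_Sigma: "edges = Sigma UNIV (\<lambda>x. {y. adj x y})"
  by auto

lemma infsum_edges_swap: "infsum f edges = infsum (\<lambda>e. f (prod.swap e)) edges"
  by (rule infsum_reindex_bij_witness[of _ prod.swap prod.swap]) (auto simp: adj_sym)

lemma summable_edges_swap: "f summable_on edges \<longleftrightarrow> (\<lambda>e. f (prod.swap e)) summable_on edges"
  by (rule summable_on_reindex_bij_witness[of _ prod.swap prod.swap]) (auto simp: adj_sym)

lemma l2alt_swap: "\<xi> \<in> l2alt adj \<Longrightarrow> \<xi> (prod.swap e) = - \<xi> e"
  using adj_sym by (cases e) (auto simp: l2alt_def, metis add.inverse_neutral)

lemma l2alt_summable: "\<xi> \<in> l2alt adj \<Longrightarrow> (\<lambda>e. (\<xi> e)\<^sup>2) summable_on edges"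
  by (simp add: l2alt_def)

lemma l2alt_non_edge: "\<xi> \<in> l2alt adj \<Longrightarrow> e \<notin> edges \<Longrightarrow> \<xi> e = 0"
  by (cases e) (simp add: l2alt_def)

lemma l2alt_add: "\<xi> \<in> l2alt adj \<Longrightarrow> \<eta> \<in> l2alt adj \<Longrightarrow> (\<lambda>e. \<xi> e + \<eta> e) \<in> l2alt adj"
  by (simp add: l2alt_def summable_on_square_add)

lemma l2alt_scale: "\<xi> \<in> l2alt adj \<Longrightarrow> (\<lambda>e. c * \<xi> e) \<in> l2alt adj"
  by (simp add: l2alt_def summable_on_square_cmult)

lemma l2alt_zero: "(\<lambda>_. 0) \<in> l2alt adj"
  by (simp add: l2alt_def)

lemma l2alt_diff: "\<xi> \<in> l2alt adj \<Longrightarrow> \<eta> \<in> l2alt adj \<Longrightarrow> (\<lambda>e. \<xi> e - \<eta> e) \<in> l2alt adj"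
  using l2alt_add[OF _ l2alt_scale[of \<eta> "- 1"], of \<xi>] by simp

lemma l2alt_sum: "finite I \<Longrightarrow> (\<And>i. i \<in> I \<Longrightarrow> \<xi> i \<in> l2alt adj) \<Longrightarrow> (\<lambda>e. \<Sum>i\<in>I. a i * \<xi> i e) \<in> l2alt adj"
  by (induction I rule: finite_induct) (simp_all add: l2alt_zero l2alt_add l2alt_scale)

lemma alt_inner_summable:
  "\<xi> \<in> l2alt adj \<Longrightarrow> \<eta> \<in> l2alt adj \<Longrightarrow> (\<lambda>e. \<xi> e * \<eta> e) summable_on edges"
  by (intro summable_on_product_of_squares l2alt_summable)

lemma alt_inner_commute: "alt_inner adj \<xi> \<eta> = alt_inner adj \<eta> \<xi>"
  by (simp add: alt_inner_def mult.commute)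

lemma alt_inner_add_right:
  assumes "\<xi> \<in> l2alt adj" "\<eta> \<in> l2alt adj" "\<zeta> \<in> l2alt adj"
  shows "alt_inner adj \<xi> (\<lambda>e. \<eta> e + \<zeta> e) = alt_inner adj \<xi> \<eta> + alt_inner adj \<xi> \<zeta>"
  using infsum_add[OF alt_inner_summable[OF assms(1,2)] alt_inner_summable[OF assms(1,3)]]
  by (simp add: alt_inner_def distrib_left)

lemma alt_inner_scale_right: "alt_inner adj \<xi> (\<lambda>e. c * \<eta> e) = c * alt_inner adj \<xi> \<eta>"
  unfolding alt_inner_def by (simp add: infsum_cmult_right' mult.left_commute[of _ c])

lemma alt_inner_diff_right:
  assumes "\<xi> \<in> l2alt adj" "\<eta> \<in> l2alt adj" "\<zeta> \<in> l2alt adj"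
  shows "alt_inner adj \<xi> (\<lambda>e. \<eta> e - \<zeta> e) = alt_inner adj \<xi> \<eta> - alt_inner adj \<xi> \<zeta>"
  using alt_inner_add_right[OF assms(1,2) l2alt_scale[OF assms(3), of "- 1"]]
    alt_inner_scale_right[of \<xi> "- 1" \<zeta>] by simp

lemma alt_inner_sum_right:
  assumes "finite I" "\<xi> \<in> l2alt adj" "\<And>i. i \<in> I \<Longrightarrow> \<eta> i \<in> l2alt adj"
  shows "alt_inner adj \<xi> (\<lambda>e. \<Sum>i\<in>I. a i * \<eta> i e) = (\<Sum>i\<in>I. a i * alt_inner adj \<xi> (\<eta> i))"
  using assms(1,3)
proof (induction I rule: finite_induct)
  case empty
  then show ?case
    by (simp add: alt_inner_def)
next
  case (insert i I)
  then show ?case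
    using alt_inner_add_right[OF assms(2) l2alt_scale[of "\<eta> i" "a i"] l2alt_sum[of I \<eta> a]]
    by (simp add: alt_inner_scale_right)
qed

lemma alt_inner_self_nonneg: "alt_inner adj \<xi> \<xi> \<ge> 0"
  by (simp add: alt_inner_def infsum_nonneg)

lemma alt_inner_self_eq_0:
  assumes "\<xi> \<in> l2alt adj" "alt_inner adj \<xi> \<xi> = 0"
  shows "\<xi> e = 0"
proof (cases "e \<in> edges")
  case True
  have "\<xi> e * \<xi> e = 0"
    using nonneg_infsum_le_0D[of "\<lambda>e. \<xi> e * \<xi> e" edges e] assms alt_inner_summable[OF assms(1,1)] True
    by (simp add: alt_inner_def)
  then show ?thesis
    by simp
qed (use assms l2alt_non_edge in blast)

lemma l2V_sum_edges: assumes "h \<in> l2V adj" shows "(\<lambda>(x, y). (h x)\<^sup>2) summable_on edges"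
  unfolding edges_Sigma
proof (rule summable_on_SigmaI)
  show "((\<lambda>y. case (x, y) of (x, y) \<Rightarrow> (h x)\<^sup>2) has_sum ((h x)\<^sup>2 * real (deg adj x))) {y. adj x y}" for x
    by (rule has_sum_finiteI) (simp_all add: mult.commute)
qed (use assms in \<open>auto simp: l2V_def\<close>)

lemma l2V_sum_edges': assumes "h \<in> l2V adj" shows "(\<lambda>(x, y). (h y)\<^sup>2) summable_on edges"
  using l2V_sum_edges[OF assms] by (subst summable_edges_swap) (simp add: case_prod_unfold)

lemma grad_l2alt: assumes "h \<in> l2V adj" shows "grad adj h \<in> l2alt adj"
proof -
  have "(\<lambda>e. (h (snd e) + (- 1) * h (fst e))\<^sup>2) summable_on edges"
    using l2V_sum_edges[OF assms] l2V_sum_edges'[OF assms]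
    by (intro summable_on_square_add summable_on_square_cmult) (simp_all add: case_prod_unfold)
  also have "?this \<longleftrightarrow> (\<lambda>e. (grad adj h e)\<^sup>2) summable_on edges"
    by (intro summable_on_cong) (auto simp: grad_def)
  finally show ?thesis
    using adj_sym by (auto simp: l2alt_def grad_def)
qed

lemma l2V_lin: assumes "f \<in> l2V adj" "g \<in> l2V adj" shows "(\<lambda>v. a * f v + b * g v) \<in> l2V adj"
proof -
  have *: "h \<in> l2V adj \<longleftrightarrow> (\<lambda>v. (h v)\<^sup>2) summable_on UNIV" for h
    unfolding l2V_def using summable_on_cmult_left'[of "real q + 1" "\<lambda>v. (h v)\<^sup>2" UNIV]
    by (simp add: add.commute)
  show ?thesis
    using assms unfolding * by (intro summable_on_square_add summable_on_square_cmult)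
qed

text \<open>Summation by parts. The sum over the sources of edges vanishes since \<open>\<xi>\<close> has no divergence, and the
  sum over the ranges differs from it by the reversal of edges. Both converge absolutely.\<close>

lemma alt_inner_grad:
  assumes \<xi>: "\<xi> \<in> ker_grad_adj adj" and h: "h \<in> l2V adj"
  shows "alt_inner adj \<xi> (grad adj h) = 0"
proof -
  have l2: "\<xi> \<in> l2alt adj" and ker: "\<And>x. grad_adj adj \<xi> x = 0"
    using \<xi> by (auto simp: ker_grad_adj_def)
  let ?A = "\<lambda>e. \<xi> e * h (fst e)" and ?B = "\<lambda>e. \<xi> e * h (snd e)"
  have A: "?A summable_on edges"
    using l2V_sum_edges[OF h] by (intro summable_on_product_of_squares[OF l2alt_summable[OF l2]]) (simp add: case_prod_unfold)
  have B: "?B summable_on edges"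
    using l2V_sum_edges'[OF h] by (intro summable_on_product_of_squares[OF l2alt_summable[OF l2]]) (simp add: case_prod_unfold)
  have "infsum ?A edges = (\<Sum>\<^sub>\<infinity>x. \<Sum>\<^sub>\<infinity>y\<in>{y. adj x y}. ?A (x, y))"
    using A unfolding edges_Sigma by (rule infsum_Sigma_banach[symmetric])
  also have "\<dots> = (\<Sum>\<^sub>\<infinity>x::'v. 0)"
  proof (rule infsum_cong)
    fix x
    have "(\<Sum>\<^sub>\<infinity>y\<in>{y. adj x y}. ?A (x, y)) = (\<Sum>y | adj x y. - \<xi> (y, x) * h x)"
      using l2alt_swap[OF l2, of "(_, x)"] by simp
    also have "\<dots> = - (\<Sum>y | adj x y. \<xi> (y, x)) * h x"
      by (simp add: sum_distrib_right sum_negf)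
    also have "(\<Sum>y | adj x y. \<xi> (y, x)) = 0"
      using ker[of x] by (simp add: grad_adj_def)
    finally show "(\<Sum>\<^sub>\<infinity>y\<in>{y. adj x y}. ?A (x, y)) = 0"
      by simp
  qed
  finally have A0: "infsum ?A edges = 0"
    by simp
  have "infsum ?B edges = infsum (\<lambda>e. - ?A e) edges"
    by (subst infsum_edges_swap) (simp add: l2alt_swap[OF l2])
  then have B0: "infsum ?B edges = 0"
    using A0 by (simp add: infsum_uminus)
  have "infsum (\<lambda>e. \<xi> e * grad adj h e) edges = infsum (\<lambda>e. ?B e - ?A e) edges"
    by (intro infsum_cong) (auto simp: grad_def algebra_simps)
  also have "\<dots> = infsum ?B edges - infsum ?A edges"
    using infsum_add[OF B summable_on_uminus[THEN iffD2, OF A]] by (simp add: infsum_uminus)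
  finally show ?thesis
    using A0 B0 by (simp add: alt_inner_def)
qed

lemma finite_ball: "finite {v. d x v \<le> n}"
proof -
  have "{v. d x v \<le> n} = (\<Union>k\<le>n. {v. d x v = k})"
    by auto
  then show ?thesis
    using finite_sphere by simp
qed

lemma finite_support_chi: "finite {e. chi adj x y e \<noteq> 0}"
proof (rule finite_subset)
  show "{e. chi adj x y e \<noteq> 0} \<subseteq> (\<Union>u\<in>{u. d x u \<le> Suc (d x y)}. {u} \<times> {v. adj u v})"
  proof
    fix e assume e: "e \<in> {e. chi adj x y e \<noteq> 0}"
    obtain u v where uv: "e = (u, v)"
      by fastforce
    have chi: "chi adj x y (u, v) \<noteq> 0"
      using e uv by simp
    have "adj u v \<and> d x u \<le> Suc (d x y)"
    proof (cases "adj u v \<and> d x v = Suc (d x u) \<and> d y u = Suc (d y v)")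
      case True
      then show ?thesis
        using edge_between[of u v x y] by auto
    next
      case False
      then have vu: "adj v u \<and> d x u = Suc (d x v) \<and> d y v = Suc (d y u)"
        using chi unfolding chi_def prod.swap_def fst_conv snd_conv ex_geodesic_traverses_iff
        by presburger
      then show ?thesis
        using edge_between[of v u x y] adj_sym[of u v] by auto
    qed
    then show "e \<in> (\<Union>u\<in>{u. d x u \<le> Suc (d x y)}. {u} \<times> {v. adj u v})"
      using uv by auto
  qed
qed (use finite_ball in auto)

lemma chi_l2alt: "chi adj x y \<in> l2alt adj"
proof -
  have "(\<lambda>e. (chi adj x y e)\<^sup>2) summable_on edges"
    by (rule finite_nonzero_values_imp_summable_on)
       (rule finite_subset[OF _ finite_support_chi[of x y]], auto)
  then show ?thesis
    using adj_sym by (auto simp: l2alt_def chi_eq_grad grad_def diff_divide_distrib)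
qed

lemma power_gdist_l2V: "(\<lambda>v. (1 / real q) ^ d x v) \<in> l2V adj"
proof -
  let ?f = "\<lambda>v. ((1 / real q) ^ d x v)\<^sup>2"
  have q: "real q > 0" "1 / real q < 1"
    using q_ge_2 by auto
  have "(\<lambda>p. ?f (snd p)) summable_on Sigma UNIV (\<lambda>n. {v. d x v = n})"
  proof (rule summable_on_SigmaI)
    show "((\<lambda>v. ?f (snd (n, v))) has_sum (real (card {v. d x v = n}) * ((1 / real q) ^ n)\<^sup>2)) {v. d x v = n}" for n
      by (rule has_sum_finiteI) (simp_all add: finite_sphere)
    show "(\<lambda>n. real (card {v. d x v = n}) * ((1 / real q) ^ n)\<^sup>2) summable_on UNIV"
    proof (rule summable_on_comparison_test)
      show "(\<lambda>n. 2 * (1 / real q) ^ n) summable_on UNIV"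
        using q by (intro summable_on_cmult_right) (auto simp: summable_on_UNIV_nonneg_real_iff)
      fix n
      have "real (card {v. d x v = n}) * ((1 / real q) ^ n)\<^sup>2 \<le> real (2 * q ^ n) * ((1 / real q) ^ n)\<^sup>2"
        using card_sphere[of x n] by (intro mult_right_mono) (auto simp del: of_nat_mult of_nat_power)
      also have "\<dots> = 2 * (1 / real q) ^ n"
        using q by (simp add: power2_eq_square power_divide field_simps)
      finally show "real (card {v. d x v = n}) * ((1 / real q) ^ n)\<^sup>2 \<le> 2 * (1 / real q) ^ n" .
    qed auto
  qed auto
  also have "?this \<longleftrightarrow> ?f summable_on UNIV"
    by (rule summable_on_reindex_bij_witness[of _ "\<lambda>v. (d x v, v)" snd]) auto
  finally show ?thesis
    unfolding l2V_def by (simp add: summable_on_cmult_left)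
qed

text \<open>The potentials of the two components of \<open>chi adj x y\<close>: the first one is square summable,
  the second one is harmonic.\<close>

definition l2_potential :: "'v \<Rightarrow> 'v \<Rightarrow> 'v \<Rightarrow> real" where
  "l2_potential x y v = real q / ((real q)\<^sup>2 - 1) * ((1 / real q) ^ d y v - (1 / real q) ^ d x v)"

definition harmonic_potential :: "'v \<Rightarrow> 'v \<Rightarrow> 'v \<Rightarrow> real" where
  "harmonic_potential x y v = (harmonic_profile (d x v) - harmonic_profile (d y v)) / 2"

definition chi_harmonic :: "'v \<Rightarrow> 'v \<Rightarrow> 'v \<times> 'v \<Rightarrow> real" where
  "chi_harmonic x y = grad adj (harmonic_potential x y)"

lemma l2_potential_l2V: "l2_potential x y \<in> l2V adj"
  using l2V_lin[OF power_gdist_l2V[of y] power_gdist_l2V[of x], of "real q / ((real q)\<^sup>2 - 1)" "- (real q / ((real q)\<^sup>2 - 1))"]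
  by (simp add: l2_potential_def[abs_def] right_diff_distrib)

text \<open>The potentials on both sides agree pointwise, by the definition of \<open>harmonic_profile\<close>.\<close>

lemma chi_decomposition: "chi adj x y e = chi_harmonic x y e + grad adj (l2_potential x y) e"
proof -
  define c where "c = real q / ((real q)\<^sup>2 - 1)"
  have profile: "harmonic_profile n = real n - 2 * c + 2 * c * (1 / real q) ^ n" for n
    by (simp add: harmonic_profile_def c_def)
  have "(real a - real b) / 2 = (harmonic_profile a - harmonic_profile b) / 2
      + c * ((1 / real q) ^ b - (1 / real q) ^ a)" (is "?l a b = ?r a b") for a b
    by (simp add: profile algebra_simps diff_divide_distrib add_divide_distrib)
  then have "(\<lambda>v. (real (d x v) - real (d y v)) / 2) = (\<lambda>v. harmonic_potential x y v + l2_potential x y v)"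
    unfolding harmonic_potential_def l2_potential_def c_def[symmetric] by (intro ext)
  then show ?thesis
    unfolding chi_harmonic_def chi_eq_grad by (cases e) (simp add: grad_def)
qed

lemma chi_harmonic_l2alt: "chi_harmonic x y \<in> l2alt adj"
  using l2alt_diff[OF chi_l2alt grad_l2alt[OF l2_potential_l2V], of x y x y]
  by (simp add: chi_decomposition)

lemma chi_harmonic_ker: "chi_harmonic x y \<in> ker_grad_adj adj"
proof -
  have "grad_adj adj (chi_harmonic x y) v = 0" for v
  proof -
    have "(\<Sum>w | adj v w. chi_harmonic x y (w, v)) =
      (\<Sum>w | adj v w. harmonic_potential x y v - harmonic_potential x y w)"
      by (intro sum.cong) (auto simp: chi_harmonic_def grad_def adj_sym)
    also have "\<dots> = (real q + 1) * (harmonic_potential x y v - avg (harmonic_potential x y) v)"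
      using q_ge_2 by (simp add: sum_subtractf avg_def right_diff_distrib)
    also have "avg (harmonic_potential x y) v =
      (avg (\<lambda>w. harmonic_profile (d x w)) v - avg (\<lambda>w. harmonic_profile (d y w)) v) / 2"
      by (simp add: avg_def harmonic_potential_def sum_subtractf diff_divide_distrib
          sum_divide_distrib[symmetric] mult.commute)
    also have "\<dots> = harmonic_potential x y v"
      by (simp add: avg_radial radial_avg_harmonic_profile harmonic_potential_def)
    finally show ?thesis
      by (simp add: grad_adj_def)
  qed
  then show ?thesis
    using chi_harmonic_l2alt by (simp add: ker_grad_adj_def)
qed

text \<open>\<open>chi_harmonic x y\<close> is orthogonal to all gradients of square summable functions. Two candidates for
  the projection differ by such a gradient that is orthogonal to itself.\<close>

lemma Q_proj_chi: "Q_proj adj (chi adj x y) = grad adj (l2_potential x y)"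
  unfolding Q_proj_def
proof (rule the_equality)
  have diff: "(\<lambda>e. chi adj x y e - grad adj (l2_potential x y) e) = chi_harmonic x y"
    by (simp add: chi_decomposition)
  show "grad adj (l2_potential x y) \<in> grad adj ` l2V adj \<and>
    (\<forall>\<zeta>\<in>grad adj ` l2V adj. alt_inner adj (\<lambda>e. chi adj x y e - grad adj (l2_potential x y) e) \<zeta> = 0)"
    unfolding diff using l2_potential_l2V alt_inner_grad[OF chi_harmonic_ker] by auto
  fix \<eta> assume \<eta>: "\<eta> \<in> grad adj ` l2V adj \<and>
    (\<forall>\<zeta>\<in>grad adj ` l2V adj. alt_inner adj (\<lambda>e. chi adj x y e - \<eta> e) \<zeta> = 0)"
  then obtain f where f: "f \<in> l2V adj" "\<eta> = grad adj f"
    by blast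
  define g where "g = (\<lambda>v. 1 * l2_potential x y v + (- 1) * f v)"
  have g: "g \<in> l2V adj"
    unfolding g_def by (intro l2V_lin l2_potential_l2V f)
  have grad_g: "grad adj g = (\<lambda>e. grad adj (l2_potential x y) e - \<eta> e)"
    by (auto simp: g_def f grad_def)
  have l2: "grad adj g \<in> l2alt adj" "\<eta> \<in> l2alt adj"
    using g f grad_l2alt by auto
  have "alt_inner adj (grad adj g) (\<lambda>e. (\<lambda>e. chi adj x y e - \<eta> e) e - chi_harmonic x y e) = 0"
  proof (subst alt_inner_diff_right)
    show "alt_inner adj (grad adj g) (\<lambda>e. chi adj x y e - \<eta> e) - alt_inner adj (grad adj g) (chi_harmonic x y) = 0"
      using \<eta> g alt_inner_grad[OF chi_harmonic_ker g] by (simp add: alt_inner_commute[of "grad adj g"])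
  qed (intro l2 l2alt_diff chi_l2alt chi_harmonic_l2alt)+
  also have "(\<lambda>e. (\<lambda>e. chi adj x y e - \<eta> e) e - chi_harmonic x y e) = grad adj g"
    by (auto simp: grad_g chi_decomposition)
  finally have "grad adj g e = 0" for e
    by (rule alt_inner_self_eq_0[OF l2(1)])
  then show "\<eta> = grad adj (l2_potential x y)"
    unfolding grad_g by (auto simp: fun_eq_iff)
qed

lemma b_tilde_eq: "b_tilde adj x\<^sub>0 g = chi_harmonic x\<^sub>0 (g x\<^sub>0)"
  by (simp add: b_tilde_def Q_proj_chi chi_decomposition)

lemma alt_inner_chi_edge:
  assumes \<xi>: "\<xi> \<in> l2alt adj" and xy: "adj x y"
  shows "alt_inner adj \<xi> (chi adj x y) = \<xi> (x, y)"
proof -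
  have ne: "x \<noteq> y" "adj y x"
    using xy adj_sym[of x y] by auto
  have "((\<lambda>e. \<xi> e * chi adj x y e) has_sum (2 * \<xi> (x, y))) edges"
  proof (rule has_sum_finite_neutralI[of "{(x, y), (y, x)}"])
    show "{(x, y), (y, x)} \<subseteq> edges"
      using xy ne by auto
    show "\<xi> e * chi adj x y e = 0" if "e \<in> edges - {(x, y), (y, x)}" for e
    proof -
      obtain u v where uv: "e = (u, v)"
        by fastforce
      have "adj u v" "\<not> (u = x \<and> v = y)" "\<not> (u = y \<and> v = x)"
        using that unfolding uv by blast+
      then show ?thesis
        unfolding uv by (simp only: chi_edge[OF xy] if_False mult_zero_right)
    qed
    show "2 * \<xi> (x, y) = (\<Sum>e\<in>{(x, y), (y, x)}. \<xi> e * chi adj x y e)"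
      using ne l2alt_swap[OF \<xi>, of "(x, y)"] chi_edge[OF xy xy] chi_edge[OF xy ne(2)] by simp
  qed simp
  then show ?thesis
    by (simp add: alt_inner_def infsumI)
qed

text \<open>The circulation of a gradient along a geodesic.\<close>

lemma alt_inner_chi:
  assumes \<xi>: "\<xi> \<in> l2alt adj" and T: "\<And>u v. adj u v \<Longrightarrow> \<xi> (u, v) = T v - T u"
  shows "alt_inner adj \<xi> (chi adj x y) = T y - T x"
proof (induction "d x y" arbitrary: y)
  case 0
  then have "chi adj x y = (\<lambda>_. 0)"
    by auto
  then show ?case
    using 0 by (simp add: alt_inner_def)
next
  case (Suc n)
  obtain z where z: "d x z = n" "adj z y"
    using gdist_Suc_parent[OF Suc.hyps(2)[symmetric]] by blast
  have "chi adj x y = (\<lambda>e. chi adj x z e + chi adj z y e)"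
    using chi_add by blast
  then show ?case
    using alt_inner_add_right[OF \<xi> chi_l2alt chi_l2alt] alt_inner_chi_edge[OF \<xi> z(2)] T[OF z(2)]
      Suc.hyps(1)[of z] z(1) by simp
qed

text \<open>The chain minus its harmonic component is the gradient of a square summable function, so it is
  orthogonal to this component. Therefore the square norm of the latter is its inner product with the
  chain, which is given by the circulation of its potential.\<close>

lemma chain_energy:
  fixes a :: "'i \<Rightarrow> real" and s t :: "'i \<Rightarrow> 'v"
  assumes "finite I"
  defines "\<xi> \<equiv> \<lambda>e. \<Sum>i\<in>I. a i * chi_harmonic (s i) (t i) e"
    and "c \<equiv> \<lambda>e. \<Sum>i\<in>I. a i * chi adj (s i) (t i) e"
  shows "alt_inner adj \<xi> \<xi> = (\<Sum>i\<in>I. \<Sum>j\<in>I. a i * a j *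
      (harmonic_potential (s j) (t j) (t i) - harmonic_potential (s j) (t j) (s i)))" (is ?energy)
    and "alt_inner adj \<xi> \<xi> \<le> alt_inner adj c c" (is ?bound)
proof -
  define f where "f = (\<lambda>v. \<Sum>i\<in>I. a i * l2_potential (s i) (t i) v)"
  define T where "T = (\<lambda>v. \<Sum>i\<in>I. a i * harmonic_potential (s i) (t i) v)"
  have f: "f \<in> l2V adj"
    unfolding f_def using assms(1)
  proof (induction I rule: finite_induct)
    case empty
    then show ?case
      by (simp add: l2V_def)
  next
    case (insert i I)
    then show ?case
      using l2V_lin[OF l2_potential_l2V[of "s i" "t i"] insert.IH, of "a i" 1] by simp
  qed
  have l2: "\<xi> \<in> l2alt adj" "c \<in> l2alt adj"
    unfolding \<xi>_def c_def using assms(1) by (auto intro!: l2alt_sum chi_l2alt chi_harmonic_l2alt)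
  have grad_f: "grad adj f e = (\<Sum>i\<in>I. a i * grad adj (l2_potential (s i) (t i)) e)" for e
    by (cases e) (auto simp: f_def grad_def right_diff_distrib sum_subtractf)
  have c: "c = (\<lambda>e. \<xi> e + grad adj f e)"
    unfolding \<xi>_def c_def grad_f by (auto simp: chi_decomposition sum.distrib[symmetric] distrib_left)
  have grad_T: "\<xi> (u, v) = T v - T u" if "adj u v" for u v
    using that by (simp add: \<xi>_def T_def chi_harmonic_def grad_def right_diff_distrib sum_subtractf)
  have ker: "\<xi> \<in> ker_grad_adj adj"
  proof -
    have "grad_adj adj \<xi> v = (\<Sum>i\<in>I. a i * grad_adj adj (chi_harmonic (s i) (t i)) v)" for v
      unfolding \<xi>_def grad_adj_def by (subst sum.swap) (simp add: sum_distrib_left mult_ac)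
    then show ?thesis
      using l2(1) chi_harmonic_ker by (simp add: ker_grad_adj_def)
  qed
  have orth: "alt_inner adj \<xi> (grad adj f) = 0"
    by (rule alt_inner_grad[OF ker f])
  have \<xi>c: "alt_inner adj \<xi> c = alt_inner adj \<xi> \<xi>"
    unfolding c using alt_inner_add_right[OF l2(1,1) grad_l2alt[OF f]] orth by simp
  have "alt_inner adj \<xi> c = (\<Sum>i\<in>I. a i * (T (t i) - T (s i)))"
    unfolding c_def
    using alt_inner_sum_right[OF assms(1) l2(1), of "\<lambda>i. chi adj (s i) (t i)" a]
      alt_inner_chi[OF l2(1) grad_T] chi_l2alt by simp
  with \<xi>c show ?energy
    by (simp add: T_def sum_subtractf[symmetric] sum_distrib_left right_diff_distrib mult_ac)
  have "alt_inner adj c c = alt_inner adj c \<xi> + alt_inner adj c (grad adj f)"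
    using alt_inner_add_right[OF l2(2,1) grad_l2alt[OF f]] c by simp
  also have "alt_inner adj c \<xi> = alt_inner adj \<xi> \<xi>"
    using \<xi>c by (simp only: alt_inner_commute[of c])
  also have "alt_inner adj c (grad adj f) = alt_inner adj (grad adj f) (grad adj f)"
    using alt_inner_add_right[OF grad_l2alt[OF f] l2(1) grad_l2alt[OF f]] orth c
    by (simp add: alt_inner_commute)
  finally show ?bound
    using alt_inner_self_nonneg[of "grad adj f"] by simp
qed

text \<open>The chain of segments from a base point to the points \<open>x i\<close>, with the weights \<open>\<alpha> i\<close>, has nonnegative
  energy. The terms that involve the base point cancel because the weights sum to zero.\<close>

lemma radial_neg_type_harmonic_profile: "radial_neg_type harmonic_profile"
  unfolding radial_neg_type_def cond_neg_type_kernel_def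
proof (intro conjI ballI allI impI)
  fix n :: nat and x :: "nat \<Rightarrow> 'v" and \<alpha> :: "nat \<Rightarrow> real"
  assume "(\<forall>i<n. x i \<in> UNIV) \<and> (\<Sum>i<n. \<alpha> i) = 0"
  then have \<alpha>: "(\<Sum>i<n. \<alpha> i) = 0"
    by simp
  fix x\<^sub>0 :: 'v
  let ?h = "\<lambda>x y. harmonic_profile (d x y)"
  have "0 \<le> (\<Sum>i<n. \<Sum>j<n. \<alpha> i * \<alpha> j * (harmonic_potential x\<^sub>0 (x j) (x i) - harmonic_potential x\<^sub>0 (x j) x\<^sub>0))"
    using alt_inner_self_nonneg[of "\<lambda>e. \<Sum>i<n. \<alpha> i * chi_harmonic x\<^sub>0 (x i) e"]
      chain_energy(1)[of "{..<n}" \<alpha> "\<lambda>_. x\<^sub>0" x] by simp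
  also have "\<dots> = (\<Sum>i<n. \<Sum>j<n. \<alpha> j * (\<alpha> i * ?h x\<^sub>0 (x i) / 2) + \<alpha> i * (\<alpha> j * ?h (x j) x\<^sub>0 / 2)
      - \<alpha> i * \<alpha> j * ?h (x i) (x j) / 2)"
    by (intro sum.cong refl) (simp add: harmonic_potential_def field_simps gdist_commute)
  also have "\<dots> = (\<Sum>i<n. (\<Sum>j<n. \<alpha> j) * (\<alpha> i * ?h x\<^sub>0 (x i) / 2))
      + (\<Sum>i<n. \<alpha> i) * (\<Sum>j<n. \<alpha> j * ?h (x j) x\<^sub>0 / 2) - (\<Sum>i<n. \<Sum>j<n. \<alpha> i * \<alpha> j * ?h (x i) (x j)) / 2"
    unfolding sum.distrib sum_subtractf sum_distrib_right[symmetric] sum_distrib_left[symmetric]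
      sum_divide_distrib[symmetric] ..
  finally show "(\<Sum>i<n. \<Sum>j<n. \<alpha> i * \<alpha> j * ?h (x i) (x j)) \<le> 0"
    using \<alpha> by simp
qed (auto simp: gdist_commute)

text \<open>On an oriented edge the chain has at most two contributions, from the edge itself and from its
  reverse; this is where the factor 2 comes from.\<close>

lemma edge_chain_bound:
  assumes A: "finite A" "A \<subseteq> edges"
  shows "(\<Sum>e\<in>A. \<Sum>e'\<in>A. a e * a e' * (harmonic_potential (fst e') (snd e') (snd e)
    - harmonic_potential (fst e') (snd e') (fst e))) \<le> 2 * (\<Sum>e\<in>A. (a e)\<^sup>2)"
proof -
  define c where "c = (\<lambda>e. \<Sum>e'\<in>A. a e' * chi adj (fst e') (snd e') e)"
  define \<alpha> where "\<alpha> = (\<lambda>e. if e \<in> A then a e else 0)"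
  define B where "B = A \<union> prod.swap ` A"
  have B: "finite B" "B \<subseteq> edges" "A \<subseteq> B"
    using A adj_sym by (auto simp: B_def)
  have c: "c e = \<alpha> e - \<alpha> (prod.swap e)" if "e \<in> edges" for e
  proof -
    have "c e = (\<Sum>e'\<in>A. (if e' = e then a e' else 0) - (if e' = prod.swap e then a e' else 0))"
      unfolding c_def
    proof (rule sum.cong[OF refl])
      fix e' assume e': "e' \<in> A"
      obtain x y u v where xyuv: "e' = (x, y)" "e = (u, v)"
        by fastforce
      have "adj x y" "adj u v"
        using e' A that xyuv by auto
      note edge = chi_edge[OF this] adj_neq[OF this(1)]
      show "a e' * chi adj (fst e') (snd e') e =
          (if e' = e then a e' else 0) - (if e' = prod.swap e then a e' else 0)"
        unfolding xyuv fst_conv snd_conv swap_simp edge(1) prod.inject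
        by (cases "u = x"; cases "v = y"; cases "u = y"; cases "v = x"; simp add: edge(2) edge(2)[symmetric])
    qed
    also have "\<dots> = \<alpha> e - \<alpha> (prod.swap e)"
      using A(1) by (simp add: sum_subtractf \<alpha>_def sum.delta')
    finally show ?thesis .
  qed
  have "((\<lambda>e. c e * c e) has_sum (\<Sum>e\<in>B. c e * c e)) edges"
  proof (rule has_sum_finite_neutralI[OF B(1,2)])
    fix e assume e: "e \<in> edges - B"
    then have "e \<notin> A" "prod.swap e \<notin> A"
      by (auto simp: B_def image_iff)
    then show "c e * c e = 0"
      using c[of e] e by (simp add: \<alpha>_def)
  qed simp
  then have "alt_inner adj c c = 1 / 2 * (\<Sum>e\<in>B. (c e)\<^sup>2)"
    by (simp add: alt_inner_def infsumI power2_eq_square)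
  also have "\<dots> \<le> 1 / 2 * (\<Sum>e\<in>B. 2 * (\<alpha> e)\<^sup>2 + 2 * (\<alpha> (prod.swap e))\<^sup>2)"
  proof (intro mult_left_mono sum_mono)
    fix e assume "e \<in> B"
    then have "c e = \<alpha> e + (- \<alpha> (prod.swap e))"
      using c B by auto
    then show "(c e)\<^sup>2 \<le> 2 * (\<alpha> e)\<^sup>2 + 2 * (\<alpha> (prod.swap e))\<^sup>2"
      using sq_sum_le[of "\<alpha> e" "- \<alpha> (prod.swap e)"] by simp
  qed simp
  also have "\<dots> = (\<Sum>e\<in>B. (\<alpha> e)\<^sup>2) + (\<Sum>e\<in>B. (\<alpha> (prod.swap e))\<^sup>2)"
    by (simp add: sum.distrib sum_distrib_left[symmetric])
  also have "(\<Sum>e\<in>B. (\<alpha> (prod.swap e))\<^sup>2) = (\<Sum>e\<in>B. (\<alpha> e)\<^sup>2)"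
    by (rule sum.reindex_bij_witness[of _ prod.swap prod.swap]) (auto simp: B_def)
  also have "(\<Sum>e\<in>B. (\<alpha> e)\<^sup>2) = (\<Sum>e\<in>A. (a e)\<^sup>2)"
    using B by (intro sum.mono_neutral_cong_right) (auto simp: \<alpha>_def)
  finally show ?thesis
    using chain_energy[OF A(1), of a fst snd] unfolding c_def by simp
qed

end

section \<open>Pure functions of negative type\<close>

lemma cond_neg_type_kernel_pullback:
  assumes "cond_neg_type_kernel W \<Psi>" "\<And>x. x \<in> W' \<Longrightarrow> f x \<in> W"
    "\<And>x y. x \<in> W' \<Longrightarrow> y \<in> W' \<Longrightarrow> \<Phi> x y = \<Psi> (f x) (f y)"
  shows "cond_neg_type_kernel W' \<Phi>"
  unfolding cond_neg_type_kernel_def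
proof (intro conjI ballI allI impI)
  fix n :: nat and x \<alpha> assume *: "(\<forall>i<n. x i \<in> W') \<and> (\<Sum>i<n. \<alpha> i) = (0::real)"
  then have "(\<Sum>i<n. \<Sum>j<n. \<alpha> i * \<alpha> j * \<Phi> (x i) (x j)) = (\<Sum>i<n. \<Sum>j<n. \<alpha> i * \<alpha> j * \<Psi> (f (x i)) (f (x j)))"
    using assms(3) by (intro sum.cong) auto
  also have "\<dots> \<le> 0"
    using assms(1,2) * unfolding cond_neg_type_kernel_def by (auto elim!: allE[of _ "\<lambda>i. f (x i)"])
  finally show "(\<Sum>i<n. \<Sum>j<n. \<alpha> i * \<alpha> j * \<Phi> (x i) (x j)) \<le> 0" .
qed (use assms in \<open>auto simp: cond_neg_type_kernel_def\<close>)

text \<open>The points \<open>y\<close> and \<open>z\<close> have the same image in the Hilbert space. Concretely, the kernel is tested on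
  \<open>x, y, z\<close> with the weights \<open>1, t, - 1 - t\<close> for all \<open>t\<close>.\<close>

lemma cond_neg_type_kernel_zero_imp_eq:
  assumes \<Psi>: "cond_neg_type_kernel W \<Psi>" and W: "x \<in> W" "y \<in> W" "z \<in> W" and yz: "\<Psi> y z = 0"
  shows "\<Psi> x y = \<Psi> x z"
proof -
  have diag: "\<Psi> v v = 0" "\<Psi> v w = \<Psi> w v" if "v \<in> W" "w \<in> W" for v w
    using \<Psi> that by (auto simp: cond_neg_type_kernel_def)
  have le: "t * (\<Psi> x y - \<Psi> x z) \<le> \<Psi> x z" for t
  proof -
    define p \<alpha> where "p = (\<lambda>i::nat. [x, y, z] ! i)" and "\<alpha> = (\<lambda>i::nat. [1, t, - 1 - t] ! i)"
    have "\<forall>i<3. p i \<in> W"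
      using W by (auto simp: p_def less_Suc_eq numeral_3_eq_3)
    moreover have "(\<Sum>i<3. \<alpha> i) = 0"
      by (simp add: \<alpha>_def numeral_3_eq_3)
    ultimately have "(\<Sum>i<3. \<Sum>j<3. \<alpha> i * \<alpha> j * \<Psi> (p i) (p j)) \<le> 0"
      using \<Psi> unfolding cond_neg_type_kernel_def by blast
    then show ?thesis
      using diag[of x x] diag[of y y] diag[of z z] diag(2)[of y x] diag(2)[of z x] diag(2)[of z y] W yz
      by (simp add: p_def \<alpha>_def numeral_3_eq_3 algebra_simps)
  qed
  show ?thesis
  proof (rule ccontr)
    assume ne: "\<Psi> x y \<noteq> \<Psi> x z"
    then have "(\<Psi> x z + 1) / (\<Psi> x y - \<Psi> x z) * (\<Psi> x y - \<Psi> x z) = \<Psi> x z + 1"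
      by simp
    then show False
      using le[of "(\<Psi> x z + 1) / (\<Psi> x y - \<Psi> x z)"] by simp
  qed
qed

context tree_action
begin

abbreviation GG :: "('v \<Rightarrow> 'v) monoid" where "GG \<equiv> (aut_group adj)\<lparr>carrier := G\<rparr>"

abbreviation GX :: "('v \<Rightarrow> 'v) topology" where "GX \<equiv> subtopology (aut_topology adj) G"

lemma mult_aut_group [simp]: "g \<otimes>\<^bsub>aut_group adj\<^esub> h = g \<circ> h"
  by (simp add: aut_group_def)

lemma m_inv_GG: "g \<in> G \<Longrightarrow> m_inv GG g = fun_inv g"
  using group.inv_equality[OF subgroup.subgroup_is_group[OF subgroup_G group_aut_group], of "fun_inv g" g]
    inv_G[of g] bij_G[of g]
  by (simp add: aut_group_def bij_is_inj)

lemma continuous_vertex_function: "continuous_map GX euclideanreal (\<lambda>g. f (g x))"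
proof -
  have "continuous_map (product_topology (\<lambda>_. discrete_topology UNIV) UNIV) (discrete_topology UNIV) (\<lambda>g. g x)"
    by (rule continuous_map_product_projection) simp
  then have "continuous_map GX (discrete_topology UNIV) (\<lambda>g. g x)"
    unfolding aut_topology_def by (intro continuous_map_from_subtopology)
  moreover have "continuous_map (discrete_topology UNIV) euclideanreal f"
    by simp
  ultimately show ?thesis
    using continuous_map_compose[of GX "discrete_topology UNIV" "\<lambda>g. g x" euclideanreal f]
    by (simp add: o_def)
qed

lemma ex_G_gdist: obtains g where "g \<in> G" "d x (g x) = n"
proof -
  obtain y where "d x y = n"
    using ex_beyond by metis
  then show thesis
    using transitive that by metis
qed

lemma radial_CL:
  assumes "radial_neg_type \<phi>"
  shows "(\<lambda>g. \<phi> (d x (g x))) \<in> CL GG GX"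
proof -
  have "cond_neg_type_kernel G (\<lambda>g h. \<phi> (d x ((m_inv GG g \<otimes>\<^bsub>GG\<^esub> h) x)))"
  proof (rule cond_neg_type_kernel_pullback)
    show "cond_neg_type_kernel UNIV (\<lambda>x y. \<phi> (d x y))"
      using assms by (simp add: radial_neg_type_def)
    fix g h assume "g \<in> G" "h \<in> G"
    then show "\<phi> (d x ((m_inv GG g \<otimes>\<^bsub>GG\<^esub> h) x)) = \<phi> (d (g x) (h x))"
      using gdist_inv_G[of g "h x" x] by (simp add: m_inv_GG gdist_commute)
  qed simp
  then show ?thesis
    using continuous_vertex_function[of "\<lambda>y. \<phi> (d x y)"] by (simp add: CL_def)
qed

text \<open>A function of negative type that vanishes on a stabiliser is bi-invariant under it, hence a
  function of the displacement because the stabiliser is transitive on spheres.\<close>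

lemma CL_radial:
  assumes \<psi>: "\<psi> \<in> CL GG GX" and K: "\<And>g. g \<in> G \<Longrightarrow> g x = x \<Longrightarrow> \<psi> g = 0"
  obtains \<phi> where "radial_neg_type \<phi>" "\<And>g. g \<in> G \<Longrightarrow> \<psi> g = \<phi> (d x (g x))"
proof -
  let ?\<Psi> = "\<lambda>g h. \<psi> (m_inv GG g \<otimes>\<^bsub>GG\<^esub> h)"
  have ker: "cond_neg_type_kernel G ?\<Psi>"
    using \<psi> by (simp add: CL_def)
  have \<Psi>: "?\<Psi> g h = \<psi> (fun_inv g \<circ> h)" if "g \<in> G" for g h
    using that by (simp add: m_inv_GG)
  have sym: "?\<Psi> g h = ?\<Psi> h g" if "g \<in> G" "h \<in> G" for g h
    using ker that unfolding cond_neg_type_kernel_def by simp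
  have inv_id: "fun_inv id \<circ> g = g" for g :: "'v \<Rightarrow> 'v"
    by simp
  have eq: "\<psi> g = \<psi> h" if g: "g \<in> G" and h: "h \<in> G" and gh: "d x (g x) = d x (h x)" for g h
  proof -
    obtain k where k: "k \<in> G" "k x = x" "k (g x) = h x"
      using sphere_transitive[OF gh] by blast
    have kg: "k \<circ> g \<in> G" "fun_inv k \<in> G"
      using comp_G inv_G k g by auto
    have inv_inv: "fun_inv (fun_inv k) = k"
      using bij_G[OF k(1)] by (simp add: inv_inv_eq)
    have "?\<Psi> h (k \<circ> g) = 0"
      unfolding \<Psi>[OF h] using h g inv_G[OF h] k by (intro K comp_G) auto
    then have "?\<Psi> id h = ?\<Psi> id (k \<circ> g)"
      by (intro cond_neg_type_kernel_zero_imp_eq[OF ker] id_G h kg)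
    then have "\<psi> h = \<psi> (k \<circ> g)"
      unfolding \<Psi>[OF id_G] inv_id .
    also have "\<dots> = ?\<Psi> (fun_inv k) g"
      unfolding \<Psi>[OF kg(2)] inv_inv ..
    also have "\<dots> = ?\<Psi> g (fun_inv k)"
      by (rule sym[OF kg(2) g])
    also have "\<dots> = ?\<Psi> g id"
    proof (intro cond_neg_type_kernel_zero_imp_eq[OF ker] g kg(2) id_G)
      show "?\<Psi> (fun_inv k) id = 0"
        unfolding \<Psi>[OF kg(2)] inv_inv using K k by simp
    qed
    also have "\<dots> = ?\<Psi> id g"
      by (rule sym[OF g id_G])
    also have "\<dots> = \<psi> g"
      unfolding \<Psi>[OF id_G] inv_id ..
    finally show ?thesis ..
  qed
  define \<phi> where "\<phi> n = \<psi> (SOME g. g \<in> G \<and> d x (g x) = n)" for n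
  have \<phi>: "\<psi> g = \<phi> (d x (g x))" if "g \<in> G" for g
  proof -
    let ?h = "SOME h. h \<in> G \<and> d x (h x) = d x (g x)"
    have "?h \<in> G \<and> d x (?h x) = d x (g x)"
      by (rule someI[of _ g]) (use that in simp)
    then show ?thesis
      unfolding \<phi>_def by (intro eq[OF that]) simp_all
  qed
  have "\<forall>y. \<exists>g. g \<in> G \<and> g x = y"
    using transitive by blast
  from choice[OF this] obtain f where f: "\<And>y. f y \<in> G" "\<And>y. f y x = y"
    by blast
  have "radial_neg_type \<phi>"
    unfolding radial_neg_type_def
  proof (rule cond_neg_type_kernel_pullback[OF ker, of _ f])
    fix y z
    have "?\<Psi> (f y) (f z) = \<phi> (d x (fun_inv (f y) (f z x)))"
      unfolding \<Psi>[OF f(1)] using \<phi>[of "fun_inv (f y) \<circ> f z"] f(1) inv_G comp_G by simp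
    also have "d x (fun_inv (f y) (f z x)) = d y z"
      using gdist_inv_G[OF f(1), of y z x] f by (simp add: gdist_commute)
    finally show "\<phi> (d y z) = ?\<Psi> (f y) (f z)" ..
  qed (use f in auto)
  then show thesis
    using that \<phi> by blast
qed

lemma CL_nonneg:
  assumes \<psi>: "\<psi> \<in> CL GG GX" and g: "g \<in> G"
  shows "\<psi> g \<ge> 0"
proof -
  have "\<psi> (m_inv GG id \<otimes>\<^bsub>GG\<^esub> g) \<ge> 0"
  proof -
    let ?\<Psi> = "\<lambda>g h. \<psi> (m_inv GG g \<otimes>\<^bsub>GG\<^esub> h)"
    have ker: "cond_neg_type_kernel G ?\<Psi>"
      using \<psi> by (simp add: CL_def)
    define p \<alpha> where "p = (\<lambda>i::nat. [id, g] ! i)" and "\<alpha> = (\<lambda>i::nat. [1, - 1 :: real] ! i)"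
    have "\<forall>i<2. p i \<in> G"
      using g id_G by (auto simp: p_def less_Suc_eq numeral_2_eq_2)
    moreover have "(\<Sum>i<2. \<alpha> i) = 0"
      by (simp add: \<alpha>_def numeral_2_eq_2)
    ultimately have "(\<Sum>i<2. \<Sum>j<2. \<alpha> i * \<alpha> j * ?\<Psi> (p i) (p j)) \<le> 0"
      using ker unfolding cond_neg_type_kernel_def by blast
    moreover have "?\<Psi> id id = 0" "?\<Psi> g g = 0" "?\<Psi> g id = ?\<Psi> id g"
      using ker g id_G by (auto simp: cond_neg_type_kernel_def)
    ultimately show ?thesis
      by (simp add: p_def \<alpha>_def numeral_2_eq_2)
  qed
  then show ?thesis
    by (simp add: m_inv_GG id_G)
qed

text \<open>The summands vanish on the stabiliser because they are nonnegative, so they are radial as well.\<close>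

lemma pure_harmonic_profile: "pure GG GX (\<lambda>g. harmonic_profile (d x (g x)))"
  unfolding pure_def
proof (intro conjI ballI impI)
  show "(\<lambda>g. harmonic_profile (d x (g x))) \<in> CL GG GX"
    by (rule radial_CL[OF radial_neg_type_harmonic_profile])
  obtain g where "g \<in> G" "d x (g x) = 1"
    by (rule ex_G_gdist)
  then show "\<exists>g\<in>carrier GG. harmonic_profile (d x (g x)) \<noteq> 0"
    using harmonic_profile_1_pos by (intro bexI[of _ g]) auto
next
  have main: "\<exists>t\<ge>0. \<forall>g\<in>carrier GG. \<psi>\<^sub>1 g = t * harmonic_profile (d x (g x))"
    if \<psi>: "\<psi>\<^sub>1 \<in> CL GG GX" "\<psi>\<^sub>2 \<in> CL GG GX"
      and sum: "\<And>g. g \<in> G \<Longrightarrow> harmonic_profile (d x (g x)) = \<psi>\<^sub>1 g + \<psi>\<^sub>2 g" for \<psi>\<^sub>1 \<psi>\<^sub>2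
  proof -
    have K: "\<psi>\<^sub>1 g = 0 \<and> \<psi>\<^sub>2 g = 0" if "g \<in> G" "g x = x" for g
      using sum[OF that(1)] CL_nonneg[OF \<psi>(1) that(1)] CL_nonneg[OF \<psi>(2) that(1)] that(2) by simp
    obtain \<phi>\<^sub>1 where \<phi>\<^sub>1: "radial_neg_type \<phi>\<^sub>1" "\<And>g. g \<in> G \<Longrightarrow> \<psi>\<^sub>1 g = \<phi>\<^sub>1 (d x (g x))"
      using CL_radial[OF \<psi>(1)] K by blast
    obtain \<phi>\<^sub>2 where \<phi>\<^sub>2: "radial_neg_type \<phi>\<^sub>2" "\<And>g. g \<in> G \<Longrightarrow> \<psi>\<^sub>2 g = \<phi>\<^sub>2 (d x (g x))"
      using CL_radial[OF \<psi>(2)] K by blast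
    have "harmonic_profile n = \<phi>\<^sub>1 n + \<phi>\<^sub>2 n" for n
    proof -
      obtain g where "g \<in> G" "d x (g x) = n"
        by (rule ex_G_gdist)
      then show ?thesis
        using sum[of g] \<phi>\<^sub>1(2)[of g] \<phi>\<^sub>2(2)[of g] by simp
    qed
    then obtain t where "t \<ge> 0" "\<And>n. \<phi>\<^sub>1 n = t * harmonic_profile n"
      using harmonic_profile_extremal[OF \<phi>\<^sub>1(1) \<phi>\<^sub>2(1)] by blast
    then show ?thesis
      using \<phi>\<^sub>1(2) by auto
  qed
  fix \<psi>\<^sub>1 \<psi>\<^sub>2 assume *: "\<psi>\<^sub>1 \<in> CL GG GX" "\<psi>\<^sub>2 \<in> CL GG GX"
    "\<forall>g\<in>carrier GG. harmonic_profile (d x (g x)) = \<psi>\<^sub>1 g + \<psi>\<^sub>2 g"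
  show "\<exists>t\<ge>0. \<forall>g\<in>carrier GG. \<psi>\<^sub>1 g = t * harmonic_profile (d x (g x))"
    using main[OF *(1,2)] *(3) by simp
  show "\<exists>t\<ge>0. \<forall>g\<in>carrier GG. \<psi>\<^sub>2 g = t * harmonic_profile (d x (g x))"
    using main[OF *(2,1)] *(3) by (simp add: add.commute)
qed

lemma unbounded_harmonic_profile: "\<not> bounded ((\<lambda>g. harmonic_profile (d x (g x))) ` G)"
proof
  assume "bounded ((\<lambda>g. harmonic_profile (d x (g x))) ` G)"
  then obtain B where B: "\<And>g. g \<in> G \<Longrightarrow> norm (harmonic_profile (d x (g x))) \<le> B"
    by (auto simp: bounded_iff)
  obtain n where n: "harmonic_profile n > B"
    using harmonic_profile_unbounded by blast
  obtain g where "g \<in> G" "d x (g x) = n"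
    by (rule ex_G_gdist)
  then show False
    using B[of g] n by auto
qed

text \<open>The averaging operator is a bounded symmetric operator for the form of \<open>\<psi>\<close>, so it splits
  \<open>\<psi>\<close> into two functions of negative type. If \<open>\<psi>\<close> is pure, the operator is therefore a scalar
  \<open>t\<close>. For \<open>t \<noteq> 1\<close> the function is bounded; \<open>t = 1\<close> is the harmonic case.\<close>

lemma pure_unique:
  assumes pure: "pure GG GX \<psi>" and unbounded: "\<not> bounded (\<psi> ` G)"
    and K: "\<And>g. g \<in> G \<Longrightarrow> g x = x \<Longrightarrow> \<psi> g = 0"
  obtains c where "c > 0" "\<And>g. g \<in> G \<Longrightarrow> \<psi> g = c * harmonic_profile (d x (g x))"
proof -
  have "\<psi> \<in> CL GG GX"
    using pure by (simp add: pure_def)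
  then obtain \<phi> where \<phi>: "radial_neg_type \<phi>" "\<And>g. g \<in> G \<Longrightarrow> \<psi> g = \<phi> (d x (g x))"
    using CL_radial K by blast
  define \<phi>' where "\<phi>' s n = (\<phi> n + s * (radial_avg \<phi> n - \<phi> 1)) / 2" for s n
  have CL: "(\<lambda>g. \<phi>' s (d x (g x))) \<in> CL GG GX" if "\<bar>s\<bar> \<le> 1 / 4" for s
    unfolding \<phi>'_def by (rule radial_CL[OF radial_neg_type_dominated[OF \<phi>(1) that]])
  have split: "\<forall>g\<in>carrier GG. \<psi> g = \<phi>' (1 / 4) (d x (g x)) + \<phi>' (- 1 / 4) (d x (g x))"
    by (simp add: \<phi>(2) \<phi>'_def field_simps)
  have CL4: "(\<lambda>g. \<phi>' (1 / 4) (d x (g x))) \<in> CL GG GX" "(\<lambda>g. \<phi>' (- 1 / 4) (d x (g x))) \<in> CL GG GX"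
    by (rule CL; simp)+
  have "\<exists>t\<ge>0. \<forall>g\<in>carrier GG. \<phi>' (1 / 4) (d x (g x)) = t * \<psi> g"
    using pure[unfolded pure_def, THEN conjunct2, THEN conjunct2, rule_format, OF CL4] split by blast
  then obtain u where u: "\<And>g. g \<in> G \<Longrightarrow> \<phi>' (1 / 4) (d x (g x)) = u * \<psi> g"
    by auto
  define t where "t = 8 * u - 4"
  have t: "radial_avg \<phi> n - \<phi> 1 = t * \<phi> n" for n
  proof -
    obtain g where "g \<in> G" "d x (g x) = n"
      by (rule ex_G_gdist)
    then show ?thesis
      using u[of g] \<phi>(2)[of g] by (simp add: \<phi>'_def t_def field_simps)
  qed
  have "t = 1"
  proof (rule ccontr)
    assume "t \<noteq> 1"
    then obtain B where B: "\<And>n. \<phi> n \<le> B"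
      using eigenfunction_bounded[OF \<phi>(1) t] by blast
    have "norm (\<psi> g) \<le> B" if "g \<in> G" for g
      using B radial_neg_type_nonneg[OF \<phi>(1)] \<phi>(2)[OF that] by simp
    then show False
      using unbounded by (auto simp: bounded_iff)
  qed
  then have profile: "\<phi> n = \<phi> 1 / harmonic_profile 1 * harmonic_profile n" for n
    using t radial_neg_type_0[OF \<phi>(1)] by (intro harmonic_recursion_unique) (auto simp: algebra_simps)
  have "\<phi> 1 \<noteq> 0"
  proof
    assume "\<phi> 1 = 0"
    then have "\<psi> g = 0" if "g \<in> G" for g
      using profile[of "d x (g x)"] \<phi>(2)[OF that] by simp
    then have "\<psi> ` G \<subseteq> {0}"
      by blast
    then have "bounded (\<psi> ` G)"
      by (rule bounded_subset[rotated]) simp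
    then show False
      using unbounded by contradiction
  qed
  then have "\<phi> 1 / harmonic_profile 1 > 0"
    using radial_neg_type_nonneg[OF \<phi>(1), of 1] harmonic_profile_1_pos by simp
  moreover have "\<psi> g = \<phi> 1 / harmonic_profile 1 * harmonic_profile (d x (g x))" if "g \<in> G" for g
    using \<phi>(2)[OF that] profile[of "d x (g x)"] by (rule trans)
  ultimately show thesis
    by (rule that)
qed

lemma edge_action_chi_harmonic:
  assumes "g \<in> G"
  shows "edge_action g (chi_harmonic x y) = chi_harmonic (g x) (g y)"
proof
  fix e :: "'v \<times> 'v"
  obtain u v where e: "e = (u, v)"
    by fastforce
  have "d z (fun_inv g w) = d (g z) w" for z w
    using gdist_inv_G[OF assms, of w z] gdist_commute by metis
  moreover have "adj (fun_inv g u) (fun_inv g v) \<longleftrightarrow> adj u v"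
    using adj_G[OF inv_G[OF assms]] .
  ultimately show "edge_action g (chi_harmonic x y) e = chi_harmonic (g x) (g y) e"
    unfolding e by (simp add: edge_action_def chi_harmonic_def grad_def harmonic_potential_def)
qed

lemma chi_harmonic_add: "chi_harmonic x z e = chi_harmonic x y e + chi_harmonic y z e"
  by (cases e) (simp add: chi_harmonic_def grad_def harmonic_potential_def diff_divide_distrib)

lemma b_tilde_cocycle:
  assumes "g \<in> G" "h \<in> G"
  shows "b_tilde adj x (g \<circ> h) = (\<lambda>e. edge_action g (b_tilde adj x h) e + b_tilde adj x g e)"
  using chi_harmonic_add[of x "g (h x)" _ "g x"]
  by (simp add: b_tilde_eq edge_action_chi_harmonic[OF assms(1)] add.commute fun_eq_iff)

end

section \<open>Absolute values of symmetric contractions\<close>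

text \<open>The coefficients of the power series \<open>y\<close> of \<open>1 - sqrt (1 - x)\<close>; the recursion comes from
  \<open>2 * y = x + y\<^sup>2\<close>. They are nonnegative with sum at most 1, so the series may be evaluated at a
  contraction.\<close>

fun sqrt_coeff :: "nat \<Rightarrow> real" where
  "sqrt_coeff 0 = 0"
| "sqrt_coeff (Suc 0) = 1 / 2"
| "sqrt_coeff (Suc (Suc n)) = (\<Sum>i\<le>n. sqrt_coeff (Suc i) * sqrt_coeff (Suc (n - i))) / 2"

lemma sqrt_coeff_nonneg: "sqrt_coeff n \<ge> 0"
  by (induction n rule: sqrt_coeff.induct) (auto intro!: sum_nonneg)

lemma sqrt_coeff_convolution:
  "(\<Sum>i\<le>n. sqrt_coeff i * sqrt_coeff (n - i)) = 2 * sqrt_coeff n - (if n = 1 then 1 else 0)"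
proof (induction n rule: sqrt_coeff.induct)
  case (3 n)
  have "(\<Sum>i\<le>Suc (Suc n). sqrt_coeff i * sqrt_coeff (Suc (Suc n) - i)) =
      (\<Sum>i\<le>Suc n. sqrt_coeff (Suc i) * sqrt_coeff (Suc n - i))"
    by (subst sum.atMost_Suc_shift) simp
  also have "\<dots> = (\<Sum>i\<le>n. sqrt_coeff (Suc i) * sqrt_coeff (Suc n - i))"
    by simp
  also have "\<dots> = (\<Sum>i\<le>n. sqrt_coeff (Suc i) * sqrt_coeff (Suc (n - i)))"
    by (intro sum.cong refl) (simp add: Suc_diff_le)
  finally show ?case
    by simp
qed simp_all

lemma sqrt_coeff_sum_le: "(\<Sum>k\<le>n. sqrt_coeff k) \<le> 1"
proof (induction n)
  case (Suc n)
  let ?S = "\<Sum>k\<le>n. sqrt_coeff k"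
  have S0: "?S \<ge> 0"
    by (intro sum_nonneg sqrt_coeff_nonneg)
  have "2 * (\<Sum>k\<le>Suc n. sqrt_coeff k) =
      (\<Sum>k\<le>Suc n. (\<Sum>i\<le>k. sqrt_coeff i * sqrt_coeff (k - i)) + (if k = 1 then 1 else 0))"
    by (simp only: sqrt_coeff_convolution sum_distrib_left) simp
  also have "\<dots> = (\<Sum>k\<le>Suc n. \<Sum>i\<le>k. sqrt_coeff i * sqrt_coeff (k - i)) + 1"
    by (simp only: sum.distrib) simp
  also have "(\<Sum>k\<le>Suc n. \<Sum>i\<le>k. sqrt_coeff i * sqrt_coeff (k - i)) =
      (\<Sum>(i, j)\<in>{(i, j). i + j \<le> Suc n}. sqrt_coeff i * sqrt_coeff j)"
    by (rule sum.triangle_reindex_eq[symmetric])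
  also have "\<dots> = (\<Sum>(i, j)\<in>{(i, j). i + j \<le> Suc n \<and> i \<noteq> 0 \<and> j \<noteq> 0}. sqrt_coeff i * sqrt_coeff j)"
  proof (rule sum.mono_neutral_right)
    have "{(i, j). i + j \<le> Suc n} \<subseteq> {..Suc n} \<times> {..Suc n}"
      by auto
    then show "finite {(i, j). i + j \<le> Suc n}"
      by (rule finite_subset) simp
  qed (auto intro!: gr0I)
  also have "\<dots> \<le> (\<Sum>(i, j)\<in>{..n} \<times> {..n}. sqrt_coeff i * sqrt_coeff j)"
    by (rule sum_mono2) (auto simp: sqrt_coeff_nonneg)
  also have "\<dots> = ?S * ?S"
    by (simp add: sum_product sum.cartesian_product)
  also have "\<dots> \<le> 1"
    using Suc S0 by (simp add: mult_le_one)
  finally show ?case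
    by simp
qed simp

lemma sqrt_coeff_summable: "sqrt_coeff summable_on UNIV" and sqrt_coeff_infsum: "infsum sqrt_coeff UNIV \<le> 1"
proof -
  have *: "sum sqrt_coeff F \<le> 1" if fin: "finite F" for F
  proof -
    obtain n where "F \<subseteq> {..n}"
      using fin finite_nat_iff_bounded_le by blast
    then have "sum sqrt_coeff F \<le> sum sqrt_coeff {..n}"
      by (intro sum_mono2) (auto intro: sqrt_coeff_nonneg)
    then show ?thesis
      using sqrt_coeff_sum_le[of n] by simp
  qed
  have "bdd_above (sum sqrt_coeff ` {F. F \<subseteq> UNIV \<and> finite F})"
    by (rule bdd_aboveI2[of _ _ 1]) (use * in simp)
  then show s: "sqrt_coeff summable_on UNIV"
    by (intro nonneg_bdd_above_summable_on sqrt_coeff_nonneg)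
  show "infsum sqrt_coeff UNIV \<le> 1"
    by (rule infsum_le_finite_sums[OF s]) (use * in auto)
qed

lemma infsum_bounded_linear:
  assumes "bounded_linear h" "f summable_on A"
  shows "infsum (\<lambda>x. h (f x)) A = h (infsum f A)"
  using has_sum_bounded_linear[OF assms(1) has_sum_infsum[OF assms(2)]] by (rule infsumI)

text \<open>A symmetric contraction on a closed subspace \<open>L\<close> of a Hilbert space. It is given as an
  operator on the whole space because it arises in that way.\<close>

locale symmetric_contraction =
  fixes A :: "'h::{real_inner, banach} \<Rightarrow> 'h" and L :: "'h set"
  assumes subspace_L: "subspace L" and closed_L: "closed L"
    and bounded_linear_A: "bounded_linear A" and A_L: "\<And>u. u \<in> L \<Longrightarrow> A u \<in> L"
    and symmetric_A: "\<And>u v. u \<in> L \<Longrightarrow> v \<in> L \<Longrightarrow> inner (A u) v = inner u (A v)"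
    and contraction_A: "\<And>u. u \<in> L \<Longrightarrow> norm (A u) \<le> norm u"
begin

definition X :: "'h \<Rightarrow> 'h" where "X u = u - A (A u)"

lemma bounded_linear_X: "bounded_linear X"
  unfolding X_def[abs_def]
  by (intro bounded_linear_sub bounded_linear_ident bounded_linear_compose[OF bounded_linear_A bounded_linear_A])

lemma bounded_linear_funpow_X: "bounded_linear (X ^^ k)"
proof (induction k)
  case 0
  then show ?case
    using bounded_linear_ident by (simp add: id_def)
next
  case (Suc k)
  then show ?case
    using bounded_linear_compose[OF bounded_linear_X] by (simp add: o_def)
qed

lemma X_L: "u \<in> L \<Longrightarrow> X u \<in> L"
  unfolding X_def by (intro subspace_diff[OF subspace_L] A_L)

lemma funpow_X_L: "u \<in> L \<Longrightarrow> (X ^^ k) u \<in> L"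
  by (induction k) (auto intro: X_L)

lemma norm_X: assumes "u \<in> L" shows "norm (X u) \<le> norm u"
proof -
  have "inner u (A (A u)) = (norm (A u))\<^sup>2"
    using symmetric_A[OF assms A_L[OF assms]] by (simp add: power2_norm_eq_inner)
  then have "(norm (X u))\<^sup>2 = (norm u)\<^sup>2 - 2 * (norm (A u))\<^sup>2 + (norm (A (A u)))\<^sup>2"
    unfolding X_def by (simp add: power2_norm_eq_inner inner_diff inner_commute)
  moreover have "(norm (A (A u)))\<^sup>2 \<le> (norm (A u))\<^sup>2"
    using contraction_A[OF A_L[OF assms]] by (intro power_mono) auto
  ultimately have "(norm (X u))\<^sup>2 \<le> (norm u)\<^sup>2"
    by (smt (verit) zero_le_power2)
  then show ?thesis
    by (rule power2_le_imp_le) simp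
qed

lemma norm_funpow_X: "u \<in> L \<Longrightarrow> norm ((X ^^ k) u) \<le> norm u"
proof (induction k)
  case (Suc k)
  then show ?case
    using norm_X[OF funpow_X_L[of u k]] by auto
qed simp

lemma summable_series:
  assumes "u \<in> L"
  shows "(\<lambda>k. norm (sqrt_coeff k *\<^sub>R (X ^^ k) u)) summable_on UNIV"
    and "(\<lambda>k. sqrt_coeff k *\<^sub>R (X ^^ k) u) summable_on UNIV"
proof -
  show "(\<lambda>k. norm (sqrt_coeff k *\<^sub>R (X ^^ k) u)) summable_on UNIV"
    by (rule Infinite_Sum.abs_summable_on_comparison_test'[OF summable_on_cmult_left[OF sqrt_coeff_summable, of "norm u"]])
       (use norm_funpow_X[OF assms] sqrt_coeff_nonneg in \<open>auto intro: mult_left_mono\<close>)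
  then show "(\<lambda>k. sqrt_coeff k *\<^sub>R (X ^^ k) u) summable_on UNIV"
    by (rule abs_summable_summable)
qed

text \<open>The series represents \<open>1 - sqrt (1 - X)\<close>. As \<open>1 - X\<close> is the square of \<open>A\<close>, its difference from the
  identity is the absolute value of \<open>A\<close>.\<close>

definition Y :: "'h \<Rightarrow> 'h" where "Y u = (\<Sum>\<^sub>\<infinity>k. sqrt_coeff k *\<^sub>R (X ^^ k) u)"

definition abs_A :: "'h \<Rightarrow> 'h" where "abs_A u = u - Y u"

lemma Y_commute:
  assumes T: "bounded_linear T" "\<And>u. u \<in> L \<Longrightarrow> T u \<in> L" "\<And>u. u \<in> L \<Longrightarrow> T (A u) = A (T u)" and u: "u \<in> L"
  shows "T (Y u) = Y (T u)"
proof -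
  interpret T: bounded_linear T by fact
  have TX1: "T (X v) = X (T v)" if "v \<in> L" for v
    using that by (simp add: X_def T.diff T(3) A_L)
  have TX: "T ((X ^^ k) u) = (X ^^ k) (T u)" for k
  proof (induction k)
    case (Suc k)
    then show ?case
      using TX1[OF funpow_X_L[OF u, of k]] by simp
  qed simp
  have "(\<Sum>\<^sub>\<infinity>k. T (sqrt_coeff k *\<^sub>R (X ^^ k) u)) = T (Y u)"
    unfolding Y_def by (rule infsum_bounded_linear[OF T(1) summable_series(2)[OF u]])
  then show ?thesis
    by (simp add: Y_def T.scale TX)
qed

lemma Y_L: assumes "u \<in> L" shows "Y u \<in> L"
proof -
  have "((\<lambda>F. \<Sum>k\<in>F. sqrt_coeff k *\<^sub>R (X ^^ k) u) \<longlongrightarrow> Y u) (finite_subsets_at_top UNIV)"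
    unfolding Y_def using summable_series(2)[OF assms] by (rule infsum_tendsto)
  moreover have "\<forall>\<^sub>F F in finite_subsets_at_top UNIV. (\<Sum>k\<in>F. sqrt_coeff k *\<^sub>R (X ^^ k) u) \<in> L"
    using assms by (intro always_eventually allI subspace_sum[OF subspace_L] subspace_scale[OF subspace_L] funpow_X_L)
  ultimately show ?thesis
    using Lim_in_closed_set[OF closed_L] finite_subsets_at_top_neq_bot by blast
qed

lemma Y_add: assumes "u \<in> L" "v \<in> L" shows "Y (u + v) = Y u + Y v"
proof -
  interpret Xk: bounded_linear "X ^^ k" for k by (rule bounded_linear_funpow_X)
  show ?thesis
    unfolding Y_def Xk.add scaleR_add_right by (intro infsum_add summable_series assms)
qed

lemma norm_Y: assumes "u \<in> L" shows "norm (Y u) \<le> norm u"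
proof -
  have "norm (Y u) \<le> (\<Sum>\<^sub>\<infinity>k. norm (sqrt_coeff k *\<^sub>R (X ^^ k) u))"
    unfolding Y_def by (rule norm_infsum_bound[OF summable_series(1)[OF assms]])
  also have "\<dots> \<le> (\<Sum>\<^sub>\<infinity>k. sqrt_coeff k * norm u)"
    using norm_funpow_X[OF assms] sqrt_coeff_nonneg
    by (intro infsum_mono summable_series(1)[OF assms] summable_on_cmult_left sqrt_coeff_summable)
       (auto intro: mult_left_mono)
  also have "\<dots> = infsum sqrt_coeff UNIV * norm u"
    by (simp add: infsum_cmult_left')
  also have "\<dots> \<le> norm u"
    using mult_right_mono[OF sqrt_coeff_infsum, of "norm u"] by simp
  finally show ?thesis .
qed

lemma inner_X: "u \<in> L \<Longrightarrow> v \<in> L \<Longrightarrow> inner (X u) v = inner u (X v)"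
  by (simp add: X_def inner_diff symmetric_A A_L)

lemma inner_funpow_X: "u \<in> L \<Longrightarrow> v \<in> L \<Longrightarrow> inner ((X ^^ k) u) v = inner u ((X ^^ k) v)"
proof (induction k arbitrary: v)
  case (Suc k)
  then show ?case
    by (simp add: inner_X funpow_X_L X_L funpow_swap1[of X k v])
qed simp

lemma inner_Y: assumes "u \<in> L" "v \<in> L" shows "inner (Y u) v = inner u (Y v)"
proof -
  have "inner (Y u) v = (\<Sum>\<^sub>\<infinity>k. inner (sqrt_coeff k *\<^sub>R (X ^^ k) u) v)"
    unfolding Y_def
    by (rule infsum_bounded_linear[OF bounded_linear_inner_left summable_series(2)[OF assms(1)], symmetric])
  also have "\<dots> = (\<Sum>\<^sub>\<infinity>k. inner u (sqrt_coeff k *\<^sub>R (X ^^ k) v))"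
    by (simp add: inner_funpow_X[OF assms])
  also have "\<dots> = inner u (Y v)"
    unfolding Y_def
    by (rule infsum_bounded_linear[OF bounded_linear_inner_right summable_series(2)[OF assms(2)]])
  finally show ?thesis .
qed

text \<open>The power series satisfies \<open>y\<^sup>2 = 2 * y - x\<close>; the double series may be rearranged because it converges
  absolutely.\<close>

lemma Y_Y: assumes u: "u \<in> L" shows "Y (Y u) = 2 *\<^sub>R Y u - X u"
proof -
  let ?f = "\<lambda>(k, j). (sqrt_coeff k * sqrt_coeff j) *\<^sub>R (X ^^ (k + j)) u"
  have prod: "(\<lambda>(k, j). sqrt_coeff k * sqrt_coeff j) summable_on UNIV \<times> UNIV"
    by (rule summable_on_SigmaI[where g = "\<lambda>k. sqrt_coeff k * infsum sqrt_coeff UNIV"])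
       (auto intro!: has_sum_cmult_right summable_on_cmult_left sqrt_coeff_summable sqrt_coeff_nonneg mult_nonneg_nonneg has_sum_infsum)
  have "(\<lambda>p. norm (?f p)) summable_on UNIV \<times> UNIV"
    by (rule Infinite_Sum.abs_summable_on_comparison_test'[OF summable_on_cmult_left[OF prod, of "norm u"]])
       (use norm_funpow_X[OF u] sqrt_coeff_nonneg in \<open>auto intro!: mult_left_mono mult_nonneg_nonneg simp: abs_mult\<close>)
  then have f: "?f summable_on UNIV \<times> UNIV"
    by (rule abs_summable_summable)
  have "Y (Y u) = (\<Sum>\<^sub>\<infinity>k. \<Sum>\<^sub>\<infinity>j. ?f (k, j))"
  proof -
    have "sqrt_coeff k *\<^sub>R (X ^^ k) (Y u) = (\<Sum>\<^sub>\<infinity>j. ?f (k, j))" for k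
    proof -
      interpret Xk: bounded_linear "X ^^ k" by (rule bounded_linear_funpow_X)
      have "(X ^^ k) (Y u) = (\<Sum>\<^sub>\<infinity>j. (X ^^ k) (sqrt_coeff j *\<^sub>R (X ^^ j) u))"
        unfolding Y_def
        by (rule infsum_bounded_linear[OF bounded_linear_funpow_X summable_series(2)[OF u], symmetric])
      also have "\<dots> = (\<Sum>\<^sub>\<infinity>j. sqrt_coeff j *\<^sub>R (X ^^ (k + j)) u)"
        by (simp add: Xk.scale funpow_add)
      finally show ?thesis
        by (simp add: infsum_scaleR_right[symmetric])
    qed
    then show ?thesis
      by (subst Y_def) simp
  qed
  also have "\<dots> = infsum ?f (UNIV \<times> UNIV)"
    using infsum_Sigma_banach[OF f] by simp
  also have "\<dots> = infsum (\<lambda>(n, i). (sqrt_coeff i * sqrt_coeff (n - i)) *\<^sub>R (X ^^ n) u) (Sigma UNIV (\<lambda>n. {..n}))"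
    by (rule infsum_reindex_bij_witness[of _ "\<lambda>(n, i). (i, n - i)" "\<lambda>(k, j). (k + j, k)"]) auto
  also have "\<dots> = (\<Sum>\<^sub>\<infinity>n. \<Sum>\<^sub>\<infinity>i\<in>{..n}. (sqrt_coeff i * sqrt_coeff (n - i)) *\<^sub>R (X ^^ n) u)"
  proof (rule infsum_Sigma'_banach[symmetric])
    show "(\<lambda>(n, i). (sqrt_coeff i * sqrt_coeff (n - i)) *\<^sub>R (X ^^ n) u) summable_on Sigma UNIV (\<lambda>n. {..n})"
      using f by (subst summable_on_reindex_bij_witness[of _ "\<lambda>(k, j). (k + j, k)" "\<lambda>(n, i). (i, n - i)" _ ?f]) auto
  qed
  also have "\<dots> = (\<Sum>\<^sub>\<infinity>n. 2 *\<^sub>R (sqrt_coeff n *\<^sub>R (X ^^ n) u) - (if n = 1 then X u else 0))"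
  proof (rule infsum_cong)
    fix n :: nat
    have "(\<Sum>\<^sub>\<infinity>i\<in>{..n}. (sqrt_coeff i * sqrt_coeff (n - i)) *\<^sub>R (X ^^ n) u) =
        (\<Sum>i\<le>n. sqrt_coeff i * sqrt_coeff (n - i)) *\<^sub>R (X ^^ n) u"
      by (simp add: scaleR_sum_left)
    then show "(\<Sum>\<^sub>\<infinity>i\<in>{..n}. (sqrt_coeff i * sqrt_coeff (n - i)) *\<^sub>R (X ^^ n) u) =
        2 *\<^sub>R (sqrt_coeff n *\<^sub>R (X ^^ n) u) - (if n = 1 then X u else 0)"
      by (simp add: sqrt_coeff_convolution scaleR_diff_left)
  qed
  also have "\<dots> = 2 *\<^sub>R Y u - X u"
  proof (rule infsumI)
    have "((\<lambda>n. 2 *\<^sub>R (sqrt_coeff n *\<^sub>R (X ^^ n) u)) has_sum 2 *\<^sub>R Y u) UNIV"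
      unfolding Y_def using summable_series(2)[OF u]
      by (intro has_sum_bounded_linear[OF bounded_linear_scaleR_right] has_sum_infsum)
    moreover have "((\<lambda>n. - (if n = 1 then X u else 0)) has_sum (- X u)) (UNIV :: nat set)"
      by (rule has_sum_finite_neutralI[of "{1}"]) simp_all
    ultimately have "((\<lambda>n. 2 *\<^sub>R (sqrt_coeff n *\<^sub>R (X ^^ n) u) + - (if n = 1 then X u else 0)) has_sum (2 *\<^sub>R Y u + - X u)) UNIV"
      by (rule has_sum_add)
    then show "((\<lambda>n. 2 *\<^sub>R (sqrt_coeff n *\<^sub>R (X ^^ n) u) - (if n = 1 then X u else 0)) has_sum (2 *\<^sub>R Y u - X u)) UNIV"
      by simp
  qed
  finally show ?thesis .
qed

lemma abs_A_L: "u \<in> L \<Longrightarrow> abs_A u \<in> L"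
  unfolding abs_A_def by (intro subspace_diff[OF subspace_L] Y_L)

lemma abs_A_add: "u \<in> L \<Longrightarrow> v \<in> L \<Longrightarrow> abs_A (u + v) = abs_A u + abs_A v"
  by (simp add: abs_A_def Y_add)

lemma abs_A_diff: assumes "u \<in> L" "v \<in> L" shows "abs_A (u - v) = abs_A u - abs_A v"
  using abs_A_add[OF subspace_diff[OF subspace_L assms] assms(2)] by simp

lemma inner_abs_A: "u \<in> L \<Longrightarrow> v \<in> L \<Longrightarrow> inner (abs_A u) v = inner u (abs_A v)"
  by (simp add: abs_A_def inner_diff inner_Y)

lemma abs_A_nonneg: assumes "u \<in> L" shows "inner (abs_A u) u \<ge> 0"
proof -
  have "inner (Y u) u \<le> norm (Y u) * norm u"
    by (rule norm_cauchy_schwarz)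
  also have "\<dots> \<le> norm u * norm u"
    using norm_Y[OF assms] by (intro mult_right_mono) auto
  finally show ?thesis
    by (simp add: abs_A_def inner_diff power2_norm_eq_inner[symmetric] power2_eq_square)
qed

lemma abs_A_abs_A: assumes "u \<in> L" shows "abs_A (abs_A u) = A (A u)"
proof -
  have "Y (u - Y u) = Y u - Y (Y u)"
    using Y_add[OF subspace_diff[OF subspace_L assms Y_L[OF assms]] Y_L[OF assms]] by (simp add: eq_diff_eq)
  then show ?thesis
    by (simp add: abs_A_def Y_Y[OF assms] X_def scaleR_2)
qed

lemma abs_A_commute:
  assumes "bounded_linear T" "\<And>u. u \<in> L \<Longrightarrow> T u \<in> L" "\<And>u. u \<in> L \<Longrightarrow> T (A u) = A (T u)" "u \<in> L"
  shows "T (abs_A u) = abs_A (T u)"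
proof -
  interpret T: bounded_linear T by fact
  show ?thesis
    using Y_commute[OF assms] by (simp add: abs_A_def T.diff)
qed

text \<open>The two operators \<open>abs_A + A\<close> and \<open>abs_A - A\<close> commute, and their product is the difference of the squares.\<close>

lemma abs_A_parts:
  assumes "u \<in> L"
  shows "abs_A (abs_A u - A u) + A (abs_A u - A u) = 0"
proof -
  interpret A: bounded_linear A by (rule bounded_linear_A)
  have "A (abs_A u) = abs_A (A u)"
    by (rule abs_A_commute[OF bounded_linear_A A_L _ assms]) auto
  then show ?thesis
    using assms by (simp add: abs_A_diff abs_A_L A_L abs_A_abs_A A.diff)
qed

end

text \<open>A form of Schur's lemma. The operator \<open>J\<close> stands for the multiplication by the imaginary unit;
  the hypothesis \<open>irr\<close> says that each nonzero vector of \<open>L\<close> is cyclic for \<open>A\<close>. For every real \<open>s\<close>, one of the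
  positive and the negative part of \<open>A - s\<close> vanishes, because their product is zero; so no \<open>s\<close>
  separates the values of the quadratic form of \<open>A\<close> on unit vectors.\<close>

lemma symmetric_contraction_scalar:
  fixes A J :: "'h::{real_inner, banach} \<Rightarrow> 'h"
  assumes "symmetric_contraction A L"
    and J: "bounded_linear J" "\<And>u. u \<in> L \<Longrightarrow> J u \<in> L" "\<And>u. u \<in> L \<Longrightarrow> J (A u) = A (J u)"
    and irr: "\<And>u v. u \<in> L \<Longrightarrow> v \<in> L \<Longrightarrow> (\<And>k. inner u ((A ^^ k) v) = 0 \<and> inner (J u) ((A ^^ k) v) = 0) \<Longrightarrow>
      u = 0 \<or> v = 0"
  obtains t where "\<And>u. u \<in> L \<Longrightarrow> A u = t *\<^sub>R u"
proof -
  interpret A: symmetric_contraction A L by fact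
  interpret Alin: bounded_linear A by (rule A.bounded_linear_A)
  interpret Jlin: bounded_linear J by (rule J)
  have small: "\<bar>inner (A u) u\<bar> \<le> inner u u" if "u \<in> L" for u
  proof -
    have "\<bar>inner (A u) u\<bar> \<le> norm (A u) * norm u"
      by (rule Cauchy_Schwarz_ineq2)
    also have "\<dots> \<le> norm u * norm u"
      using A.contraction_A[OF that] by (intro mult_right_mono) auto
    finally show ?thesis
      by (simp add: power2_norm_eq_inner[symmetric] power2_eq_square)
  qed
  have dich: "(\<forall>u\<in>L. inner (A u) u \<le> s * inner u u) \<or> (\<forall>u\<in>L. inner (A u) u \<ge> s * inner u u)" for s
  proof (cases "\<bar>s\<bar> \<le> 1")
    case False
    show ?thesis
    proof (cases "s > 1")
      case True
      have "inner (A u) u \<le> s * inner u u" if "u \<in> L" for u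
        using small[OF that] mult_right_mono[of 1 s "inner u u"] True by simp
      then show ?thesis
        by blast
    next
      case False
      have "s < - 1"
        using False \<open>\<not> \<bar>s\<bar> \<le> 1\<close> by simp
      have "inner (A u) u \<ge> s * inner u u" if "u \<in> L" for u
        using small[OF that] mult_right_mono[of s "- 1" "inner u u"] \<open>s < - 1\<close> by simp
      then show ?thesis
        by blast
    qed
  next
    case True
    \<comment> \<open>half of \<open>A - s\<close>, in order to have a contraction\<close>
    define B where "B u = (1 / 2) *\<^sub>R (A u - s *\<^sub>R u)" for u
    interpret B: symmetric_contraction B L
    proof (rule symmetric_contraction.intro)
      show "bounded_linear B"
        unfolding B_def[abs_def]
        by (intro bounded_linear_const_scaleR bounded_linear_sub A.bounded_linear_A bounded_linear_scaleR_right)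
      show "B u \<in> L" if "u \<in> L" for u
        unfolding B_def using that
        by (intro subspace_scale[OF A.subspace_L] subspace_diff[OF A.subspace_L] A.A_L)
      show "inner (B u) v = inner u (B v)" if "u \<in> L" "v \<in> L" for u v
        using A.symmetric_A[OF that] by (simp add: B_def inner_diff)
      show "norm (B u) \<le> norm u" if "u \<in> L" for u
      proof -
        have "norm (A u - s *\<^sub>R u) \<le> norm (A u) + \<bar>s\<bar> * norm u"
          using norm_triangle_ineq4[of "A u" "s *\<^sub>R u"] by simp
        also have "\<dots> \<le> norm u + 1 * norm u"
          using A.contraction_A[OF that] True by (intro add_mono mult_right_mono) auto
        finally show ?thesis
          by (simp add: B_def)
      qed
    qed (rule A.subspace_L A.closed_L)+
    interpret Blin: bounded_linear B by (rule B.bounded_linear_A)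
    let ?P = "\<lambda>u. B.abs_A u + B u" and ?N = "\<lambda>u. B.abs_A u - B u"
    have AB: "A (B u) = B (A u)" for u
      by (simp add: B_def Alin.scale Alin.diff)
    have JB: "J (B u) = B (J u)" if "u \<in> L" for u
      using that by (simp add: B_def Jlin.scale Jlin.diff J(3))
    have A_abs: "A (B.abs_A u) = B.abs_A (A u)" if "u \<in> L" for u
      by (rule B.abs_A_commute[OF A.bounded_linear_A A.A_L AB that])
    have J_abs: "J (B.abs_A u) = B.abs_A (J u)" if "u \<in> L" for u
      by (rule B.abs_A_commute[OF J(1,2) JB that])
    have funpow: "(A ^^ k) v \<in> L \<and> (A ^^ k) (?N v) = ?N ((A ^^ k) v)" if "v \<in> L" for k v
    proof (induction k)
      case (Suc k)
      then show ?case
        by (simp add: A.A_L A_abs Alin.diff AB)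
    qed (simp add: that)
    have orth: "inner (?P u) ((A ^^ k) (?N v)) = 0" if "u \<in> L" "v \<in> L" for u v k
    proof -
      let ?w = "(A ^^ k) v"
      have w: "?w \<in> L"
        using funpow[OF that(2)] by blast
      then have Nw: "?N ?w \<in> L"
        by (intro subspace_diff[OF A.subspace_L] B.abs_A_L B.A_L)
      have "inner (?P u) (?N ?w) = inner u (B.abs_A (?N ?w) + B (?N ?w))"
        using B.inner_abs_A[OF that(1) Nw] B.symmetric_A[OF that(1) Nw] by (simp only: inner_add)
      also have "\<dots> = 0"
        using B.abs_A_parts[OF w] by simp
      finally show ?thesis
        using funpow[OF that(2), of k] by simp
    qed
    have PN: "?P u = 0 \<or> ?N v = 0" if "u \<in> L" "v \<in> L" for u v
    proof (rule irr)
      show "?P u \<in> L" "?N v \<in> L"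
        using that by (auto intro!: subspace_diff[OF A.subspace_L] subspace_add[OF A.subspace_L] B.abs_A_L B.A_L)
      have "J (?P u) = ?P (J u)"
        using that by (simp add: Jlin.add J_abs JB)
      then show "inner (?P u) ((A ^^ k) (?N v)) = 0 \<and> inner (J (?P u)) ((A ^^ k) (?N v)) = 0" for k
        using orth[OF that] orth[OF J(2)[OF that(1)] that(2)] by simp
    qed
    have BA: "inner (A u) u = s * inner u u + 2 * inner (B u) u" for u
      by (simp add: B_def inner_diff diff_divide_distrib)
    show ?thesis
    proof (cases "\<forall>u\<in>L. ?P u = 0")
      case True
      have "inner (A u) u \<le> s * inner u u" if "u \<in> L" for u
      proof -
        have "B u = - B.abs_A u"
          using True that by (simp add: eq_neg_iff_add_eq_0 add.commute)
        then show ?thesis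
          using B.abs_A_nonneg[OF that] BA[of u] by simp
      qed
      then show ?thesis
        by blast
    next
      case False
      then have "?N v = 0" if "v \<in> L" for v
        using PN that by blast
      then have "inner (A u) u \<ge> s * inner u u" if "u \<in> L" for u
        using B.abs_A_nonneg[OF that] BA[of u] that by simp
      then show ?thesis
        by blast
    qed
  qed
  show thesis
  proof (cases "L \<subseteq> {0}")
    case True
    then show thesis
      using that[of 0] Alin.zero by force
  next
    case False
    then obtain w where w: "w \<in> L" "w \<noteq> 0"
      by blast
    define S where "S = {s. \<forall>u\<in>L. inner (A u) u \<le> s * inner u u}"
    define t where "t = Inf S"
    have ww: "inner w w > 0"
      using w by simp
    have "1 \<in> S"
      using small by (force simp: S_def)
    have bdd: "bdd_below S"
    proof (rule bdd_belowI)
      fix s assume "s \<in> S"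
      then have "- inner w w \<le> s * inner w w"
        using small[OF w(1)] w(1) by (force simp: S_def)
      then show "- 1 \<le> s"
        using ww by (metis mult_le_cancel_right_pos mult_minus1)
    qed
    have upper: "inner (A u) u \<le> t * inner u u" if u: "u \<in> L" for u
    proof (cases "u = 0")
      case False
      then have uu: "inner u u > 0"
        by simp
      have "inner (A u) u / inner u u \<le> t"
        unfolding t_def
      proof (rule cInf_greatest)
        fix s assume "s \<in> S"
        then show "inner (A u) u / inner u u \<le> s"
          using u uu by (simp add: S_def divide_le_eq)
      qed (use \<open>1 \<in> S\<close> in blast)
      then show ?thesis
        using uu by (simp add: divide_le_eq)
    qed (simp add: Alin.zero)
    have lower: "inner (A u) u \<ge> t * inner u u" if u: "u \<in> L" for u
    proof (cases "u = 0")
      case False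
      then have uu: "inner u u > 0"
        by simp
      have "s \<le> inner (A u) u / inner u u" if "s < t" for s
      proof -
        have "s \<notin> S"
          using cInf_lower[OF _ bdd] that unfolding t_def by force
        then show ?thesis
          using dich[of s] u uu by (auto simp: S_def le_divide_eq)
      qed
      then have "t \<le> inner (A u) u / inner u u"
        by (rule dense_le)
      then show ?thesis
        using uu by (simp add: le_divide_eq)
    qed (simp add: Alin.zero)
    let ?D = "\<lambda>u. A u - t *\<^sub>R u"
    have DL: "?D u \<in> L" if "u \<in> L" for u
      using that by (intro subspace_diff[OF A.subspace_L] subspace_scale[OF A.subspace_L] A.A_L)
    have diag: "inner (?D u) u = 0" if "u \<in> L" for u
      using upper[OF that] lower[OF that] by (simp add: inner_diff)
    have "?D u = 0" if u: "u \<in> L" for u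
    proof -
      let ?v = "?D u"
      have v: "?v \<in> L"
        by (rule DL[OF u])
      have "inner (?D (u + ?v)) (u + ?v) = 0"
        by (rule diag[OF subspace_add[OF A.subspace_L u v]])
      moreover have "?D (u + ?v) = ?D u + ?D ?v"
        by (simp add: Alin.add scaleR_add_right)
      moreover have "inner (?D ?v) u = inner (?D u) ?v"
        using A.symmetric_A[OF v u] by (simp add: inner_diff inner_commute algebra_simps)
      ultimately have "2 * inner ?v ?v = 0"
        using diag[OF u] diag[OF v] by (simp add: inner_add)
      then show ?thesis
        by simp
    qed
    then show thesis
      using that[of t] by simp
  qed
qed

section \<open>Harmonicity of unbounded cocycles\<close>

text \<open>The Cauchy criterion: the tails of the series of \<open>g\<close> control those of the series of \<open>f\<close>. Unlike absolute
  convergence, this applies to expansions in a frame.\<close>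

lemma summable_on_if_square_bound:
  fixes f :: "'a \<Rightarrow> 'b::banach" and g :: "'a \<Rightarrow> real"
  assumes g: "g summable_on A" "\<And>x. x \<in> A \<Longrightarrow> g x \<ge> 0"
    and bound: "\<And>F. finite F \<Longrightarrow> F \<subseteq> A \<Longrightarrow> (norm (sum f F))\<^sup>2 \<le> B * sum g F"
  shows "f summable_on A"
proof -
  have "\<exists>P. eventually P (finite_subsets_at_top A) \<and>
              (\<forall>F F'. P F \<and> P F' \<longrightarrow> dist (sum f F) (sum f F') < e)" if e: "e > 0" for e
  proof -
    define \<delta> where "\<delta> = (e / 2)\<^sup>2 / (\<bar>B\<bar> + 1)"
    have \<delta>: "\<delta> > 0"
      using e by (simp add: \<delta>_def add_nonneg_pos)
    obtain F0 where F0: "finite F0" "F0 \<subseteq> A" "dist (sum g F0) (infsum g A) \<le> \<delta> / 2"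
      using infsum_finite_approximation[OF g(1), of "\<delta> / 2"] \<delta> by auto
    have small: "norm (sum f F) < e / 2" if F: "finite F" "F \<subseteq> A - F0" for F
    proof -
      have "sum g F + sum g F0 = sum g (F \<union> F0)"
        using F F0 by (subst sum.union_disjoint) auto
      also have "\<dots> \<le> infsum g A"
        using F F0 g by (intro finite_sum_le_infsum) auto
      finally have gF: "sum g F < \<delta>"
        using F0(3) \<delta> unfolding dist_real_def by linarith
      have g0: "sum g F \<ge> 0"
        using F g by (intro sum_nonneg) auto
      have "(norm (sum f F))\<^sup>2 \<le> B * sum g F"
        using F by (intro bound) auto
      also have "\<dots> \<le> (\<bar>B\<bar> + 1) * sum g F"
        using g0 by (intro mult_right_mono) auto
      also have "\<dots> < (\<bar>B\<bar> + 1) * \<delta>"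
        using gF by (intro mult_strict_left_mono) auto
      also have "\<dots> = (e / 2)\<^sup>2"
        by (simp add: \<delta>_def add_nonneg_pos less_imp_neq[symmetric])
      finally show ?thesis
        by (rule power2_less_imp_less) (use e in simp)
    qed
    define P where "P F \<longleftrightarrow> finite F \<and> F0 \<subseteq> F \<and> F \<subseteq> A" for F
    have "eventually P (finite_subsets_at_top A)"
      unfolding eventually_finite_subsets_at_top P_def using F0 by blast
    moreover have "dist (sum f F) (sum f F') < e" if "P F" "P F'" for F F'
    proof -
      have "sum f F = sum f (F \<inter> F') + sum f (F - F')" "sum f F' = sum f (F \<inter> F') + sum f (F' - F)"
        using that sum.Int_Diff[of F f F'] sum.Int_Diff[of F' f F] by (auto simp: P_def Int_commute)
      then have "dist (sum f F) (sum f F') = norm (sum f (F - F') - sum f (F' - F))"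
        by (simp add: dist_norm)
      also have "\<dots> \<le> norm (sum f (F - F')) + norm (sum f (F' - F))"
        by (rule norm_triangle_ineq4)
      also have "\<dots> < e / 2 + e / 2"
        using that by (intro add_strict_mono small) (auto simp: P_def)
      finally show ?thesis
        by simp
    qed
    ultimately show ?thesis
      by blast
  qed
  then have "cauchy_filter (filtermap (sum f) (finite_subsets_at_top A))"
    by (simp add: cauchy_filter_metric_filtermap)
  moreover have "complete (UNIV::'b set)"
    by (meson Cauchy_convergent UNIV_I complete_def convergent_def)
  ultimately obtain L' where "(sum f \<longlongrightarrow> L') (finite_subsets_at_top A)"
    using complete_uniform[where S = UNIV] by (force simp add: filterlim_def)
  then show ?thesis
    using summable_on_def has_sum_def by blast
qed

instance chilbert_space \<subseteq> banach ..

lemma scaleC_scaleR_commute: "scaleC a (r *\<^sub>R x) = r *\<^sub>R scaleC a (x::'h::chilbert_space)"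
  by (simp add: scaleC_of_real[symmetric] scaleC_scaleC mult.commute)

lemma cinner_scaleC_right: "cinner x (scaleC a y) = cnj a * cinner x (y::'h::chilbert_space)"
  by (metis cinner_commute cinner_scaleC_left complex_cnj_mult)

lemma Im_cinner: "Im (cinner x (y::'h::chilbert_space)) = - inner (scaleC \<i> x) y"
  using Re_cinner[of "scaleC \<i> x" y] by (simp add: cinner_scaleC_left)

lemma cinner_self: "cinner x (x::'h::chilbert_space) = complex_of_real (inner x x)"
  using Re_cinner[of x x] cinner_commute[of x x] by (simp add: complex_eq_iff)

lemma norm_scaleC: "norm (scaleC a (x::'h::chilbert_space)) = cmod a * norm x"
proof -
  have "complex_of_real ((norm (scaleC a x))\<^sup>2) = cinner (scaleC a x) (scaleC a x)"
    by (simp add: cinner_self power2_norm_eq_inner)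
  also have "\<dots> = (a * cnj a) * cinner x x"
    by (simp add: cinner_scaleC_left cinner_scaleC_right)
  also have "\<dots> = complex_of_real ((cmod a)\<^sup>2) * complex_of_real ((norm x)\<^sup>2)"
    by (simp only: complex_norm_square[symmetric] cinner_self power2_norm_eq_inner)
  also have "\<dots> = complex_of_real ((cmod a * norm x)\<^sup>2)"
    by (simp add: power_mult_distrib)
  finally have "complex_of_real ((norm (scaleC a x))\<^sup>2) = complex_of_real ((cmod a * norm x)\<^sup>2)" .
  then have "(norm (scaleC a x))\<^sup>2 = (cmod a * norm x)\<^sup>2"
    using of_real_eq_iff by blast
  then show ?thesis
    by simp
qed

lemma bounded_linear_scaleC: "bounded_linear (scaleC a :: 'h::chilbert_space \<Rightarrow> 'h)"
  by (rule bounded_linear_intro[where K = "cmod a"])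
     (simp_all add: scaleC_add_right scaleC_scaleR_commute norm_scaleC mult.commute)

lemma cinner_eq_Complex: "cinner x (y::'h::chilbert_space) = Complex (inner x y) (- inner (scaleC \<i> x) y)"
  by (simp add: complex_eq_iff Re_cinner Im_cinner)

lemma bounded_linear_cinner_left: "bounded_linear (\<lambda>x. cinner x (y::'h::chilbert_space))"
proof (rule bounded_linear_intro[where K = "2 * norm y"])
  fix x z :: 'h and r :: real
  show "cinner (x + z) y = cinner x y + cinner z y"
    by (rule cinner_add_left)
  show "cinner (r *\<^sub>R x) y = r *\<^sub>R cinner x y"
    by (simp add: scaleC_of_real[symmetric] cinner_scaleC_left scaleR_conv_of_real)
  have "cmod (cinner x y) \<le> \<bar>inner x y\<bar> + \<bar>inner (scaleC \<i> x) y\<bar>"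
    using cmod_le[of "cinner x y"] by (simp add: Re_cinner Im_cinner)
  also have "\<dots> \<le> norm x * norm y + norm (scaleC \<i> x) * norm y"
    by (intro add_mono Cauchy_Schwarz_ineq2)
  finally show "cmod (cinner x y) \<le> norm x * (2 * norm y)"
    by (simp add: norm_scaleC mult.commute)
qed

lemma bounded_linear_cinner_right: "bounded_linear (\<lambda>y. cinner (x::'h::chilbert_space) y)"
proof -
  have "bounded_linear (\<lambda>y. cnj (cinner y x))"
    by (rule bounded_linear_compose[OF bounded_linear_cnj bounded_linear_cinner_left])
  then show ?thesis
    using cinner_commute[of x] by simp
qed

lemmas cinner_diff_left = linear_diff[OF bounded_linear.linear[OF bounded_linear_cinner_left]]
  and cinner_zero_left [simp] = linear_0[OF bounded_linear.linear[OF bounded_linear_cinner_left]]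
  and cinner_scaleR_left = linear_scale[OF bounded_linear.linear[OF bounded_linear_cinner_left]]
  and cinner_scaleR_right = linear_scale[OF bounded_linear.linear[OF bounded_linear_cinner_right]]
  and cinner_sum_left = linear_sum[OF bounded_linear.linear[OF bounded_linear_cinner_left]]
  and cinner_sum_right = linear_sum[OF bounded_linear.linear[OF bounded_linear_cinner_right]]

lemma unitary_op_inner: "unitary_op T \<Longrightarrow> inner (T x) (T y) = inner x y"
  by (metis Re_cinner unitary_op_def)

lemma unitary_op_norm: "unitary_op T \<Longrightarrow> norm (T x) = norm x"
  by (simp add: norm_eq_sqrt_inner unitary_op_inner)

lemma unitary_op_bounded_linear: assumes "unitary_op T" shows "bounded_linear T"
proof (rule bounded_linear_intro[where K = 1])
  show "T (r *\<^sub>R x) = r *\<^sub>R T x" for r x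
    using assms unfolding unitary_op_def by (metis scaleC_of_real)
qed (use assms in \<open>auto simp: unitary_op_norm unitary_op_def\<close>)

context regular_tree_graph
begin

text \<open>If the sum over all neighbours of \<open>z\<close> vanishes, and so does the value at the parent, then the sum over
  the children vanishes; they all have the same value.\<close>

lemma zero_on_children:
  fixes f :: "'v \<Rightarrow> 'a::real_vector"
  assumes sum: "(\<Sum>y | adj z y. f y) = 0"
    and parent: "\<And>y. adj z y \<Longrightarrow> d x y < d x z \<Longrightarrow> f y = 0"
    and children: "\<And>y. adj z y \<Longrightarrow> d x y = Suc (d x z) \<Longrightarrow> f y = f w"
    and w: "adj z w" "d x w = Suc (d x z)"
  shows "f w = 0"
proof -
  let ?C = "{y. adj z y \<and> d x y = Suc (d x z)}"
  have "(\<Sum>y | adj z y. f y) = (\<Sum>y\<in>?C. f y)"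
  proof (intro sum.mono_neutral_right ballI)
    fix y assume y: "y \<in> {y. adj z y} - ?C"
    then have "d x y < d x z"
      using gdist_adj_cases[of z y x] by auto
    then show "f y = 0"
      using parent y by blast
  qed auto
  also have "\<dots> = (\<Sum>y\<in>?C. f w)"
    using children by (intro sum.cong) auto
  also have "\<dots> = real (card ?C) *\<^sub>R f w"
    by (rule sum_constant_scaleR)
  finally have "real (card ?C) *\<^sub>R f w = 0"
    using sum by simp
  moreover have "card ?C \<noteq> 0"
  proof
    assume "card ?C = 0"
    moreover have "finite ?C"
      by (rule finite_subset[of _ "{y. adj z y}"]) auto
    ultimately have "?C = {}"
      by simp
    then show False
      using w by blast
  qed
  ultimately show ?thesis
    by simp
qed

lemma harmonic_radial_zero:
  fixes f :: "'v \<Rightarrow> 'a::real_vector"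
  assumes harm: "\<And>z. (\<Sum>y | adj z y. f y) = (real q + 1) *\<^sub>R f z"
    and radial: "\<And>y z. d x y = d x z \<Longrightarrow> f y = f z" and "f x = 0"
  shows "f y = 0"
proof (induction "d x y" arbitrary: y rule: less_induct)
  case less
  show ?case
  proof (cases "d x y")
    case 0
    then show ?thesis
      using assms(3) by simp
  next
    case (Suc n)
    obtain z where z: "d x z = n" "adj z y"
      using gdist_Suc_parent[OF Suc] by blast
    show ?thesis
    proof (rule zero_on_children[where z = z and f = f and x = x])
      show "(\<Sum>y | adj z y. f y) = 0"
        using harm[of z] less[of z] z Suc by simp
      show "f v = 0" if "adj z v" "d x v < d x z" for v
        using less[of v] that z Suc by simp
      show "f v = f y" if "adj z v" "d x v = Suc (d x z)" for v
        using radial[of v y] that z Suc by simp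
    qed (use z Suc in auto)
  qed
qed

lemma harmonic_half_tree_zero:
  fixes f :: "'v \<Rightarrow> 'a::real_vector"
  assumes harm: "\<And>z. (\<Sum>y | adj z y. f y) = (real q + 1) *\<^sub>R f z"
    and xy: "adj x y" "f x = 0" "f y = 0"
    and radial: "\<And>v w. between x y v \<Longrightarrow> between x y w \<Longrightarrow> d x v = d x w \<Longrightarrow> f v = f w"
    and w: "between x y w"
  shows "f w = 0"
  using w
proof (induction "d x w" arbitrary: w rule: less_induct)
  case less
  have xy1: "d x y = 1"
    by (rule gdist_adj[OF xy(1)])
  show ?case
  proof (cases "w = y")
    case False
    then have "d y w \<noteq> 0"
      by simp
    then obtain n where n: "d y w = Suc n"
      by (cases "d y w") auto
    obtain z where z: "d y z = n" "adj z w"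
      using gdist_Suc_parent[OF n] by blast
    have dw: "d x w = Suc (Suc n)"
      using less.prems n xy1 by (simp add: between_def)
    have "d x w \<le> d x z + d z w" "d x z \<le> d x y + d y z"
      by (rule gdist_triangle)+
    then have dz: "d x z = Suc n"
      using z(1) xy1 dw gdist_adj[OF z(2)] by simp
    then have bz: "between x y z"
      using z(1) xy1 by (simp add: between_def)
    show ?thesis
    proof (rule zero_on_children[where z = z and f = f and x = x])
      show "(\<Sum>y | adj z y. f y) = 0"
        using harm[of z] less.hyps[of z] bz dz dw by simp
      show "f v = 0" if v: "adj z v" "d x v < d x z" for v
      proof (cases n)
        case 0
        then have "d x v = 0"
          using v dz by simp
        then show ?thesis
          using xy(2) by simp
      next
        case (Suc m)
        have dv: "d x v = n"
          using gdist_adj_cases[OF v(1), of x] v(2) dz by simp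
        then obtain y' where y': "between x y' v" "d x y' = 1"
          using between_at[of 1 x v] Suc by auto
        have vz: "between x v z"
          using dv dz gdist_adj[of v z] v(1) adj_sym[of v z] by (simp add: between_def)
        have "y' = y"
          using between_unique[OF between_trans(1)[OF y'(1) vz] bz] y' xy1 by simp
        then show ?thesis
          using less.hyps[of v] y'(1) dv dw by simp
      qed
      show "f v = f w" if v: "adj z v" "d x v = Suc (d x z)" for v
      proof -
        have "between x z v"
          using v gdist_adj[OF v(1)] by (simp add: between_def)
        then have "between x y v"
          using between_trans(1)[OF bz] by blast
        then show ?thesis
          using radial[OF _ less.prems] v dz dw by simp
      qed
    qed (use z dz dw in auto)
  qed (use xy in simp)
qed

end

text \<open>The function \<open>F\<close> is the cocycle, regarded as an orbit map of the affine action.\<close>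

locale tree_representation = tree_action q adj G
  for q :: nat and adj :: "'v \<Rightarrow> 'v \<Rightarrow> bool" and G +
  fixes x\<^sub>0 :: 'v and \<sigma> :: "('v \<Rightarrow> 'v) \<Rightarrow> 'h::chilbert_space \<Rightarrow> 'h"
    and b :: "('v \<Rightarrow> 'v) \<Rightarrow> 'h" and F :: "'v \<Rightarrow> 'h"
  assumes unitary: "unitary_rep GG GX \<sigma>"
    and irreducible: "irreducible_rep GG \<sigma>"
    and cocycle: "b \<in> cocycles GG GX \<sigma>"
    and unbounded: "\<not> bounded (b ` G)"
    and b_stabiliser: "\<And>g. g \<in> G \<Longrightarrow> g x\<^sub>0 = x\<^sub>0 \<Longrightarrow> b g = 0"
    and F_eq: "\<And>g. g \<in> G \<Longrightarrow> F (g x\<^sub>0) = b g"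
begin

lemma unitary_\<sigma>: "g \<in> G \<Longrightarrow> unitary_op (\<sigma> g)"
  using unitary by (simp add: unitary_rep_def)

lemma \<sigma>_bounded_linear: "g \<in> G \<Longrightarrow> bounded_linear (\<sigma> g)"
  using unitary_\<sigma> unitary_op_bounded_linear by blast

lemmas \<sigma>_add = linear_add[OF bounded_linear.linear[OF \<sigma>_bounded_linear]]
  and \<sigma>_diff = linear_diff[OF bounded_linear.linear[OF \<sigma>_bounded_linear]]
  and \<sigma>_zero = linear_0[OF bounded_linear.linear[OF \<sigma>_bounded_linear]]
  and \<sigma>_scaleR = linear_scale[OF bounded_linear.linear[OF \<sigma>_bounded_linear]]
  and \<sigma>_sum = linear_sum[OF bounded_linear.linear[OF \<sigma>_bounded_linear]]

lemma \<sigma>_scaleC: "g \<in> G \<Longrightarrow> \<sigma> g (scaleC a v) = scaleC a (\<sigma> g v)"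
  using unitary_\<sigma> by (simp add: unitary_op_def)

lemma \<sigma>_cinner: "g \<in> G \<Longrightarrow> cinner (\<sigma> g v) (\<sigma> g w) = cinner v w"
  using unitary_\<sigma> by (simp add: unitary_op_def)

lemma \<sigma>_inner: "g \<in> G \<Longrightarrow> inner (\<sigma> g v) (\<sigma> g w) = inner v w"
  using unitary_\<sigma> unitary_op_inner by blast

lemma \<sigma>_norm: "g \<in> G \<Longrightarrow> norm (\<sigma> g v) = norm v"
  using unitary_\<sigma> unitary_op_norm by blast

lemma \<sigma>_comp: "g \<in> G \<Longrightarrow> h \<in> G \<Longrightarrow> \<sigma> (g \<circ> h) v = \<sigma> g (\<sigma> h v)"
  using unitary by (simp add: unitary_rep_def)

lemma \<sigma>_id: "\<sigma> id v = v"
proof -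
  have "\<sigma> id (\<sigma> id v - v) = 0"
    using \<sigma>_comp[OF id_G id_G, of v] by (simp add: \<sigma>_diff[OF id_G])
  then show ?thesis
    using \<sigma>_norm[OF id_G, of "\<sigma> id v - v"] by simp
qed

lemma \<sigma>_inv: assumes "g \<in> G" shows "\<sigma> g (\<sigma> (fun_inv g) v) = v"
proof -
  have "g \<circ> fun_inv g = id"
    using assms by (auto simp: fun_eq_iff)
  then show ?thesis
    using \<sigma>_comp[OF assms inv_G[OF assms], of v] \<sigma>_id by simp
qed

lemma b_comp: "g \<in> G \<Longrightarrow> h \<in> G \<Longrightarrow> b (g \<circ> h) = \<sigma> g (b h) + b g"
  using cocycle by (simp add: cocycles_def)

lemma F_equivariant: assumes "g \<in> G" shows "F (g x) = \<sigma> g (F x) + b g"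
proof -
  obtain h where h: "h \<in> G" "h x\<^sub>0 = x"
    using transitive by blast
  show ?thesis
    using F_eq[OF comp_G[OF assms h(1)]] F_eq[OF h(1)] b_comp[OF assms h(1)] h(2) by simp
qed

lemma F_base [simp]: "F x\<^sub>0 = 0"
  using F_eq[OF id_G] b_stabiliser[OF id_G] by simp

lemma F_diff_equivariant: "g \<in> G \<Longrightarrow> F (g x) - F (g y) = \<sigma> g (F x - F y)"
  by (simp add: F_equivariant \<sigma>_diff)

text \<open>The orthogonal complement of an invariant set is a closed invariant subspace.\<close>

lemma orthogonal_to_invariant_set:
  assumes inv: "\<And>g v. g \<in> G \<Longrightarrow> v \<in> V \<Longrightarrow> \<sigma> g v \<in> V" and v: "v \<in> V" "v \<noteq> 0"
    and h: "\<And>v. v \<in> V \<Longrightarrow> cinner h v = 0"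
  shows "h = 0"
proof -
  let ?S = "{h. \<forall>v\<in>V. cinner h v = 0}"
  have "closed ?S"
  proof -
    have "?S = (\<Inter>v\<in>V. (\<lambda>h. cinner h v) -` {0})"
      by auto
    moreover have "closed ((\<lambda>h. cinner h v) -` {0})" for v :: 'h
      by (intro continuous_closed_vimage closed_singleton
          linear_continuous_at[OF bounded_linear_cinner_left])
    ultimately show ?thesis
      by auto
  qed
  then have "closed_csubspace ?S"
    by (auto simp: closed_csubspace_def cinner_add_left cinner_scaleC_left)
  moreover have "\<sigma> g ` ?S \<subseteq> ?S" if g: "g \<in> G" for g
  proof
    fix u assume "u \<in> \<sigma> g ` ?S"
    then obtain k where k: "u = \<sigma> g k" "k \<in> ?S"
      by blast
    have "cinner u w = 0" if "w \<in> V" for w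
    proof -
      have "cinner u w = cinner (\<sigma> g k) (\<sigma> g (\<sigma> (fun_inv g) w))"
        using k g by (simp add: \<sigma>_inv)
      also have "\<dots> = 0"
        using k inv[OF inv_G[OF g] that] by (simp add: \<sigma>_cinner[OF g])
      finally show ?thesis .
    qed
    then show "u \<in> ?S"
      by blast
  qed
  ultimately have "?S = {0} \<or> ?S = UNIV"
    using irreducible unfolding irreducible_rep_def by simp
  moreover have "v \<notin> ?S"
    using v by (auto simp: cinner_self intro!: bexI[of _ v])
  ultimately show ?thesis
    using h by blast
qed

definition avgH :: "('v \<Rightarrow> 'h) \<Rightarrow> 'v \<Rightarrow> 'h" where
  "avgH f x = (1 / (real q + 1)) *\<^sub>R (\<Sum>y | adj x y. f y)"

lemma sum_nbrs_G: assumes "g \<in> G" shows "(\<Sum>y | adj (g x) y. f y) = (\<Sum>y | adj x y. f (g y))"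
  by (rule sum.reindex_bij_witness[of _ g "fun_inv g"])
     (use assms adj_G[OF assms] adj_G[OF inv_G[OF assms], of "g x"] in auto)

lemma avgH_sum: "(\<Sum>y | adj x y. f y) = (real q + 1) *\<^sub>R avgH f x"
  using q_ge_2 by (simp add: avgH_def)

lemma avgH_F_equivariant: assumes "g \<in> G" shows "avgH F (g x) = \<sigma> g (avgH F x) + b g"
proof -
  have "(\<Sum>y | adj (g x) y. F y) = (\<Sum>y | adj x y. \<sigma> g (F y)) + (\<Sum>y | adj x y. b g)"
    by (simp only: sum_nbrs_G[OF assms] F_equivariant[OF assms] sum.distrib)
  also have "\<dots> = \<sigma> g (\<Sum>y | adj x y. F y) + (real q + 1) *\<^sub>R b g"
    by (simp add: \<sigma>_sum[OF assms] sum_constant_scaleR add.commute del: sum_constant)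
  finally show ?thesis
    using q_ge_2 by (simp add: avgH_def scaleR_add_right \<sigma>_scaleR[OF assms])
qed

definition fixed_vectors :: "'h set" where
  "fixed_vectors = {v. \<forall>g\<in>G. g x\<^sub>0 = x\<^sub>0 \<longrightarrow> \<sigma> g v = v}"

definition to_vertex :: "'v \<Rightarrow> 'v \<Rightarrow> 'v" where
  "to_vertex y = (SOME g. g \<in> G \<and> g x\<^sub>0 = y)"

lemma to_vertex: "to_vertex y \<in> G" "to_vertex y x\<^sub>0 = y"
proof -
  have "\<exists>g. g \<in> G \<and> g x\<^sub>0 = y"
    using transitive by blast
  from someI_ex[OF this] show "to_vertex y \<in> G" "to_vertex y x\<^sub>0 = y"
    unfolding to_vertex_def by auto
qed

text \<open>The orbit of a fixed vector, as a function on the vertices: the choice of the element that moves the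
  base point does not matter for such vectors.\<close>

definition orbit :: "'h \<Rightarrow> 'v \<Rightarrow> 'h" where "orbit v y = \<sigma> (to_vertex y) v"

lemma orbit_eq:
  assumes v: "v \<in> fixed_vectors" and g: "g \<in> G"
  shows "orbit v (g x\<^sub>0) = \<sigma> g v"
proof -
  let ?t = "to_vertex (g x\<^sub>0)"
  have t: "?t \<in> G" "?t x\<^sub>0 = g x\<^sub>0"
    by (rule to_vertex)+
  let ?k = "fun_inv g \<circ> ?t"
  have "?k \<in> G" "?k x\<^sub>0 = x\<^sub>0"
    using t g by (auto intro!: comp_G inv_G)
  then have "\<sigma> ?k v = v"
    using v by (simp add: fixed_vectors_def)
  then have "\<sigma> (fun_inv g) (\<sigma> ?t v) = v"
    using \<sigma>_comp[OF inv_G[OF g] t(1)] by simp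
  then have "\<sigma> g v = \<sigma> ?t v"
    using \<sigma>_inv[OF g, of "\<sigma> ?t v"] by simp
  then show ?thesis
    by (simp add: orbit_def)
qed

lemma orbit_base: "v \<in> fixed_vectors \<Longrightarrow> orbit v x\<^sub>0 = v"
  using orbit_eq[OF _ id_G, of v] \<sigma>_id by simp

lemma orbit_equivariant:
  assumes v: "v \<in> fixed_vectors" and g: "g \<in> G"
  shows "orbit v (g y) = \<sigma> g (orbit v y)"
  using orbit_eq[OF v comp_G[OF g to_vertex(1)], of y] \<sigma>_comp[OF g to_vertex(1)]
  by (simp add: to_vertex(2) orbit_def)

lemma orbit_scaleR: "orbit (t *\<^sub>R v) y = t *\<^sub>R orbit v y"
  by (simp add: orbit_def \<sigma>_scaleR[OF to_vertex(1)])

lemma orbit_scaleC: "orbit (scaleC a v) y = scaleC a (orbit v y)"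
  by (simp add: orbit_def \<sigma>_scaleC[OF to_vertex(1)])

lemma norm_orbit: "norm (orbit v y) = norm v"
  by (simp add: orbit_def \<sigma>_norm[OF to_vertex(1)])

text \<open>The averaging operator generates the Hecke algebra of the stabiliser, which acts on the fixed
  vectors.\<close>

definition hecke :: "'h \<Rightarrow> 'h" where "hecke v = avgH (orbit v) x\<^sub>0"

lemma avgH_orbit_equivariant:
  assumes v: "v \<in> fixed_vectors" and g: "g \<in> G"
  shows "avgH (orbit v) (g x) = \<sigma> g (avgH (orbit v) x)"
  unfolding avgH_def sum_nbrs_G[OF g] orbit_equivariant[OF v g]
  by (simp add: \<sigma>_scaleR[OF g] \<sigma>_sum[OF g])

lemma hecke_fixed: assumes "v \<in> fixed_vectors" shows "hecke v \<in> fixed_vectors"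
  unfolding fixed_vectors_def hecke_def mem_Collect_eq
  by (metis avgH_orbit_equivariant[OF assms])

lemma avgH_orbit: assumes v: "v \<in> fixed_vectors" shows "avgH (orbit v) y = orbit (hecke v) y"
proof -
  have "avgH (orbit v) y = \<sigma> (to_vertex y) (hecke v)"
    using avgH_orbit_equivariant[OF v to_vertex(1), of y x\<^sub>0] by (simp add: to_vertex(2) hecke_def)
  then show ?thesis
    by (simp add: orbit_def)
qed

lemma subspace_fixed_vectors: "subspace fixed_vectors"
  by (auto simp: subspace_def fixed_vectors_def \<sigma>_zero \<sigma>_add \<sigma>_scaleR)

lemma closed_fixed_vectors: "closed fixed_vectors"
proof -
  have "fixed_vectors = (\<Inter>g\<in>{g\<in>G. g x\<^sub>0 = x\<^sub>0}. {v. \<sigma> g v = v})"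
    by (auto simp: fixed_vectors_def)
  moreover have "closed {v. \<sigma> g v = v}" if "g \<in> G" for g
    using linear_continuous_on[OF \<sigma>_bounded_linear[OF that], of UNIV] by (intro closed_Collect_eq continuous_on_id)
  ultimately show ?thesis
    by auto
qed

lemma hecke_bounded_linear: "bounded_linear hecke"
  unfolding hecke_def[abs_def] avgH_def orbit_def
  by (intro bounded_linear_const_scaleR bounded_linear_sum \<sigma>_bounded_linear to_vertex)

lemma hecke_scaleC: "hecke (scaleC a v) = scaleC a (hecke v)"
  using linear_sum[OF bounded_linear.linear[OF bounded_linear_scaleC[of a]], of "orbit v" "{y. adj x\<^sub>0 y}"]
  by (simp add: hecke_def avgH_def orbit_scaleC scaleC_scaleR_commute)

lemma hecke_symmetric:
  assumes v: "v \<in> fixed_vectors" and w: "w \<in> fixed_vectors"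
  shows "inner (hecke v) w = inner v (hecke w)"
proof -
  have "inner (orbit v y) w = inner v (orbit w y)" if "adj x\<^sub>0 y" for y
  proof -
    obtain g where g: "g \<in> G" "g x\<^sub>0 = y" "g y = x\<^sub>0"
      using two_point_homogeneous[of x\<^sub>0 y y x\<^sub>0] gdist_commute by blast
    have "inner v (orbit w y) = inner (\<sigma> g (orbit v x\<^sub>0)) (\<sigma> g (orbit w y))"
      using \<sigma>_inner[OF g(1)] orbit_base[OF v] by simp
    also have "\<dots> = inner (orbit v y) w"
      using orbit_equivariant[OF v g(1), of x\<^sub>0] orbit_equivariant[OF w g(1), of y] g orbit_base[OF w] by simp
    finally show ?thesis ..
  qed
  then show ?thesis
    by (simp add: hecke_def avgH_def inner_sum_left inner_sum_right)
qed

lemma hecke_contraction: "norm (hecke v) \<le> norm v"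
proof -
  have "norm (\<Sum>y | adj x\<^sub>0 y. orbit v y) \<le> (\<Sum>y | adj x\<^sub>0 y. norm v)"
    by (rule sum_norm_le) (simp add: norm_orbit)
  also have "\<dots> = (real q + 1) * norm v"
    by simp
  finally show ?thesis
    using q_ge_2 by (simp add: hecke_def avgH_def field_simps)
qed

lemma symmetric_contraction_hecke: "symmetric_contraction hecke fixed_vectors"
  by (intro symmetric_contraction.intro subspace_fixed_vectors closed_fixed_vectors
      hecke_bounded_linear hecke_fixed hecke_symmetric hecke_contraction)

text \<open>Through invariance, the inner products of \<open>u\<close> with the orbit of \<open>v\<close> only depend on the distance from
  the base point, so those at distance \<open>n + 1\<close> are determined by those at smaller distances of the orbits
  of \<open>v\<close> and of its images under the powers of the operator.\<close>

lemma orthogonal_to_orbit: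
  assumes u: "u \<in> fixed_vectors" and v: "v \<in> fixed_vectors"
    and orth: "\<And>k. cinner u ((hecke ^^ k) v) = 0"
  shows "cinner u (orbit v y) = 0"
proof -
  have fixed: "(hecke ^^ k) v \<in> fixed_vectors" for k
    by (induction k) (auto simp: v hecke_fixed)
  let ?s = "\<lambda>k y. cinner u (orbit ((hecke ^^ k) v) y)"
  have radial: "?s k y = ?s k z" if yz: "d x\<^sub>0 y = d x\<^sub>0 z" for k y z
  proof -
    obtain g where g: "g \<in> G" "g x\<^sub>0 = x\<^sub>0" "g y = z"
      using sphere_transitive[OF yz] by blast
    have "?s k y = cinner (\<sigma> g u) (\<sigma> g (orbit ((hecke ^^ k) v) y))"
      by (simp add: \<sigma>_cinner[OF g(1)])
    also have "\<dots> = ?s k z"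
      using u g orbit_equivariant[OF fixed g(1), of k y] by (simp add: fixed_vectors_def)
    finally show ?thesis .
  qed
  have "\<forall>k. ?s k y = 0" for y
  proof (induction "d x\<^sub>0 y" arbitrary: y rule: less_induct)
    case less
    show ?case
    proof
      fix k
      show "?s k y = 0"
      proof (cases "d x\<^sub>0 y")
        case 0
        then show ?thesis
          using orth[of k] orbit_base[OF fixed] by simp
      next
        case (Suc n)
        obtain z where z: "d x\<^sub>0 z = n" "adj z y"
          using gdist_Suc_parent[OF Suc] by blast
        show ?thesis
        proof (rule zero_on_children[where z = z and f = "?s k" and x = x\<^sub>0])
          have "\<forall>k. ?s k z = 0"
            using less[of z] z Suc by simp
          then have "?s (Suc k) z = 0"
            by (rule spec)
          then have "cinner u (\<Sum>w | adj z w. orbit ((hecke ^^ k) v) w) = 0"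
            using avgH_orbit[OF fixed[of k], of z] unfolding avgH_sum
            by (simp add: cinner_scaleR_right)
          then show "(\<Sum>w | adj z w. ?s k w) = 0"
            by (simp add: cinner_sum_right)
          show "?s k w = 0" if "adj z w" "d x\<^sub>0 w < d x\<^sub>0 z" for w
            using less[of w] that z Suc by simp
          show "?s k w = ?s k y" if "adj z w" "d x\<^sub>0 w = Suc (d x\<^sub>0 z)" for w
            using radial[of w y] that z Suc by simp
        qed (use z Suc in auto)
      qed
    qed
  qed
  from spec[OF this, of 0] show ?thesis
    by simp
qed

lemma hecke_scalar: "\<exists>t. \<forall>v\<in>fixed_vectors. hecke v = t *\<^sub>R v"
proof (rule symmetric_contraction_scalar[OF symmetric_contraction_hecke bounded_linear_scaleC[of \<i>]])
  show "scaleC \<i> u \<in> fixed_vectors" if "u \<in> fixed_vectors" for u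
    using that by (auto simp: fixed_vectors_def \<sigma>_scaleC)
  show "scaleC \<i> (hecke u) = hecke (scaleC \<i> u)" for u
    by (simp add: hecke_scaleC)
  fix u v assume uv: "u \<in> fixed_vectors" "v \<in> fixed_vectors"
    "\<And>k. inner u ((hecke ^^ k) v) = 0 \<and> inner (scaleC \<i> u) ((hecke ^^ k) v) = 0"
  then have "cinner u ((hecke ^^ k) v) = 0" for k
    by (simp add: cinner_eq_Complex complex_eq_iff)
  then have orth: "cinner u (orbit v y) = 0" for y
    by (rule orthogonal_to_orbit[OF uv(1,2)])
  have "u = 0" if "v \<noteq> 0"
  proof (rule orthogonal_to_invariant_set)
    show "\<sigma> g w \<in> range (orbit v)" if g: "g \<in> G" and w: "w \<in> range (orbit v)" for g w
      using w orbit_equivariant[OF uv(2) g, symmetric] by auto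
    show "v \<in> range (orbit v)"
      using orbit_base[OF uv(2)] rangeI[of "orbit v" x\<^sub>0] by simp
  qed (use that orth in auto)
  then show "u = 0 \<or> v = 0"
    by blast
qed blast

text \<open>As \<open>F x\<^sub>0 = 0\<close>, this measures how far \<open>F\<close> is from being harmonic at \<open>x\<^sub>0\<close>, and its orbit does so at all
  vertices.\<close>

definition defect :: 'h where "defect = avgH F x\<^sub>0"

lemma defect_fixed: "defect \<in> fixed_vectors"
  unfolding fixed_vectors_def defect_def mem_Collect_eq
  by (metis avgH_F_equivariant add.right_neutral b_stabiliser)

lemma avgH_F: "avgH F y = F y + orbit defect y"
proof -
  have "avgH F y = \<sigma> (to_vertex y) defect + b (to_vertex y)"
    using avgH_F_equivariant[OF to_vertex(1), of y x\<^sub>0] by (simp add: to_vertex(2) defect_def)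
  moreover have "F y = b (to_vertex y)"
    using F_eq[OF to_vertex(1)] by (simp add: to_vertex(2))
  ultimately show ?thesis
    by (simp add: orbit_def)
qed

text \<open>By strict convexity the defect is an invariant vector. Then \<open>F\<close> followed by the inner product with it is
  a homomorphism on the group, which takes the same value on an element that exchanges the two
  ends of an edge as on its inverse. So it vanishes on the neighbours of \<open>x\<^sub>0\<close>.\<close>

lemma defect_zero_if_invariant:
  assumes "hecke defect = defect"
  shows "defect = 0"
proof -
  note fixed = defect_fixed
  have "(\<Sum>y | adj x\<^sub>0 y. (norm (orbit defect y - defect))\<^sup>2) =
      (\<Sum>y | adj x\<^sub>0 y. 2 * (norm defect)\<^sup>2 - 2 * inner (orbit defect y) defect)"
    by (intro sum.cong refl)
       (simp add: power2_norm_eq_inner inner_diff inner_commute norm_orbit[unfolded norm_eq_sqrt_inner, simplified])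
  also have "\<dots> = 2 * (real q + 1) * (norm defect)\<^sup>2 - 2 * inner (\<Sum>y | adj x\<^sub>0 y. orbit defect y) defect"
    by (simp add: sum_subtractf inner_sum_left sum_distrib_left)
  also have "\<dots> = 0"
    using assms unfolding avgH_sum by (simp add: hecke_def[symmetric] power2_norm_eq_inner)
  finally have "\<forall>y\<in>{y. adj x\<^sub>0 y}. (norm (orbit defect y - defect))\<^sup>2 = 0"
    by (subst (asm) sum_nonneg_eq_0_iff) auto
  then have orbit: "orbit defect y = defect" if "adj x\<^sub>0 y" for y
    using that by simp
  have "inner (F y) defect = 0" if "adj x\<^sub>0 y" for y
  proof -
    obtain g where g: "g \<in> G" "g x\<^sub>0 = y" "g y = x\<^sub>0"
      using two_point_homogeneous[of x\<^sub>0 y y x\<^sub>0] gdist_commute by blast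
    have "\<sigma> g (F y) = - F y"
      using F_equivariant[OF g(1), of y] F_eq[OF g(1)] g by (simp add: eq_neg_iff_add_eq_0)
    moreover have "\<sigma> g defect = defect"
      using orbit_eq[OF fixed g(1)] orbit[OF that] g by simp
    ultimately show ?thesis
      using \<sigma>_inner[OF g(1), of "F y" defect] by simp
  qed
  then have "inner defect defect = 0"
    unfolding defect_def[unfolded avgH_def] by (simp add: inner_sum_left defect_def avgH_def)
  then show ?thesis
    by simp
qed

text \<open>If the averaging operator is the scalar \<open>t \<noteq> 1\<close>, then \<open>F\<close> is the sum of a harmonic equivariant map
  and a multiple of the orbit of the defect. The differences of the harmonic map are orthogonal to
  this orbit, which is total if the defect does not vanish. Then the harmonic map is constant, and \<open>F\<close> is
  as bounded as the orbit.\<close>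

lemma defect_zero: "defect = 0"
proof (rule ccontr)
  assume nz: "defect \<noteq> 0"
  note fixed = defect_fixed
  obtain t where t: "\<And>v. v \<in> fixed_vectors \<Longrightarrow> hecke v = t *\<^sub>R v"
    using hecke_scalar by blast
  have "t \<noteq> 1"
    using t[OF fixed] defect_zero_if_invariant nz by auto
  define F' where "F' y = F y + (1 / (1 - t)) *\<^sub>R orbit defect y" for y
  have F'_equiv: "F' (g y) - F' (g z) = \<sigma> g (F' y - F' z)" if "g \<in> G" for g y z
    using that by (simp add: F'_def F_equivariant orbit_equivariant[OF fixed] \<sigma>_add \<sigma>_diff \<sigma>_scaleR algebra_simps)
  have harm: "(\<Sum>y | adj z y. F' y) = (real q + 1) *\<^sub>R F' z" for z
  proof -
    have "(\<Sum>y | adj z y. F' y) = (real q + 1) *\<^sub>R (avgH F z + (1 / (1 - t)) *\<^sub>R avgH (orbit defect) z)"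
      by (simp add: F'_def sum.distrib scaleR_sum_right[symmetric] avgH_sum scaleR_add_right mult.commute)
    also have "avgH F z + (1 / (1 - t)) *\<^sub>R avgH (orbit defect) z =
        F z + (1 + t / (1 - t)) *\<^sub>R orbit defect z"
      by (simp add: avgH_F avgH_orbit[OF fixed] t[OF fixed] orbit_scaleR scaleR_add_left)
    also have "1 + t / (1 - t) = 1 / (1 - t)"
      using \<open>t \<noteq> 1\<close> by (simp add: field_simps)
    finally show ?thesis
      by (simp add: F'_def)
  qed
  have base: "cinner (F' y - F' x\<^sub>0) defect = 0" for y
  proof (rule harmonic_radial_zero[of "\<lambda>y. cinner (F' y - F' x\<^sub>0) defect" x\<^sub>0])
    fix z
    have "(\<Sum>y | adj z y. cinner (F' y - F' x\<^sub>0) defect) = cinner (\<Sum>y | adj z y. F' y - F' x\<^sub>0) defect"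
      by (simp add: cinner_sum_left)
    also have "(\<Sum>y | adj z y. F' y - F' x\<^sub>0) = (real q + 1) *\<^sub>R (F' z - F' x\<^sub>0)"
      by (simp add: sum_subtractf harm sum_constant_scaleR scaleR_diff_right add.commute del: sum_constant)
    finally show "(\<Sum>y | adj z y. cinner (F' y - F' x\<^sub>0) defect) = (real q + 1) *\<^sub>R cinner (F' z - F' x\<^sub>0) defect"
      by (simp add: cinner_scaleR_left)
  next
    fix y z assume "d x\<^sub>0 y = d x\<^sub>0 z"
    then obtain g where g: "g \<in> G" "g x\<^sub>0 = x\<^sub>0" "g y = z"
      using sphere_transitive by blast
    have "cinner (F' y - F' x\<^sub>0) defect = cinner (\<sigma> g (F' y - F' x\<^sub>0)) (\<sigma> g defect)"
      by (simp add: \<sigma>_cinner[OF g(1)])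
    also have "\<dots> = cinner (F' z - F' x\<^sub>0) defect"
      using F'_equiv[OF g(1), of y x\<^sub>0] g fixed by (simp add: fixed_vectors_def)
    finally show "cinner (F' y - F' x\<^sub>0) defect = cinner (F' z - F' x\<^sub>0) defect" .
  qed simp
  have orth: "cinner (F' y - F' z) (orbit defect z) = 0" for y z
  proof -
    let ?t = "to_vertex z"
    have "F' y - F' z = \<sigma> ?t (F' (fun_inv ?t y) - F' x\<^sub>0)"
      using F'_equiv[OF to_vertex(1), of z "fun_inv ?t y" x\<^sub>0] inv_G_apply(2)[OF to_vertex(1)]
      by (simp add: to_vertex(2))
    then show ?thesis
      using base by (simp add: orbit_def \<sigma>_cinner[OF to_vertex(1)])
  qed
  have "F' y - F' x\<^sub>0 = 0" for y
  proof (rule orthogonal_to_invariant_set)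
    show "\<sigma> g w \<in> range (orbit defect)" if g: "g \<in> G" and w: "w \<in> range (orbit defect)" for g w
      using w orbit_equivariant[OF fixed g, symmetric] by auto
    show "defect \<in> range (orbit defect)"
      using orbit_base[OF fixed] rangeI[of "orbit defect" x\<^sub>0] by simp
    show "cinner (F' y - F' x\<^sub>0) w = 0" if w: "w \<in> range (orbit defect)" for w
    proof -
      obtain z where "w = orbit defect z"
        using w by blast
      moreover have "F' y - F' x\<^sub>0 = (F' y - F' z) - (F' x\<^sub>0 - F' z)"
        by simp
      ultimately show ?thesis
        using orth by (simp only: cinner_diff_left) simp
    qed
  qed (rule nz)
  then have F: "F y = F' x\<^sub>0 - (1 / (1 - t)) *\<^sub>R orbit defect y" for y
    by (metis F'_def add_diff_cancel_right' eq_iff_diff_eq_0)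
  have "norm (b g) \<le> norm (F' x\<^sub>0) + \<bar>1 / (1 - t)\<bar> * norm defect" if "g \<in> G" for g
    using norm_triangle_ineq4[of "F' x\<^sub>0" "(1 / (1 - t)) *\<^sub>R orbit defect (g x\<^sub>0)"] F[of "g x\<^sub>0"] F_eq[OF that]
    by (simp add: norm_orbit)
  then show False
    using unbounded unfolding bounded_iff by blast
qed

lemma F_harmonic: "(\<Sum>y | adj x y. F y) = (real q + 1) *\<^sub>R F x"
proof -
  have "orbit defect x = 0"
    unfolding defect_zero orbit_def by (rule \<sigma>_zero[OF to_vertex(1)])
  then show ?thesis
    unfolding avgH_sum avgH_F by simp
qed

end

section \<open>The isomorphism with the kernel of the divergence\<close>

lemma infsum_of_real:
  fixes f :: "'a \<Rightarrow> real"
  assumes "f summable_on A"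
  shows "(\<Sum>\<^sub>\<infinity>x\<in>A. complex_of_real (f x)) = complex_of_real (infsum f A)"
  by (rule infsum_bounded_linear[OF bounded_linear_of_real assms])

context tree_representation
begin

lemma F_unbounded: "\<exists>y. norm (F y) > B"
proof (rule ccontr)
  assume "\<not> ?thesis"
  then have "norm (b g) \<le> B" if "g \<in> G" for g
    using F_eq[OF that] by (metis not_le)
  then show False
    using unbounded unfolding bounded_iff by blast
qed

lemma norm_F_diff_radial:
  assumes "d x y = d x' y'"
  shows "norm (F x - F y) = norm (F x' - F y')"
proof -
  obtain g where g: "g \<in> G" "g x = x'" "g y = y'"
    using two_point_homogeneous[OF assms] by blast
  show ?thesis
    using F_diff_equivariant[OF g(1), of x y] \<sigma>_norm[OF g(1), of "F x - F y"] g by simp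
qed

text \<open>Since \<open>F\<close> is harmonic, its square displacement satisfies the recursion that characterises
  the harmonic profile.\<close>

lemma ex_norm_F_diff: "\<exists>C>0. \<forall>x y. (norm (F x - F y))\<^sup>2 = C * harmonic_profile (d x y)"
proof -
  define \<phi> where "\<phi> n = (norm (F (SOME y. d x\<^sub>0 y = n) - F x\<^sub>0))\<^sup>2" for n
  have \<phi>: "(norm (F y - F x))\<^sup>2 = \<phi> (d x y)" for x y
  proof -
    obtain z where "d x\<^sub>0 z = d x y"
      using ex_beyond by metis
    then have "d x\<^sub>0 (SOME z. d x\<^sub>0 z = d x y) = d x y"
      by (rule someI)
    then have "d y x = d (SOME z. d x\<^sub>0 z = d x y) x\<^sub>0"
      by (simp add: gdist_commute)
    from norm_F_diff_radial[OF this] show ?thesis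
      by (simp add: \<phi>_def)
  qed
  have \<phi>0: "\<phi> 0 = 0"
    using \<phi>[of x\<^sub>0 x\<^sub>0] by simp
  have rec: "radial_avg \<phi> n = \<phi> n + \<phi> 1" for n
  proof -
    obtain x z where xz: "d z x = n"
      by (rule ex_gdist)
    have expand: "(norm (F y - F z))\<^sup>2 = \<phi> n + \<phi> 1 + 2 * inner (F y - F x) (F x - F z)" if "adj x y" for y
    proof -
      have "(norm (u + v))\<^sup>2 = (norm u)\<^sup>2 + (norm v)\<^sup>2 + 2 * inner u v" for u v :: 'h
        unfolding power2_norm_eq_inner by (simp add: inner_add inner_commute)
      from this[of "F y - F x" "F x - F z"]
      have "(norm (F y - F z))\<^sup>2 = (norm (F y - F x))\<^sup>2 + (norm (F x - F z))\<^sup>2 + 2 * inner (F y - F x) (F x - F z)"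
        by simp
      then show ?thesis
        unfolding \<phi> using xz gdist_adj[OF that] by simp
    qed
    have "(real q + 1) * avg (\<lambda>y. \<phi> (d z y)) x = (\<Sum>y | adj x y. (norm (F y - F z))\<^sup>2)"
      unfolding \<phi> using q_ge_2 by (simp add: avg_def)
    also have "\<dots> = (\<Sum>y | adj x y. \<phi> n + \<phi> 1 + 2 * inner (F y - F x) (F x - F z))"
      using expand by (intro sum.cong) auto
    also have "\<dots> = (real q + 1) * (\<phi> n + \<phi> 1) + 2 * inner (\<Sum>y | adj x y. F y - F x) (F x - F z)"
      by (simp add: sum.distrib inner_sum_left sum_distrib_left)
    also have "(\<Sum>y | adj x y. F y - F x) = 0"
      by (simp add: sum_subtractf F_harmonic sum_constant_scaleR add.commute del: sum_constant)
    finally have "(real q + 1) * avg (\<lambda>y. \<phi> (d z y)) x = (real q + 1) * (\<phi> n + \<phi> 1)"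
      by simp
    then show ?thesis
      using xz q_ge_2 by (simp add: avg_radial)
  qed
  define C where "C = \<phi> 1 / harmonic_profile 1"
  have C: "\<phi> n = C * harmonic_profile n" for n
    unfolding C_def by (rule harmonic_recursion_unique[OF \<phi>0 rec])
  have "C \<ge> 0"
  proof -
    obtain x y where "d x y = 1"
      by (rule ex_gdist)
    then have "\<phi> 1 \<ge> 0"
      using \<phi>[of y x] zero_le_power2[of "norm (F y - F x)"] by simp
    then show ?thesis
      using harmonic_profile_1_pos by (simp add: C_def)
  qed
  moreover have "C \<noteq> 0"
  proof
    assume "C = 0"
    then have "norm (F y) = 0" for y
      using \<phi>[of y x\<^sub>0] C[of "d x\<^sub>0 y"] by simp
    then show False
      using F_unbounded[of 0] by simp
  qed
  moreover have "(norm (F x - F y))\<^sup>2 = C * harmonic_profile (d x y)" for x y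
    using \<phi>[of x y] C[of "d x y"] gdist_commute[of x y] by (simp add: norm_minus_commute)
  ultimately show ?thesis
    by (intro exI[of _ C]) auto
qed

definition gram_scale :: real where
  "gram_scale = (SOME C. C > 0 \<and> (\<forall>x y. (norm (F x - F y))\<^sup>2 = C * harmonic_profile (d x y)))"

lemma gram_scale_pos: "gram_scale > 0"
  and norm_F_diff: "(norm (F x - F y))\<^sup>2 = gram_scale * harmonic_profile (d x y)"
  using someI_ex[OF ex_norm_F_diff] unfolding gram_scale_def[symmetric] by auto

text \<open>Polarisation of \<open>norm_F_diff\<close>, which gives the real parts of the Gram matrix.\<close>

lemma inner_F:
  "inner (F y - F x) (F v - F u) = gram_scale * (harmonic_potential x y v - harmonic_potential x y u)"
proof -
  have "2 * inner (F y - F x) (F v - F u) =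
      (norm (F y - F u))\<^sup>2 + (norm (F x - F v))\<^sup>2 - (norm (F y - F v))\<^sup>2 - (norm (F x - F u))\<^sup>2"
    unfolding power2_norm_eq_inner by (simp add: inner_diff inner_commute)
  then show ?thesis
    unfolding norm_F_diff by (simp add: harmonic_potential_def field_simps)
qed

text \<open>The imaginary part is a harmonic function of \<open>w\<close> that is zero at \<open>x\<close> and \<open>y\<close>. On the half-tree beyond
  the edge it only depends on the distance to the edge, because the stabiliser of \<open>x\<close> is transitive
  on the vertices at a given distance there and fixes \<open>y\<close> when it moves one of them to another.\<close>

lemma inner_i_F_half:
  assumes xy: "adj x y" and w: "between x y w"
  shows "inner (scaleC \<i> (F y - F x)) (F w - F x) = 0"
proof (rule harmonic_half_tree_zero[OF _ xy _ _ _ w])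
  let ?f = "\<lambda>w. inner (scaleC \<i> (F y - F x)) (F w - F x)"
  show "(\<Sum>w | adj z w. ?f w) = (real q + 1) *\<^sub>R ?f z" for z
  proof -
    have "(\<Sum>w | adj z w. ?f w) = inner (scaleC \<i> (F y - F x)) (\<Sum>w | adj z w. F w - F x)"
      by (simp add: inner_sum_right)
    also have "(\<Sum>w | adj z w. F w - F x) = (real q + 1) *\<^sub>R (F z - F x)"
      by (simp add: sum_subtractf F_harmonic sum_constant_scaleR scaleR_diff_right add.commute del: sum_constant)
    finally show ?thesis
      by simp
  qed
  show "?f y = 0"
    using Im_cinner[of "F y - F x" "F y - F x"] by (simp add: cinner_self)
  show "?f v = ?f v'" if v: "between x y v" "between x y v'" "d x v = d x v'" for v v'
  proof -
    obtain g where g: "g \<in> G" "g x = x" "g v = v'"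
      using sphere_transitive[OF v(3)] by blast
    have "g y = y"
      using between_unique[of x "g y" v' y] between_G[OF g(1), of x y v] gdist_G[OF g(1), of x y] v
      unfolding g(2,3) by blast
    have "?f v = inner (\<sigma> g (scaleC \<i> (F y - F x))) (\<sigma> g (F v - F x))"
      by (simp add: \<sigma>_inner[OF g(1)])
    also have "\<dots> = inner (scaleC \<i> (F (g y) - F (g x))) (F (g v) - F (g x))"
      by (simp only: F_diff_equivariant[OF g(1)] \<sigma>_scaleC[OF g(1)])
    finally show ?thesis
      by (simp only: g \<open>g y = y\<close>)
  qed
qed simp

lemma inner_i_F:
  assumes xy: "adj x y"
  shows "inner (scaleC \<i> (F y - F x)) (F v - F u) = 0"
proof -
  let ?f = "\<lambda>w. inner (scaleC \<i> (F y - F x)) (F w - F x)"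
  have fy: "?f y = 0"
    using Im_cinner[of "F y - F x" "F y - F x"] by (simp add: cinner_self)
  have "?f w = 0" for w
  proof (cases "d x w = Suc (d y w)")
    case True
    then show ?thesis
      using inner_i_F_half[OF xy, of w] gdist_adj[OF xy] by (simp add: between_def)
  next
    case False
    have yx: "adj y x"
      using xy adj_sym by blast
    have "d y w = Suc (d x w)"
      using gdist_adj_cases[OF xy, of w] False gdist_commute[of w x] gdist_commute[of w y] by simp
    then have "between y x w"
      using gdist_adj[OF yx] by (simp add: between_def)
    then have "inner (scaleC \<i> (F x - F y)) (F w - F y) = 0"
      by (rule inner_i_F_half[OF yx])
    moreover have "scaleC \<i> (F x - F y) = - scaleC \<i> (F y - F x)"
      using scaleC_scaleR_commute[of \<i> "- 1" "F y - F x"] by simp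
    ultimately have "inner (scaleC \<i> (F y - F x)) (F w - F y) = 0"
      by simp
    moreover have "F w - F x = (F w - F y) + (F y - F x)"
      by simp
    ultimately show ?thesis
      using fy by (simp only: inner_add_right)
  qed
  from this[of v] this[of u] show ?thesis
    by (simp add: inner_diff_right)
qed

definition dF :: "'v \<times> 'v \<Rightarrow> 'h" where "dF e = F (snd e) - F (fst e)"

lemma cinner_dF:
  assumes "e \<in> edges"
  shows "cinner (dF e) (F v - F u) =
    complex_of_real (gram_scale * (harmonic_potential (fst e) (snd e) v - harmonic_potential (fst e) (snd e) u))"
  using inner_i_F[of "fst e" "snd e" v u] inner_F[of "snd e" "fst e" v u] assms
  by (auto simp: cinner_eq_Complex dF_def complex_eq_iff)

lemma harmonic_potential_swap:
  "harmonic_potential x y v - harmonic_potential x y u = harmonic_potential u v y - harmonic_potential u v x"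
  by (simp add: harmonic_potential_def gdist_commute[of x] gdist_commute[of y] field_simps)

lemma cinner_F_dF:
  assumes "e \<in> edges"
  shows "cinner (F y - F x) (dF e) = complex_of_real (gram_scale * chi_harmonic x y e)"
proof -
  have "cinner (F y - F x) (dF e) = cnj (cinner (dF e) (F y - F x))"
    by (rule cinner_commute)
  also have "\<dots> = complex_of_real (gram_scale *
      (harmonic_potential (fst e) (snd e) y - harmonic_potential (fst e) (snd e) x))"
    by (simp add: cinner_dF[OF assms])
  also have "harmonic_potential (fst e) (snd e) y - harmonic_potential (fst e) (snd e) x = chi_harmonic x y e"
    using assms unfolding harmonic_potential_swap[of "fst e" "snd e" y x]
    by (auto simp: chi_harmonic_def grad_def)
  finally show ?thesis .
qed

lemma dF_G: "g \<in> G \<Longrightarrow> dF (g x, g y) = \<sigma> g (dF (x, y))"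
  by (simp add: dF_def F_diff_equivariant)

text \<open>The vectors \<open>dF e\<close> are total because their span is invariant.\<close>

lemma orthogonal_to_dF:
  assumes "\<And>e. e \<in> edges \<Longrightarrow> cinner h (dF e) = 0"
  shows "h = 0"
proof -
  obtain x y where xy: "d x y = 1"
    by (rule ex_gdist)
  then have e: "(x, y) \<in> edges"
    by (simp add: adj_iff_gdist)
  show ?thesis
  proof (rule orthogonal_to_invariant_set[of "dF ` edges" "dF (x, y)"])
    show "\<sigma> g v \<in> dF ` edges" if g: "g \<in> G" and v: "v \<in> dF ` edges" for g v
    proof -
      obtain x y where "adj x y" "v = dF (x, y)"
        using v by auto
      then have "\<sigma> g v = dF (g x, g y)" "(g x, g y) \<in> edges"
        using g adj_G[OF g] by (auto simp: dF_G)
      then show ?thesis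
        by blast
    qed
    show "dF (x, y) \<in> dF ` edges"
      using e by blast
    have "(norm (F x - F y))\<^sup>2 > 0"
      unfolding norm_F_diff xy using gram_scale_pos harmonic_profile_1_pos by simp
    then show "dF (x, y) \<noteq> 0"
      by (auto simp: dF_def)
  qed (use assms in auto)
qed

text \<open>The Bessel inequality for the harmonic components of edges, transported by the equality of Gram
  matrices up to scaling.\<close>

lemma norm_sum_dF:
  assumes "finite A" "A \<subseteq> edges"
  shows "(norm (\<Sum>e\<in>A. a e *\<^sub>R dF e))\<^sup>2 \<le> 2 * gram_scale * (\<Sum>e\<in>A. (a e)\<^sup>2)"
proof -
  have "(norm (\<Sum>e\<in>A. a e *\<^sub>R dF e))\<^sup>2 = (\<Sum>e\<in>A. \<Sum>e'\<in>A. a e * a e' * inner (dF e') (dF e))"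
    by (simp add: power2_norm_eq_inner inner_sum_left inner_sum_right sum_distrib_left
        inner_commute mult_ac)
  also have "\<dots> = gram_scale * (\<Sum>e\<in>A. \<Sum>e'\<in>A. a e * a e' * (harmonic_potential (fst e') (snd e') (snd e)
    - harmonic_potential (fst e') (snd e') (fst e)))"
    unfolding dF_def inner_F by (simp add: sum_distrib_left mult_ac)
  also have "\<dots> \<le> gram_scale * (2 * (\<Sum>e\<in>A. (a e)\<^sup>2))"
    using edge_chain_bound[OF assms] gram_scale_pos by (intro mult_left_mono) auto
  finally show ?thesis
    by simp
qed

lemma summable_dF: assumes "\<xi> \<in> l2alt adj" shows "(\<lambda>e. \<xi> e *\<^sub>R dF e) summable_on edges"
  by (rule summable_on_if_square_bound[OF l2alt_summable[OF assms]])
     (use norm_sum_dF in auto)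

text \<open>The vectors \<open>dF e\<close> and the harmonic components of the edges have proportional Gram
  matrices, and both are tight frames. So the isomorphism is the synthesis operator of the
  first frame.\<close>

definition synth :: "('v \<times> 'v \<Rightarrow> real) \<Rightarrow> 'h" where
  "synth \<xi> = (1 / (2 * sqrt gram_scale)) *\<^sub>R (\<Sum>\<^sub>\<infinity>e\<in>edges. \<xi> e *\<^sub>R dF e)"

lemma synth_add:
  assumes "\<xi> \<in> l2alt adj" "\<eta> \<in> l2alt adj"
  shows "synth (\<lambda>e. \<xi> e + \<eta> e) = synth \<xi> + synth \<eta>"
  using infsum_add[OF summable_dF[OF assms(1)] summable_dF[OF assms(2)]]
  by (simp add: synth_def scaleR_add_left scaleR_add_right)

lemma synth_scale: "synth (\<lambda>e. a * \<xi> e) = a *\<^sub>R synth \<xi>"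
  unfolding synth_def scaleR_scaleR[symmetric, of a] infsum_scaleR_right
  by (simp add: mult.commute)

text \<open>Up to a factor, the left-hand side is the inner product of \<open>\<xi>\<close> with the harmonic component of the
  edge, which is its inner product with the edge itself.\<close>

lemma cinner_synth_dF:
  assumes \<xi>: "\<xi> \<in> ker_grad_adj adj" and e: "e \<in> edges"
  shows "cinner (synth \<xi>) (dF e) = complex_of_real (sqrt gram_scale * \<xi> e)"
proof -
  obtain x y where xy: "e = (x, y)" "adj x y"
    using e by auto
  have l2: "\<xi> \<in> l2alt adj"
    using \<xi> by (simp add: ker_grad_adj_def)
  have "alt_inner adj \<xi> (chi adj x y) =
      alt_inner adj \<xi> (chi_harmonic x y) + alt_inner adj \<xi> (grad adj (l2_potential x y))"
    using alt_inner_add_right[OF l2 chi_harmonic_l2alt grad_l2alt[OF l2_potential_l2V], of x y x y]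
    by (simp add: chi_decomposition[abs_def])
  then have inner: "alt_inner adj \<xi> (chi_harmonic x y) = \<xi> e"
    using alt_inner_chi_edge[OF l2 xy(2)] alt_inner_grad[OF \<xi> l2_potential_l2V] xy by simp
  have gram: "cinner (\<xi> e' *\<^sub>R dF e') (dF e) = complex_of_real (gram_scale * (\<xi> e' * chi_harmonic x y e'))"
    if e': "e' \<in> edges" for e'
  proof -
    have "cinner (dF e') (dF e) = cnj (cinner (dF e) (dF e'))"
      by (rule cinner_commute)
    also have "cinner (dF e) (dF e') = complex_of_real (gram_scale * chi_harmonic x y e')"
      using cinner_F_dF[OF e', of y x] by (simp add: dF_def xy)
    finally show ?thesis
      by (simp add: cinner_scaleR_left scaleR_conv_of_real mult_ac)
  qed
  have "cinner (\<Sum>\<^sub>\<infinity>e'\<in>edges. \<xi> e' *\<^sub>R dF e') (dF e) = (\<Sum>\<^sub>\<infinity>e'\<in>edges. cinner (\<xi> e' *\<^sub>R dF e') (dF e))"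
    by (rule infsum_bounded_linear[OF bounded_linear_cinner_left summable_dF[OF l2], symmetric])
  also have "\<dots> = (\<Sum>\<^sub>\<infinity>e'\<in>edges. complex_of_real (gram_scale * (\<xi> e' * chi_harmonic x y e')))"
    by (rule infsum_cong[OF gram])
  also have "\<dots> = complex_of_real (\<Sum>\<^sub>\<infinity>e'\<in>edges. gram_scale * (\<xi> e' * chi_harmonic x y e'))"
    by (intro infsum_of_real summable_on_cmult_right alt_inner_summable l2 chi_harmonic_l2alt)
  also have "(\<Sum>\<^sub>\<infinity>e'\<in>edges. gram_scale * (\<xi> e' * chi_harmonic x y e')) = gram_scale * (2 * \<xi> e)"
    using inner by (simp add: alt_inner_def infsum_cmult_right')
  finally have "cinner (synth \<xi>) (dF e) = (1 / (2 * sqrt gram_scale)) *\<^sub>R complex_of_real (gram_scale * (2 * \<xi> e))"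
    unfolding synth_def cinner_scaleR_left by (rule arg_cong)
  also have "\<dots> = complex_of_real (1 / (2 * sqrt gram_scale) * (gram_scale * (2 * \<xi> e)))"
    by (simp only: scaleR_conv_of_real of_real_mult)
  also have "1 / (2 * sqrt gram_scale) * (gram_scale * (2 * \<xi> e)) = (gram_scale / sqrt gram_scale) * \<xi> e"
    by simp
  also have "gram_scale / sqrt gram_scale = sqrt gram_scale"
    using gram_scale_pos by (simp add: real_div_sqrt)
  finally show ?thesis .
qed

lemma cinner_synth:
  assumes \<xi>: "\<xi> \<in> ker_grad_adj adj" and \<eta>: "\<eta> \<in> ker_grad_adj adj"
  shows "cinner (synth \<xi>) (synth \<eta>) = complex_of_real (alt_inner adj \<xi> \<eta>)"
proof -
  have l2: "\<xi> \<in> l2alt adj" "\<eta> \<in> l2alt adj"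
    using \<xi> \<eta> by (auto simp: ker_grad_adj_def)
  have "cinner (synth \<xi>) (\<Sum>\<^sub>\<infinity>e\<in>edges. \<eta> e *\<^sub>R dF e) = (\<Sum>\<^sub>\<infinity>e\<in>edges. cinner (synth \<xi>) (\<eta> e *\<^sub>R dF e))"
    by (rule infsum_bounded_linear[OF bounded_linear_cinner_right summable_dF[OF l2(2)], symmetric])
  also have "\<dots> = (\<Sum>\<^sub>\<infinity>e\<in>edges. complex_of_real (sqrt gram_scale * (\<xi> e * \<eta> e)))"
    by (rule infsum_cong)
       (simp add: cinner_scaleR_right cinner_synth_dF[OF \<xi>] scaleR_conv_of_real mult_ac)
  also have "\<dots> = complex_of_real (\<Sum>\<^sub>\<infinity>e\<in>edges. sqrt gram_scale * (\<xi> e * \<eta> e))"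
    by (intro infsum_of_real summable_on_cmult_right alt_inner_summable l2)
  also have "(\<Sum>\<^sub>\<infinity>e\<in>edges. sqrt gram_scale * (\<xi> e * \<eta> e)) = sqrt gram_scale * (2 * alt_inner adj \<xi> \<eta>)"
    by (simp add: alt_inner_def infsum_cmult_right')
  finally have "cinner (synth \<xi>) (\<Sum>\<^sub>\<infinity>e\<in>edges. \<eta> e *\<^sub>R dF e) = complex_of_real (sqrt gram_scale * (2 * alt_inner adj \<xi> \<eta>))" .
  then show ?thesis
    using gram_scale_pos by (subst (2) synth_def) (simp add: cinner_scaleR_right scaleR_conv_of_real)
qed

lemma synth_edge_action:
  assumes g: "g \<in> G" and \<xi>: "\<xi> \<in> l2alt adj"
  shows "synth (edge_action g \<xi>) = \<sigma> g (synth \<xi>)"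
proof -
  have "(\<Sum>\<^sub>\<infinity>e\<in>edges. edge_action g \<xi> e *\<^sub>R dF e) = (\<Sum>\<^sub>\<infinity>e\<in>edges. \<sigma> g (\<xi> e *\<^sub>R dF e))"
  proof (rule infsum_reindex_bij_witness[of _ "map_prod g g" "map_prod (fun_inv g) (fun_inv g)"])
    fix e assume "e \<in> edges"
    then obtain x y where e: "e = (x, y)"
      by auto
    have "\<sigma> g (dF (fun_inv g x, fun_inv g y)) = dF (x, y)"
      using dF_G[OF g, of "fun_inv g x" "fun_inv g y"] g by simp
    then show "\<sigma> g (\<xi> (map_prod (fun_inv g) (fun_inv g) e) *\<^sub>R dF (map_prod (fun_inv g) (fun_inv g) e)) =
        edge_action g \<xi> e *\<^sub>R dF e"
      by (simp add: e edge_action_def \<sigma>_scaleR[OF g])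
  qed (use g adj_G[OF g] adj_G[OF inv_G[OF g]] in auto)
  also have "\<dots> = \<sigma> g (\<Sum>\<^sub>\<infinity>e\<in>edges. \<xi> e *\<^sub>R dF e)"
    by (rule infsum_bounded_linear[OF \<sigma>_bounded_linear[OF g] summable_dF[OF \<xi>]])
  finally show ?thesis
    by (simp add: synth_def \<sigma>_scaleR[OF g])
qed

lemma synth_chi_harmonic: "synth (chi_harmonic x y) = (1 / sqrt gram_scale) *\<^sub>R (F y - F x)"
proof -
  have "synth (chi_harmonic x y) - (1 / sqrt gram_scale) *\<^sub>R (F y - F x) = 0"
  proof (rule orthogonal_to_dF)
    fix e :: "'v \<times> 'v" assume e: "e \<in> edges"
    have "cinner ((1 / sqrt gram_scale) *\<^sub>R (F y - F x)) (dF e) =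
        complex_of_real (1 / sqrt gram_scale * (gram_scale * chi_harmonic x y e))"
      by (simp only: cinner_scaleR_left cinner_F_dF[OF e] scaleR_conv_of_real of_real_mult)
    also have "1 / sqrt gram_scale * (gram_scale * chi_harmonic x y e) = (gram_scale / sqrt gram_scale) * chi_harmonic x y e"
      by simp
    also have "gram_scale / sqrt gram_scale = sqrt gram_scale"
      using gram_scale_pos by (simp add: real_div_sqrt)
    finally show "cinner (synth (chi_harmonic x y) - (1 / sqrt gram_scale) *\<^sub>R (F y - F x)) (dF e) = 0"
      by (simp only: cinner_diff_left[of "synth _"] cinner_synth_dF[OF chi_harmonic_ker e] diff_self)
  qed
  then show ?thesis
    by simp
qed

text \<open>The analysis operator of the frame, for real parts.\<close>

definition coeffs :: "'h \<Rightarrow> 'v \<times> 'v \<Rightarrow> real" where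
  "coeffs h e = (if e \<in> edges then inner h (dF e) else 0)"

text \<open>Square summability is dual to the Bessel inequality for \<open>dF\<close>; the divergence vanishes because \<open>F\<close> is
  harmonic.\<close>

lemma coeffs_ker: "coeffs h \<in> ker_grad_adj adj"
proof -
  have bound: "(\<Sum>e\<in>A. (coeffs h e)\<^sup>2) \<le> 2 * gram_scale * (norm h)\<^sup>2" if A: "finite A" "A \<subseteq> edges" for A
  proof -
    let ?S = "\<Sum>e\<in>A. (coeffs h e)\<^sup>2"
    let ?v = "\<Sum>e\<in>A. coeffs h e *\<^sub>R dF e"
    have S0: "?S \<ge> 0"
      by (intro sum_nonneg) auto
    have "?S = inner h ?v"
      unfolding inner_sum_right
      using A by (intro sum.cong) (auto simp: coeffs_def power2_eq_square)
    also have "\<dots> \<le> norm h * norm ?v"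
      by (rule norm_cauchy_schwarz)
    finally have "?S\<^sup>2 \<le> (norm h * norm ?v)\<^sup>2"
      using S0 by (intro power_mono) auto
    also have "\<dots> \<le> (norm h)\<^sup>2 * (2 * gram_scale * ?S)"
      unfolding power_mult_distrib using norm_sum_dF[OF A] by (intro mult_left_mono) auto
    finally have "?S * ?S \<le> (2 * gram_scale * (norm h)\<^sup>2) * ?S"
      by (simp add: power2_eq_square mult_ac)
    then show ?thesis
      using S0 gram_scale_pos by (cases "?S = 0") (auto simp: mult_le_cancel_right)
  qed
  have "(\<lambda>e. (coeffs h e)\<^sup>2) summable_on edges"
  proof (rule nonneg_bdd_above_summable_on)
    show "bdd_above (sum (\<lambda>e. (coeffs h e)\<^sup>2) ` {F. F \<subseteq> edges \<and> finite F})"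
      by (rule bdd_aboveI2[of _ _ "2 * gram_scale * (norm h)\<^sup>2"]) (use bound in simp)
  qed simp
  moreover have "coeffs h (y, x) = - coeffs h (x, y)" if "adj x y" for x y
    using that adj_sym[of x y] by (simp add: coeffs_def dF_def inner_diff)
  ultimately have "coeffs h \<in> l2alt adj"
    by (simp add: l2alt_def coeffs_def)
  moreover have "grad_adj adj (coeffs h) x = 0" for x
  proof -
    have "(\<Sum>y | adj x y. coeffs h (y, x)) = (\<Sum>y | adj x y. inner h (F x - F y))"
      using adj_sym by (intro sum.cong) (auto simp: coeffs_def dF_def)
    also have "\<dots> = inner h (\<Sum>y | adj x y. F x - F y)"
      by (simp add: inner_sum_right)
    also have "(\<Sum>y | adj x y. F x - F y) = 0"
      by (simp add: sum_subtractf F_harmonic sum_constant_scaleR add.commute del: sum_constant)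
    finally show ?thesis
      by (simp add: grad_adj_def)
  qed
  ultimately show ?thesis
    by (simp add: ker_grad_adj_def)
qed

lemma ker_grad_adj_scale: "\<xi> \<in> ker_grad_adj adj \<Longrightarrow> (\<lambda>e. c * \<xi> e) \<in> ker_grad_adj adj"
  by (auto simp: ker_grad_adj_def l2alt_scale grad_adj_def sum_distrib_left[symmetric])

lemma synth_surj:
  "\<exists>\<xi>\<in>ker_grad_adj adj. \<exists>\<eta>\<in>ker_grad_adj adj. h = synth \<xi> + scaleC \<i> (synth \<eta>)"
proof -
  let ?c = "1 / sqrt gram_scale"
  let ?\<xi> = "\<lambda>e. ?c * coeffs h e" and ?\<eta> = "\<lambda>e. ?c * coeffs (- scaleC \<i> h) e"
  have ker: "?\<xi> \<in> ker_grad_adj adj" "?\<eta> \<in> ker_grad_adj adj"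
    by (intro ker_grad_adj_scale coeffs_ker)+
  have "h - (synth ?\<xi> + scaleC \<i> (synth ?\<eta>)) = 0"
  proof (rule orthogonal_to_dF)
    fix e :: "'v \<times> 'v" assume e: "e \<in> edges"
    have "cinner (synth ?\<xi> + scaleC \<i> (synth ?\<eta>)) (dF e) =
        complex_of_real (coeffs h e) + \<i> * complex_of_real (coeffs (- scaleC \<i> h) e)"
    proof -
      have "sqrt gram_scale * (?c * a) = a" for a
        using gram_scale_pos by simp
      then show ?thesis
        by (simp only: cinner_add_left cinner_scaleC_left cinner_synth_dF[OF ker(1) e] cinner_synth_dF[OF ker(2) e])
    qed
    also have "\<dots> = cinner h (dF e)"
      using e by (simp add: coeffs_def cinner_eq_Complex complex_eq_iff)
    finally show "cinner (h - (synth ?\<xi> + scaleC \<i> (synth ?\<eta>))) (dF e) = 0"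
      by (simp add: cinner_diff_left)
  qed
  then show ?thesis
    using ker by (intro bexI[of _ ?\<xi>] bexI[of _ ?\<eta>]) auto
qed

lemma complexification_iso_synth: "complexification_iso (alt_inner adj) (ker_grad_adj adj) synth"
  unfolding complexification_iso_def
  using synth_add synth_scale cinner_synth synth_surj by (auto simp: ker_grad_adj_def)

lemma synth_b_tilde: "g \<in> G \<Longrightarrow> synth (b_tilde adj x\<^sub>0 g) = scaleC (complex_of_real (1 / sqrt gram_scale)) (F (g x\<^sub>0))"
  unfolding b_tilde_eq synth_chi_harmonic scaleC_of_real by simp

lemma representation_conclusion:
  "harmonic q adj F \<and> (\<exists>x y. F x \<noteq> F y) \<and>
    (\<forall>g\<in>G. \<forall>x. F (g x) = \<sigma> g (F x) + b g) \<and>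
    (\<exists>U c. complexification_iso (alt_inner adj) (ker_grad_adj adj) U \<and>
       (\<forall>g\<in>G. \<forall>\<xi>\<in>ker_grad_adj adj. U (edge_action g \<xi>) = \<sigma> g (U \<xi>)) \<and>
       c \<noteq> 0 \<and> (\<forall>g\<in>G. U (b_tilde adj x\<^sub>0 g) = scaleC c (F (g x\<^sub>0))))"
proof (intro conjI)
  show "harmonic q adj F"
    using q_ge_2 by (simp add: harmonic_def F_harmonic)
  obtain y where "norm (F y) > 0"
    using F_unbounded by blast
  then have "F y \<noteq> F x\<^sub>0"
    by simp
  then show "\<exists>x y. F x \<noteq> F y"
    by blast
  show "\<forall>g\<in>G. \<forall>x. F (g x) = \<sigma> g (F x) + b g"
    using F_equivariant by blast
  have "\<forall>g\<in>G. \<forall>\<xi>\<in>ker_grad_adj adj. synth (edge_action g \<xi>) = \<sigma> g (synth \<xi>)"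
    using synth_edge_action by (simp add: ker_grad_adj_def)
  moreover have "complex_of_real (1 / sqrt gram_scale) \<noteq> 0"
    using gram_scale_pos by simp
  moreover have "\<forall>g\<in>G. synth (b_tilde adj x\<^sub>0 g) = scaleC (complex_of_real (1 / sqrt gram_scale)) (F (g x\<^sub>0))"
    using synth_b_tilde by blast
  ultimately show "\<exists>U c. complexification_iso (alt_inner adj) (ker_grad_adj adj) U \<and>
       (\<forall>g\<in>G. \<forall>\<xi>\<in>ker_grad_adj adj. U (edge_action g \<xi>) = \<sigma> g (U \<xi>)) \<and>
       c \<noteq> 0 \<and> (\<forall>g\<in>G. U (b_tilde adj x\<^sub>0 g) = scaleC c (F (g x\<^sub>0)))"
    using complexification_iso_synth by blast
qed

end

theorem corollary5p2:
  fixes q :: nat and adj :: "'v \<Rightarrow> 'v \<Rightarrow> bool"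
  assumes "q \<ge> 2" and "regular_tree (q + 1) adj"
  shows
    "cond_neg_type_kernel UNIV (tree_kernel q adj) \<and>
     (\<forall>(G :: ('v \<Rightarrow> 'v) set) (x\<^sub>0 :: 'v).
        subgroup G (aut_group adj) \<and> closedin (aut_topology adj) G \<and>
        \<not> compactin (aut_topology adj) G \<and>
        vertex_transitive G \<and> boundary_transitive adj G \<longrightarrow>
        (let \<G> = (aut_group adj)\<lparr>carrier := G\<rparr>;
             X = subtopology (aut_topology adj) G;
             K = {g \<in> G. g x\<^sub>0 = x\<^sub>0};
             \<psi>\<^sub>0 = (\<lambda>g. tree_kernel q adj (g x\<^sub>0) x\<^sub>0);
             unbounded_pure = (\<lambda>\<psi>. pure \<G> X \<psi> \<and> \<not> bounded (\<psi> ` G) \<and> (\<forall>g\<in>K. \<psi> g = 0))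
         in
           (\<forall>g\<in>G. \<psi>\<^sub>0 g = real (gdist adj x\<^sub>0 (g x\<^sub>0)) +
              2 * real q / ((real q)\<^sup>2 - 1) * (real q powi (- int (gdist adj x\<^sub>0 (g x\<^sub>0))) - 1)) \<and>
           unbounded_pure \<psi>\<^sub>0 \<and>
           (\<forall>\<psi>. unbounded_pure \<psi> \<longrightarrow> (\<exists>c>0. \<forall>g\<in>G. \<psi> g = c * \<psi>\<^sub>0 g)) \<and>
           (\<forall>g\<in>G. b_tilde adj x\<^sub>0 g \<in> ker_grad_adj adj) \<and>
           (\<forall>g\<in>G. \<forall>h\<in>G. b_tilde adj x\<^sub>0 (g \<circ> h) =
              (\<lambda>e. edge_action g (b_tilde adj x\<^sub>0 h) e + b_tilde adj x\<^sub>0 g e)) \<and>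
           (\<forall>(\<sigma> :: ('v \<Rightarrow> 'v) \<Rightarrow> 'h::chilbert_space \<Rightarrow> 'h) b F.
              unitary_rep \<G> X \<sigma> \<and> irreducible_rep \<G> \<sigma> \<and>
              H1 \<G> X \<sigma> \<noteq> {coboundaries \<G> X \<sigma>} \<and>
              b \<in> cocycles \<G> X \<sigma> \<and> \<not> bounded (b ` G) \<and> (\<forall>g\<in>K. b g = 0) \<and>
              (\<forall>g\<in>G. F (g x\<^sub>0) = b g) \<longrightarrow>
                harmonic q adj F \<and> (\<exists>x y. F x \<noteq> F y) \<and>
                (\<forall>g\<in>G. \<forall>x. F (g x) = \<sigma> g (F x) + b g) \<and>
                (\<exists>U c. complexification_iso (alt_inner adj) (ker_grad_adj adj) U \<and>
                   (\<forall>g\<in>G. \<forall>\<xi>\<in>ker_grad_adj adj. U (edge_action g \<xi>) = \<sigma> g (U \<xi>)) \<and>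
                   c \<noteq> 0 \<and> (\<forall>g\<in>G. U (b_tilde adj x\<^sub>0 g) = scaleC c (F (g x\<^sub>0)))))))"
proof (intro conjI allI impI, goal_cases)
  interpret regular_tree_graph q adj
    using assms by (rule regular_tree_graph.intro)
  have kernel: "tree_kernel q adj = (\<lambda>x y. harmonic_profile (gdist adj x y))"
    by (intro ext tree_kernel_eq)
  case 1
  show ?case
    using radial_neg_type_harmonic_profile unfolding kernel radial_neg_type_def .
  case (2 G x\<^sub>0)
  interpret tree_action q adj G
    using 2 by (intro tree_action.intro tree_action_axioms.intro regular_tree_graph_axioms) auto
  define \<psi>\<^sub>0 where "\<psi>\<^sub>0 = (\<lambda>g :: 'v \<Rightarrow> 'v. tree_kernel q adj (g x\<^sub>0) x\<^sub>0)"
  have \<psi>\<^sub>0: "\<psi>\<^sub>0 = (\<lambda>g. harmonic_profile (gdist adj x\<^sub>0 (g x\<^sub>0)))"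
    unfolding \<psi>\<^sub>0_def kernel by (simp add: gdist_commute)
  have formula: "\<forall>g\<in>G. \<psi>\<^sub>0 g = real (gdist adj x\<^sub>0 (g x\<^sub>0)) +
      2 * real q / ((real q)\<^sup>2 - 1) * (real q powi (- int (gdist adj x\<^sub>0 (g x\<^sub>0))) - 1)"
    unfolding \<psi>\<^sub>0_def tree_kernel_def by (simp add: gdist_commute[of _ x\<^sub>0] right_diff_distrib)
  have pure: "pure GG GX \<psi>\<^sub>0 \<and> \<not> bounded (\<psi>\<^sub>0 ` G) \<and> (\<forall>g\<in>{g \<in> G. g x\<^sub>0 = x\<^sub>0}. \<psi>\<^sub>0 g = 0)"
    unfolding \<psi>\<^sub>0 using pure_harmonic_profile unbounded_harmonic_profile by simp
  have unique: "\<forall>\<psi>. pure GG GX \<psi> \<and> \<not> bounded (\<psi> ` G) \<and> (\<forall>g\<in>{g \<in> G. g x\<^sub>0 = x\<^sub>0}. \<psi> g = 0) \<longrightarrow>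
      (\<exists>c>0. \<forall>g\<in>G. \<psi> g = c * \<psi>\<^sub>0 g)"
  proof (intro allI impI)
    fix \<psi> assume "pure GG GX \<psi> \<and> \<not> bounded (\<psi> ` G) \<and> (\<forall>g\<in>{g \<in> G. g x\<^sub>0 = x\<^sub>0}. \<psi> g = 0)"
    then obtain c where "c > 0" "\<And>g. g \<in> G \<Longrightarrow> \<psi> g = c * harmonic_profile (gdist adj x\<^sub>0 (g x\<^sub>0))"
      using pure_unique[of \<psi> x\<^sub>0] by blast
    then show "\<exists>c>0. \<forall>g\<in>G. \<psi> g = c * \<psi>\<^sub>0 g"
      unfolding \<psi>\<^sub>0 by blast
  qed
  have ker: "\<forall>g\<in>G. b_tilde adj x\<^sub>0 g \<in> ker_grad_adj adj"
    by (simp add: b_tilde_eq chi_harmonic_ker)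
  have cocycle: "\<forall>g\<in>G. \<forall>h\<in>G. b_tilde adj x\<^sub>0 (g \<circ> h) =
      (\<lambda>e. edge_action g (b_tilde adj x\<^sub>0 h) e + b_tilde adj x\<^sub>0 g e)"
    using b_tilde_cocycle by blast
  show ?case
    unfolding Let_def
  proof (rule conjI[OF formula[unfolded \<psi>\<^sub>0_def] conjI[OF pure[unfolded \<psi>\<^sub>0_def]
          conjI[OF unique[unfolded \<psi>\<^sub>0_def] conjI[OF ker conjI[OF cocycle]]]]],
      intro allI impI, goal_cases)
    case (1 \<sigma> b F)
    interpret tree_representation q adj G x\<^sub>0 \<sigma> b F
      using 1 by (intro tree_representation.intro tree_representation_axioms.intro tree_action_axioms) auto
    show ?case
      by (rule representation_conclusion)
  qed
qed

end
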